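(* Assume $\alpha\in(\frac12,1)\cup(1,2)$. Let $X_t$ and $\tilde X_t$ be stable processes with parameters $(\alpha,\rho)$ and $(\frac1\alpha,\alpha\rho)$ (both pairs belonging to $\mathcal A$), with supremum processes $S_t$ and $\tilde S_t$. Then the following identity in distribution holds: $$\varepsilon_1\left[\frac{S_1}{\varepsilon_2}\right]^\alpha\overset{d}{=}\varepsilon_3^\alpha\left[\frac{\tilde S_1}{\varepsilon_4}\right],$$ where $\varepsilon_i\sim\mathrm{Exp}(1)$ and all random variables are assumed to be independent.
   Context: The admissible set is $\mathcal A=\{\alpha\in(0,1),\rho\in(0,1)\}\cup\{\alpha=1,\rho=\frac12\}\cup\{\alpha\in(1,2),\rho\in[1-\alpha^{-1},\alpha^{-1}]\}$. For $(\alpha,\rho)\in\mathcal A$, the stable process with parameters $(\alpha,\rho)$ is the Lévy process $X_t$ with $X_0=0$, $\mathbb E[e^{izX_t}]=e^{-t\Psi(z)}$, $z\in\mathbb R$, $\Psi(z)=e^{\pi i\gamma/2}|z|^\alpha$ for $z>0$, $\Psi(z)=e^{-\pi i\gamma/2}|z|^\alpha$ for $z<0$, $\gamma=\alpha(1-2\rho)$. Its supremum process is $S_t=\sup\{X_u:0\le u\le t\}$. $\mathrm{Exp}(1)$ is the exponential law with mean $1$. *)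

theory Defs
  imports "HOL-Probability.Probability"
begin

definition cadlag :: "(real \<Rightarrow> real) \<Rightarrow> bool" where
  "cadlag f \<longleftrightarrow>
     (\<forall>t\<ge>0. continuous (at_right t) f) \<and> (\<forall>t>0. \<exists>l. (f \<longlongrightarrow> l) (at_left t))"

text \<open>The time set is \<open>[0, \<infinity>)\<close>; the values \<open>X t\<close> for \<open>t < 0\<close> play no role. Stochastic continuity
  is not listed because it follows from right continuity at \<open>0\<close> and stationarity of the
  increments.\<close>

locale levy_process = prob_space M for M :: "'a measure" +
  fixes X :: "real \<Rightarrow> 'a \<Rightarrow> real"
  assumes measurable_X: "\<And>t. 0 \<le> t \<Longrightarrow> random_variable borel (X t)"
    and start_zero: "AE \<omega> in M. X 0 \<omega> = 0"
    and indep_increments: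
      "\<And>(t :: nat \<Rightarrow> real) n. 0 \<le> t 0 \<Longrightarrow> (\<And>i. i < n \<Longrightarrow> t i \<le> t (Suc i)) \<Longrightarrow>
         indep_vars (\<lambda>_. borel) (\<lambda>i \<omega>. X (t (Suc i)) \<omega> - X (t i) \<omega>) {..<n}"
    and stationary_increments:
      "\<And>s h. 0 \<le> s \<Longrightarrow> 0 \<le> h \<Longrightarrow>
         distr M borel (\<lambda>\<omega>. X (s + h) \<omega> - X s \<omega>) = distr M borel (X h)"
    and cadlag_paths: "AE \<omega> in M. cadlag (\<lambda>t. X t \<omega>)"

definition admissible :: "(real \<times> real) set" where
  "admissible =
     {(\<alpha>, \<rho>). \<alpha> \<in> {0<..<1} \<and> \<rho> \<in> {0<..<1}} \<union>
     {(1, 1/2)} \<union>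
     {(\<alpha>, \<rho>). \<alpha> \<in> {1<..<2} \<and> \<rho> \<in> {1 - 1/\<alpha>..1/\<alpha>}}"

definition stable_exponent :: "real \<Rightarrow> real \<Rightarrow> real \<Rightarrow> complex" where
  "stable_exponent \<alpha> \<rho> z =
     (let \<gamma> = \<alpha> * (1 - 2 * \<rho>) in
      if z > 0 then exp (pi * \<i> * \<gamma> / 2) * complex_of_real (\<bar>z\<bar> powr \<alpha>)
      else if z < 0 then exp (- (pi * \<i> * \<gamma> / 2)) * complex_of_real (\<bar>z\<bar> powr \<alpha>)
      else 0)"

locale stable_process = levy_process M X
  for M :: "'a measure" and X :: "real \<Rightarrow> 'a \<Rightarrow> real" +
  fixes \<alpha> \<rho> :: real
  assumes admissible_params: "(\<alpha>, \<rho>) \<in> admissible"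
    and char_X: "\<And>t z. 0 \<le> t \<Longrightarrow>
      char (distr M borel (X t)) z = exp (- (complex_of_real t * stable_exponent \<alpha> \<rho> z))"

text \<open>Cadlag paths are bounded on compact intervals, so for a Levy process and \<open>0 \<le> t\<close> this real
  supremum is almost surely that of a nonempty bounded set.\<close>

definition sup_process :: "(real \<Rightarrow> 'a \<Rightarrow> real) \<Rightarrow> real \<Rightarrow> 'a \<Rightarrow> real" where
  "sup_process X t \<omega> = (SUP u\<in>{0..t}. X u \<omega>)"

end

theory Submission
  imports Defs "HOL-Complex_Analysis.Cauchy_Integral_Theorem"
begin

text \<open>
  For the stable process with parameters \<open>(\<alpha>, \<rho>)\<close> let \<open>\<phi>(z) = E exp (- z \<epsilon>\<^sub>1 powr (1/\<alpha>) S\<^sub>1)\<close>. By self-similarity this is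
  the Laplace transform of the supremum at an independent exponential time, a Wiener--Hopf factor
  of the process. Since \<open>\<epsilon>\<^sub>2\<close> is exponential, \<open>\<phi>(y powr (- 1/\<alpha>))\<close> is the probability that the left
  side of the claimed identity is below \<open>y\<close>, and \<open>\<phi>'(1/y)\<close>, for the dual process with parameters
  \<open>(1/\<alpha>, \<alpha>\<rho>)\<close>, is the corresponding probability for the right side. The theorem is therefore the
  functional equation \<open>\<phi>(b) = \<phi>'(b powr \<alpha>)\<close> (\<open>sup_transform_dual\<close>), which is a symmetry of an explicit
  integral.

  The integral comes from random walks. Sampling the process on a grid of step \<open>h\<close> gives a random
  walk, and Spitzer's identity (\<open>Spitzer_identity\<close>) expresses the generating function of the laws of
  its running maxima through the positive parts of the walk. Spitzer's identity follows from
  a pointwise identity between positive parts (\<open>Baxter_identity\<close>), which makes the convolution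
  equation for the maxima telescope. A difference of the resulting exponents at two points
  \<open>a < b\<close> involves only \<open>exp (- a x\<^sup>+) - exp (- b x\<^sup>+)\<close>, whose Fourier transform
  \<open>1/(a + it) - 1/(b + it)\<close> is integrable. The exponent is thus an integral against the characteristic
  function, and the sum over the steps of the walk is a logarithm. Letting \<open>h\<close> tend to zero gives
  (\<open>sup_transform_ratio\<close>)
  \<open>\<phi>(b) / \<phi>(a) = exp ((1/2\<pi>) \<integral> Ln (1 + \<Psi>(t)) (1/(a + it) - 1/(b + it)) dt)\<close>.

  With \<open>t = exp s\<close> the integrand becomes holomorphic in a horizontal strip and the line of
  integration may be moved. For \<open>(\<alpha>, \<rho>)\<close> it is moved to the line where \<open>\<Psi>\<close> is positive, for
  \<open>(1/\<alpha>, \<alpha>\<rho>)\<close> to the line where \<open>it\<close> is positive. After an integration by parts in the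
  second case both integrals take the same form, a Poisson kernel of angle \<open>\<pi>\<rho>\<close> integrated against
  \<open>ln (a powr \<alpha> + exp (\<alpha> s)) - ln (b powr \<alpha> + exp (\<alpha> s))\<close> (\<open>wh_integral_dual\<close>). So \<open>\<phi>(b)/\<phi>(a)\<close> and
  \<open>\<phi>'(b powr \<alpha>)/\<phi>'(a powr \<alpha>)\<close> agree, and letting \<open>a\<close> tend to zero removes the denominators.
\<close>

section \<open>Spitzer's identity for random walks\<close>

abbreviation pos_part_law :: "real measure \<Rightarrow> real measure" where
  "pos_part_law \<mu> \<equiv> distr \<mu> borel (max 0)"

text \<open>The laws of the \<open>n\<close>-th position and of the running maximum up to time \<open>n\<close> of a random walk with step
law \<open>\<nu>\<close> started at the origin. The second recursion conditions on the first step: the maximum of a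
walk is the positive part of its first step plus the maximum of the remaining walk.\<close>

primrec walk_law :: "real measure \<Rightarrow> nat \<Rightarrow> real measure" where
  "walk_law \<nu> 0 = return borel 0"
| "walk_law \<nu> (Suc n) = (\<nu> \<star> walk_law \<nu> n)"

primrec max_law :: "real measure \<Rightarrow> nat \<Rightarrow> real measure" where
  "max_law \<nu> 0 = return borel 0"
| "max_law \<nu> (Suc n) = pos_part_law (\<nu> \<star> max_law \<nu> n)"

lemma real_distribution_convolution:
  assumes "real_distribution \<mu>" "real_distribution \<nu>"
  shows "real_distribution (\<mu> \<star> \<nu>)"
proof -
  interpret \<mu>: real_distribution \<mu> by fact
  interpret \<nu>: real_distribution \<nu> by fact
  interpret pair_prob_space \<mu> \<nu> ..
  have "(\<lambda>(x, y). x + y) \<in> borel_measurable (\<mu> \<Otimes>\<^sub>M \<nu>)"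
    by measurable
  from P.real_distribution_distr[OF this] show ?thesis
    unfolding convolution_def .
qed

lemma real_distribution_pos_part: "real_distribution \<mu> \<Longrightarrow> real_distribution (pos_part_law \<mu>)"
proof -
  assume "real_distribution \<mu>"
  then interpret \<mu>: real_distribution \<mu> .
  show ?thesis by (rule \<mu>.real_distribution_distr) simp
qed

lemma real_distribution_return0: "real_distribution (return borel (0::real))"
  by (auto simp: real_distribution_def real_distribution_axioms_def prob_space_return)

lemma real_distribution_walk_law: "real_distribution \<nu> \<Longrightarrow> real_distribution (walk_law \<nu> n)"
  by (induction n) (auto intro: real_distribution_return0 real_distribution_convolution)

lemma real_distribution_max_law: "real_distribution \<nu> \<Longrightarrow> real_distribution (max_law \<nu> n)"
  by (induction n)
    (auto intro: real_distribution_return0 real_distribution_pos_part real_distribution_convolution)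

lemma real_distribution_integrable_bounded:
  fixes f :: "real \<Rightarrow> real"
  assumes "real_distribution \<mu>" "f \<in> borel_measurable borel" "\<And>x. \<bar>f x\<bar> \<le> B"
  shows "integrable \<mu> f"
proof -
  interpret real_distribution \<mu> by fact
  show ?thesis using assms by (intro integrable_const_bound[where B=B]) auto
qed

lemma integral_convolution:
  fixes f :: "real \<Rightarrow> real"
  assumes "real_distribution \<mu>" "real_distribution \<nu>"
    and [measurable]: "f \<in> borel_measurable borel" and "\<And>x. \<bar>f x\<bar> \<le> B"
  shows "(\<integral>z. f z \<partial>(\<mu> \<star> \<nu>)) = (\<integral>x. (\<integral>y. f (x + y) \<partial>\<nu>) \<partial>\<mu>)"
proof -
  interpret \<mu>: real_distribution \<mu> by fact
  interpret \<nu>: real_distribution \<nu> by fact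
  interpret pair_prob_space \<mu> \<nu> ..
  have "(\<integral>z. f z \<partial>(\<mu> \<star> \<nu>)) = (\<integral>p. f (fst p + snd p) \<partial>(\<mu> \<Otimes>\<^sub>M \<nu>))"
    unfolding convolution_def by (subst integral_distr) (auto simp: case_prod_beta)
  also have "\<dots> = (\<integral>x. (\<integral>y. f (x + y) \<partial>\<nu>) \<partial>\<mu>)"
    using assms(4) by (subst integral_fst'[symmetric]) (auto intro!: P.integrable_const_bound[where B=B])
  finally show ?thesis .
qed

lemma pos_part_convolution:
  assumes "real_distribution \<mu>" "real_distribution \<nu>"
  shows "(pos_part_law \<mu> \<star> pos_part_law \<nu>) =
           distr (\<mu> \<Otimes>\<^sub>M \<nu>) borel (\<lambda>p. max 0 (fst p) + max 0 (snd p))"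
    and "(\<mu> \<star> pos_part_law \<nu>) = distr (\<mu> \<Otimes>\<^sub>M \<nu>) borel (\<lambda>p. fst p + max 0 (snd p))"
    and "(pos_part_law \<mu> \<star> \<nu>) = distr (\<mu> \<Otimes>\<^sub>M \<nu>) borel (\<lambda>p. max 0 (fst p) + snd p)"
proof -
  interpret \<mu>: real_distribution \<mu> by fact
  interpret \<nu>: real_distribution \<nu> by fact
  interpret pair_prob_space \<mu> \<nu> ..
  interpret \<mu>': real_distribution "pos_part_law \<mu>" by (rule real_distribution_pos_part) fact
  interpret \<nu>': real_distribution "pos_part_law \<nu>" by (rule real_distribution_pos_part) fact
  have *: "distr \<mu> borel (\<lambda>x. x) = \<mu>" "distr \<nu> borel (\<lambda>x. x) = \<nu>"
    by (simp_all add: distr_id2)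
  have 1: "pos_part_law \<mu> \<Otimes>\<^sub>M pos_part_law \<nu> =
      distr (\<mu> \<Otimes>\<^sub>M \<nu>) (borel \<Otimes>\<^sub>M borel) (\<lambda>(x, y). (max 0 x, max 0 y))"
    by (rule pair_measure_distr) (auto simp: \<nu>'.sigma_finite_measure_axioms)
  have 2: "\<mu> \<Otimes>\<^sub>M pos_part_law \<nu> =
      distr (\<mu> \<Otimes>\<^sub>M \<nu>) (borel \<Otimes>\<^sub>M borel) (\<lambda>(x, y). (x, max 0 y))"
    by (rule pair_measure_distr[of "\<lambda>x. x" \<mu> borel "max 0" \<nu> borel, unfolded *])
      (rule \<nu>'.sigma_finite_measure_axioms | simp)+
  have 3: "pos_part_law \<mu> \<Otimes>\<^sub>M \<nu> =
      distr (\<mu> \<Otimes>\<^sub>M \<nu>) (borel \<Otimes>\<^sub>M borel) (\<lambda>(x, y). (max 0 x, y))"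
    by (rule pair_measure_distr[of "max 0" \<mu> borel "\<lambda>x. x" \<nu> borel, unfolded *])
      (rule \<nu>.sigma_finite_measure_axioms | simp)+
  show "(pos_part_law \<mu> \<star> pos_part_law \<nu>) =
           distr (\<mu> \<Otimes>\<^sub>M \<nu>) borel (\<lambda>p. max 0 (fst p) + max 0 (snd p))"
    unfolding convolution_def 1 by (subst distr_distr) (auto simp: comp_def case_prod_beta)
  show "(\<mu> \<star> pos_part_law \<nu>) = distr (\<mu> \<Otimes>\<^sub>M \<nu>) borel (\<lambda>p. fst p + max 0 (snd p))"
    unfolding convolution_def 2 by (subst distr_distr) (auto simp: comp_def case_prod_beta)
  show "(pos_part_law \<mu> \<star> \<nu>) = distr (\<mu> \<Otimes>\<^sub>M \<nu>) borel (\<lambda>p. max 0 (fst p) + snd p)"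
    unfolding convolution_def 3 by (subst distr_distr) (auto simp: comp_def case_prod_beta)
qed

text \<open>The linear map sending a measure to the law of the positive part is a Rota--Baxter operator for
convolution. This holds because the unordered pairs \<open>{x\<^sup>+ + y\<^sup>+, (x + y)\<^sup>+}\<close> and
\<open>{(x + y\<^sup>+)\<^sup>+, (x\<^sup>+ + y)\<^sup>+}\<close> coincide for all reals \<open>x\<close> and \<open>y\<close>.\<close>

lemma Baxter_identity:
  fixes f :: "real \<Rightarrow> real"
  assumes "real_distribution \<mu>" "real_distribution \<nu>"
    and [measurable]: "f \<in> borel_measurable borel" and B: "\<And>x. \<bar>f x\<bar> \<le> B"
  shows "integral\<^sup>L (pos_part_law \<mu> \<star> pos_part_law \<nu>) f + integral\<^sup>L (pos_part_law (\<mu> \<star> \<nu>)) f =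
         integral\<^sup>L (pos_part_law (\<mu> \<star> pos_part_law \<nu>)) f +
         integral\<^sup>L (pos_part_law (pos_part_law \<mu> \<star> \<nu>)) f"
proof -
  interpret \<mu>: real_distribution \<mu> by fact
  interpret \<nu>: real_distribution \<nu> by fact
  interpret pair_prob_space \<mu> \<nu> ..
  have int: "integrable (\<mu> \<Otimes>\<^sub>M \<nu>) (\<lambda>p. f (g p))" if [measurable]: "g \<in> borel_measurable (\<mu> \<Otimes>\<^sub>M \<nu>)" for g
    using B by (intro P.integrable_const_bound[where B=B]) auto
  have "integral\<^sup>L (pos_part_law \<mu> \<star> pos_part_law \<nu>) f + integral\<^sup>L (pos_part_law (\<mu> \<star> \<nu>)) f =
     (\<integral>p. f (max 0 (fst p) + max 0 (snd p)) + f (max 0 (fst p + snd p)) \<partial>(\<mu> \<Otimes>\<^sub>M \<nu>))"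
    unfolding pos_part_convolution[OF assms(1,2)] unfolding convolution_def
    by (subst Bochner_Integration.integral_add)
      (auto simp: integral_distr distr_distr case_prod_beta intro!: int)
  also have "\<dots> = (\<integral>p. f (max 0 (fst p + max 0 (snd p))) + f (max 0 (max 0 (fst p) + snd p)) \<partial>(\<mu> \<Otimes>\<^sub>M \<nu>))"
    by (intro Bochner_Integration.integral_cong refl) (auto simp: max_def)
  also have "\<dots> = integral\<^sup>L (pos_part_law (\<mu> \<star> pos_part_law \<nu>)) f +
         integral\<^sup>L (pos_part_law (pos_part_law \<mu> \<star> \<nu>)) f"
    unfolding pos_part_convolution[OF assms(1,2)]
    by (subst Bochner_Integration.integral_add)
      (auto simp: integral_distr distr_distr case_prod_beta intro!: int)
  finally show ?thesis .
qed

lemma convolution_return0: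
  assumes "real_distribution \<mu>"
  shows "(\<mu> \<star> return borel 0) = \<mu>"
proof (rule measure_eqI)
  interpret \<mu>: real_distribution \<mu> by fact
  interpret r: prob_space "return borel (0::real)" by (rule prob_space_return) simp
  show "sets (\<mu> \<star> return borel 0) = sets \<mu>" by simp
  fix A assume "A \<in> sets (\<mu> \<star> return borel 0)"
  then have A [measurable]: "A \<in> sets borel" by simp
  have "emeasure (\<mu> \<star> return borel 0) A = (\<integral>\<^sup>+x. emeasure (return borel 0) {a. a + x \<in> A} \<partial>\<mu>)"
    by (rule convolution_emeasure) (auto intro: \<mu>.finite_measure_axioms r.finite_measure_axioms)
  also have "\<dots> = (\<integral>\<^sup>+x. indicator A x \<partial>\<mu>)"
    by (intro nn_integral_cong) (auto simp: indicator_def)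
  finally show "emeasure (\<mu> \<star> return borel 0) A = emeasure \<mu> A" by simp
qed

text \<open>The coefficient form of Spitzer's identity. Applying \<open>Baxter_identity\<close> to the \<open>k\<close>-th walk law and
\<open>\<nu> \<star> max_law \<nu> (n - k)\<close> writes the \<open>k\<close>-th summand for \<open>n + 1\<close> as a telescoping difference plus a term
that the induction hypothesis sums, so that the total increases from \<open>n\<close> to \<open>n + 1\<close> copies of the
integral.\<close>

lemma Spitzer_recursion:
  fixes f :: "real \<Rightarrow> real"
  assumes nu: "real_distribution \<nu>"
    and f [measurable]: "f \<in> borel_measurable borel" and B: "\<And>x. \<bar>f x\<bar> \<le> B"
  shows "real n * integral\<^sup>L (max_law \<nu> n) f =
    (\<Sum>k=1..n. integral\<^sup>L (pos_part_law (walk_law \<nu> k) \<star> max_law \<nu> (n - k)) f)"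
  using f B
proof (induction n arbitrary: f)
  case 0
  then show ?case by simp
next
  case (Suc n f)
  note [measurable] = Suc.prems(1)
  define m where "m = max_law \<nu>"
  define w where "w = walk_law \<nu>"
  have [simp]: "real_distribution (m k)" "real_distribution (w k)" "real_distribution \<nu>"
      "real_distribution (pos_part_law (w k))" for k
    unfolding m_def w_def by (auto intro!: real_distribution_walk_law real_distribution_max_law
       real_distribution_pos_part nu)
  have fin [simp]: "finite_measure \<mu>" "sets \<mu> = sets borel" if "real_distribution \<mu>" for \<mu>
    using that by (auto simp: real_distribution_def real_distribution_axioms_def prob_space.finite_measure)
  have mS: "m (Suc k) = pos_part_law (\<nu> \<star> m k)" and wS: "w (Suc k) = (\<nu> \<star> w k)" for k
    by (simp_all add: m_def w_def)
  have split_term: "integral\<^sup>L (pos_part_law (w k) \<star> m (Suc n - k)) f =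
      integral\<^sup>L (pos_part_law (w k \<star> m (Suc n - k))) f
      - integral\<^sup>L (pos_part_law (w (Suc k) \<star> m (Suc n - Suc k))) f
      + integral\<^sup>L (pos_part_law (\<nu> \<star> (pos_part_law (w k) \<star> m (n - k)))) f"
    if "k \<in> {1..n}" for k
  proof -
    from that have k: "Suc n - k = Suc (n - k)" by auto
    have assoc: "(w k \<star> (\<nu> \<star> m (n-k))) = (w (Suc k) \<star> m (n - k))"
      unfolding wS
      by (subst convolution_commutative[of \<nu> "w k"], simp_all)
        (subst convolution_associative, simp_all)
    have comm: "(pos_part_law (w k) \<star> (\<nu> \<star> m (n-k))) = (\<nu> \<star> (pos_part_law (w k) \<star> m (n - k)))"
      by (subst (1 2) convolution_associative, simp_all)
        (subst convolution_commutative[of \<nu>], simp_all)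
    show ?thesis
      using Baxter_identity[of "w k" "\<nu> \<star> m (n - k)" f B, OF _ _ Suc.prems]
      unfolding assoc comm unfolding k mS by (simp add: real_distribution_convolution)
  qed
  \<comment> \<open>The first two terms of the splitting telescope; the third sums to a multiple of the integral over
    \<open>max_law \<nu> (Suc n)\<close> by the induction hypothesis under the outer integral over the first step.\<close>
  have tel: "(\<Sum>k=1..n. integral\<^sup>L (pos_part_law (w k \<star> m (Suc n - k))) f
      - integral\<^sup>L (pos_part_law (w (Suc k) \<star> m (Suc n - Suc k))) f) =
     integral\<^sup>L (pos_part_law (w 1 \<star> m n)) f - integral\<^sup>L (pos_part_law (w (Suc n) \<star> m 0)) f"
  proof -
    have "(\<Sum>k=1..n. g k - g (Suc k)) = g 1 - g (Suc n)" for g :: "nat \<Rightarrow> real"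
      by (induction n) auto
    from this[of "\<lambda>k. integral\<^sup>L (pos_part_law (w k \<star> m (Suc n - k))) f"] show ?thesis by simp
  qed
  have inner: "integral\<^sup>L (pos_part_law (\<nu> \<star> \<mu>)) f = (\<integral>x. (\<integral>y. f (max 0 (x + y)) \<partial>\<mu>) \<partial>\<nu>)"
    if "real_distribution \<mu>" for \<mu>
    using integral_convolution[OF nu that, of "\<lambda>z. f (max 0 z)" B] Suc.prems(2)
    by (simp add: integral_distr)
  have int: "integrable \<nu> (\<lambda>x. (\<integral>y. f (max 0 (x + y)) \<partial>\<mu>))" if "real_distribution \<mu>" for \<mu>
  proof (rule real_distribution_integrable_bounded[OF nu, where B=B])
    interpret \<mu>: real_distribution \<mu> by fact
    show "(\<lambda>x. (\<integral>y. f (max 0 (x + y)) \<partial>\<mu>)) \<in> borel_measurable borel"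
      by measurable
    fix x
    have "\<bar>\<integral>y. f (max 0 (x + y)) \<partial>\<mu>\<bar> \<le> (\<integral>y. B \<partial>\<mu>)"
      using Suc.prems(2)
      by (intro order_trans[OF integral_abs_bound] integral_mono
          real_distribution_integrable_bounded[OF that, where B=B]) (auto intro: order_trans[OF abs_ge_zero])
    then show "\<bar>\<integral>y. f (max 0 (x + y)) \<partial>\<mu>\<bar> \<le> B" 
      using \<mu>.prob_space by simp
  qed
  have "(\<Sum>k=1..n. integral\<^sup>L (pos_part_law (\<nu> \<star> (pos_part_law (w k) \<star> m (n - k)))) f) =
      (\<Sum>k=1..n. (\<integral>x. (\<integral>y. f (max 0 (x + y)) \<partial>(pos_part_law (w k) \<star> m (n - k))) \<partial>\<nu>))"
    by (intro sum.cong refl inner real_distribution_convolution) auto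
  also have "\<dots> = (\<integral>x. (\<Sum>k=1..n. (\<integral>y. f (max 0 (x + y)) \<partial>(pos_part_law (w k) \<star> m (n - k)))) \<partial>\<nu>)"
    by (intro Bochner_Integration.integral_sum[symmetric] int real_distribution_convolution) auto
  also have "\<dots> = (\<integral>x. real n * (\<integral>y. f (max 0 (x + y)) \<partial>m n) \<partial>\<nu>)"
    unfolding m_def w_def by (intro Bochner_Integration.integral_cong refl Suc.IH[symmetric] Suc.prems) simp
  also have "\<dots> = real n * integral\<^sup>L (m (Suc n)) f"
    unfolding mS by (subst inner) auto
  finally have rest: "(\<Sum>k=1..n. integral\<^sup>L (pos_part_law (\<nu> \<star> (pos_part_law (w k) \<star> m (n - k)))) f) =
      real n * integral\<^sup>L (m (Suc n)) f" .
  have ends: "(w 1 \<star> m n) = (\<nu> \<star> m n)" "(w (Suc n) \<star> m 0) = w (Suc n)"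
       "(pos_part_law (w (Suc n)) \<star> m 0) = pos_part_law (w (Suc n))"
  proof -
    have "w 1 = \<nu>" unfolding w_def using convolution_return0[OF nu] by simp
    then show "(w 1 \<star> m n) = (\<nu> \<star> m n)" by simp
    have m0: "m 0 = return borel 0" by (simp add: m_def)
    show "(w (Suc n) \<star> m 0) = w (Suc n)" unfolding m0 by (rule convolution_return0) simp
    show "(pos_part_law (w (Suc n)) \<star> m 0) = pos_part_law (w (Suc n))"
      unfolding m0 by (rule convolution_return0) simp
  qed
  have "(\<Sum>k=1..Suc n. integral\<^sup>L (pos_part_law (w k) \<star> m (Suc n - k)) f) =
    (\<Sum>k=1..n. integral\<^sup>L (pos_part_law (w k) \<star> m (Suc n - k)) f) + integral\<^sup>L (pos_part_law (w (Suc n)) \<star> m 0) f"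
    by simp
  also have "(\<Sum>k=1..n. integral\<^sup>L (pos_part_law (w k) \<star> m (Suc n - k)) f) =
     (\<Sum>k=1..n. integral\<^sup>L (pos_part_law (w k \<star> m (Suc n - k))) f
      - integral\<^sup>L (pos_part_law (w (Suc k) \<star> m (Suc n - Suc k))) f) + real n * integral\<^sup>L (m (Suc n)) f"
    unfolding rest[symmetric] sum.distrib[symmetric] by (intro sum.cong refl split_term)
  also have "\<dots> + integral\<^sup>L (pos_part_law (w (Suc n)) \<star> m 0) f = real (Suc n) * integral\<^sup>L (m (Suc n)) f"
    unfolding tel ends mS[symmetric] by (simp add: algebra_simps)
  finally show ?case
    unfolding m_def w_def by simp
qed

text \<open>The recursion is the coefficient form of the differential equation \<open>F' = G' F\<close> for the two power
series, so \<open>F exp (- G)\<close> is constant.\<close>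

lemma exp_power_series_of_recursion:
  fixes c p :: "nat \<Rightarrow> real"
  assumes c: "\<And>n. \<bar>c n\<bar> \<le> 1" and p: "\<And>n. \<bar>p n\<bar> \<le> 1" and c0: "c 0 = 1"
    and rec: "\<And>n. real n * c n = (\<Sum>k=1..n. p k * c (n - k))"
    and r: "0 \<le> r" "r < 1"
  shows "(\<Sum>n. c n * r ^ n) = exp (\<Sum>k. p k / real k * r ^ k)"
proof -
  define F where "F x = (\<Sum>n. c n * x ^ n)" for x
  define G where "G x = (\<Sum>n. p n / real n * x ^ n)" for x
  have pk: "\<bar>p n / real n\<bar> \<le> 1" for n
    using p[of n] by (cases "n = 0") (auto simp: abs_divide divide_le_eq)
  have summ: "summable (\<lambda>n. \<bar>d n * x ^ n\<bar>)" if "\<And>n. \<bar>d n\<bar> \<le> 1" "\<bar>x\<bar> < 1" for d :: "nat \<Rightarrow> real" and x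
    by (rule summable_comparison_test'[of "\<lambda>n. \<bar>x\<bar> ^ n" 0])
      (use that in \<open>auto simp: abs_mult power_abs intro!: summable_geometric mult_left_le_one_le\<close>)
  have summ': "summable (\<lambda>n. d n * x ^ n)" if "\<And>n. \<bar>d n\<bar> \<le> 1" "\<bar>x\<bar> < 1" for d :: "nat \<Rightarrow> real" and x
    using summ[OF that] by (rule summable_rabs_cancel)
  have dp: "diffs (\<lambda>n. p n / real n) n = p (Suc n)" for n
    by (simp add: diffs_def)
  have rec': "diffs c n = (\<Sum>k\<le>n. p (Suc k) * c (n - k))" for n
  proof -
    have "diffs c n = (\<Sum>k=1..Suc n. p k * c (Suc n - k))"
      using rec[of "Suc n"] by (simp add: diffs_def)
    also have "\<dots> = (\<Sum>k\<le>n. p (Suc k) * c (n - k))"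
      by (subst sum.atLeast_Suc_atMost_Suc_shift[of _ 0, unfolded One_nat_def[symmetric]] )
        (auto simp: atMost_atLeast0)
    finally show ?thesis .
  qed
  have der: "(F has_real_derivative (\<Sum>n. p (Suc n) * x ^ n) * F x) (at x)"
            "(G has_real_derivative (\<Sum>n. p (Suc n) * x ^ n)) (at x)" if x1: "\<bar>x\<bar> < 1" for x
  proof -
    obtain K where K: "\<bar>x\<bar> < K" "K < 1" using dense[OF x1] by blast
    have "(F has_real_derivative (\<Sum>n. diffs c n * x ^ n)) (at x)"
      unfolding F_def using K by (intro termdiffs_strong[where K=K] summ' c) auto
    moreover have "(\<Sum>n. diffs c n * x ^ n) = (\<Sum>n. p (Suc n) * x ^ n) * F x"
    proof -
      have "(\<Sum>n. p (Suc n) * x ^ n) * F x = (\<Sum>n. \<Sum>i\<le>n. (p (Suc i) * x ^ i) * (c (n - i) * x ^ (n - i)))"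
        unfolding F_def using summ[of "\<lambda>n. p (Suc n)" x] summ[of c x] p c x1
        by (intro Cauchy_product) auto
      also have "\<dots> = (\<Sum>n. diffs c n * x ^ n)"
        unfolding rec' sum_distrib_right
        by (intro suminf_cong sum.cong refl) (simp add: power_add[symmetric])
      finally show ?thesis ..
    qed
    ultimately show "(F has_real_derivative (\<Sum>n. p (Suc n) * x ^ n) * F x) (at x)" by simp
    have "(G has_real_derivative (\<Sum>n. diffs (\<lambda>n. p n / real n) n * x ^ n)) (at x)"
      unfolding G_def using K by (intro termdiffs_strong[where K=K] summ' pk) auto
    then show "(G has_real_derivative (\<Sum>n. p (Suc n) * x ^ n)) (at x)"
      by (simp add: dp)
  qed
  have "F r * exp (- G r) = F 0 * exp (- G 0)"
  proof (rule DERIV_isconst3[of "-1" 1 r 0 "\<lambda>x. F x * exp (- G x)"])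
    fix x :: real assume "x \<in> {-1<..<1}"
    then have x: "\<bar>x\<bar> < 1" by auto
    show "((\<lambda>x. F x * exp (- G x)) has_real_derivative 0) (at x)"
      using der[OF x] by (auto intro!: derivative_eq_intros simp: algebra_simps)
  qed (use r in auto)
  moreover have "F 0 = 1" "G 0 = 0"
    using powser_zero[of c] powser_zero[of "\<lambda>n. p n / real n"] c0 by (simp_all add: F_def G_def)
  ultimately show ?thesis
    by (simp add: F_def G_def exp_minus field_simps)
qed

text \<open>Spitzer's identity needs this because \<open>exp (- a x\<^sup>+)\<close> turns sums into products only when both
summands are nonnegative.\<close>

lemma AE_max_law_nonneg:
  assumes "real_distribution \<nu>"
  shows "AE x in max_law \<nu> n. 0 \<le> x"
proof (cases n)
  case 0
  show ?thesis unfolding 0 max_law.simps by (subst AE_return) auto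
next
  case (Suc k)
  show ?thesis unfolding Suc max_law.simps by (subst AE_distr_iff) auto
qed

theorem Spitzer_identity:
  assumes nu: "real_distribution \<nu>" and a: "0 \<le> a" and r: "0 \<le> r" "r < 1"
  shows "(\<Sum>n. (\<integral>x. exp (- a * x) \<partial>max_law \<nu> n) * r ^ n) =
         exp (\<Sum>k. (\<integral>x. exp (- a * max 0 x) \<partial>walk_law \<nu> k) / real k * r ^ k)"
proof -
  define f where "f = (\<lambda>x::real. exp (- a * max 0 x))"
  have f [measurable]: "f \<in> borel_measurable borel" by (simp add: f_def)
  have f1: "\<bar>f x\<bar> \<le> 1" for x using a by (simp add: f_def)
  note w = real_distribution_walk_law[OF nu] and m = real_distribution_max_law[OF nu]
  have bound: "\<bar>integral\<^sup>L \<mu> f\<bar> \<le> 1" if "real_distribution \<mu>" for \<mu>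
  proof -
    interpret \<mu>: real_distribution \<mu> by fact
    have "\<bar>integral\<^sup>L \<mu> f\<bar> \<le> (\<integral>y. 1 \<partial>\<mu>)"
      using f1
      by (intro order_trans[OF integral_abs_bound] integral_mono
          real_distribution_integrable_bounded[OF that, where B=1]) auto
    then show ?thesis using \<mu>.prob_space by simp
  qed
  have split: "integral\<^sup>L (pos_part_law (walk_law \<nu> k) \<star> max_law \<nu> j) f =
     integral\<^sup>L (walk_law \<nu> k) f * integral\<^sup>L (max_law \<nu> j) f" for k j
  proof -
    interpret wk: real_distribution "walk_law \<nu> k" by (rule w)
    interpret mj: real_distribution "max_law \<nu> j" by (rule m)
    have "integral\<^sup>L (pos_part_law (walk_law \<nu> k) \<star> max_law \<nu> j) f =
       (\<integral>x. (\<integral>y. f (max 0 x + y) \<partial>max_law \<nu> j) \<partial>walk_law \<nu> k)"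
      using integral_convolution[OF real_distribution_pos_part[OF w] m f f1]
      by (simp add: integral_distr)
    also have "\<dots> = (\<integral>x. (\<integral>y. f x * f y \<partial>max_law \<nu> j) \<partial>walk_law \<nu> k)"
    proof (rule Bochner_Integration.integral_cong[OF refl integral_cong_AE])
      fix x
      show "AE y in max_law \<nu> j. f (max 0 x + y) = f x * f y"
        using AE_max_law_nonneg[OF nu] 
        by eventually_elim (simp add: f_def algebra_simps exp_add[symmetric])
    qed (auto)
    finally show ?thesis by simp
  qed
  have "(\<Sum>n. integral\<^sup>L (max_law \<nu> n) f * r ^ n) =
        exp (\<Sum>k. integral\<^sup>L (walk_law \<nu> k) f / real k * r ^ k)"
  proof (rule exp_power_series_of_recursion[OF bound[OF m] bound[OF w] _ _ r])
    show "integral\<^sup>L (max_law \<nu> 0) f = 1"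
      by (simp add: integral_return f_def)
    show "real n * integral\<^sup>L (max_law \<nu> n) f =
        (\<Sum>k=1..n. integral\<^sup>L (walk_law \<nu> k) f * integral\<^sup>L (max_law \<nu> (n - k)) f)" for n
      unfolding Spitzer_recursion[OF nu f f1] split ..
  qed
  moreover have "integral\<^sup>L (max_law \<nu> n) f = (\<integral>x. exp (- a * x) \<partial>max_law \<nu> n)" for n
  proof (rule integral_cong_AE)
    interpret mj: real_distribution "max_law \<nu> n" by (rule m)
    show "AE x in max_law \<nu> n. f x = exp (- a * x)"
      using AE_max_law_nonneg[OF nu] by eventually_elim (simp add: f_def)
    show "f \<in> borel_measurable (max_law \<nu> n)" "(\<lambda>x. exp (- a * x)) \<in> borel_measurable (max_law \<nu> n)"
      by auto
  qed
  ultimately show ?thesis by (simp add: f_def)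
qed

section \<open>Random walks: characteristic functions and maxima\<close>

lemma char_convolution:
  assumes "real_distribution \<mu>" "real_distribution \<nu>"
  shows "char (\<mu> \<star> \<nu>) t = char \<mu> t * char \<nu> t"
proof -
  interpret \<mu>: real_distribution \<mu> by fact
  interpret \<nu>: real_distribution \<nu> by fact
  interpret pair_prob_space \<mu> \<nu> ..
  have "char (\<mu> \<star> \<nu>) t = (\<integral>p. iexp (t * (fst p + snd p)) \<partial>(\<mu> \<Otimes>\<^sub>M \<nu>))"
    unfolding char_def convolution_def by (subst integral_distr) (auto simp: case_prod_beta)
  also have "\<dots> = (\<integral>x. (\<integral>y. iexp (t * (x + y)) \<partial>\<nu>) \<partial>\<mu>)"
    by (subst integral_fst'[symmetric]) (auto intro!: P.integrable_const_bound[where B=1])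
  also have "\<dots> = (\<integral>x. iexp (t * x) * char \<nu> t \<partial>\<mu>)"
    unfolding char_def
    by (intro Bochner_Integration.integral_cong refl)
      (simp add: distrib_left exp_add flip: integral_mult_right_zero)
  finally show ?thesis by (simp add: char_def)
qed

lemma char_walk_law:
  assumes "real_distribution \<nu>"
  shows "char (walk_law \<nu> k) t = char \<nu> t ^ k"
proof (induction k)
  case 0
  then show ?case by (simp add: char_def integral_return)
next
  case (Suc k)
  then show ?case
    by (simp add: char_convolution assms real_distribution_walk_law)
qed

text \<open>The maximum of the walk over its last \<open>j\<close> steps, relative to the position before them. Steps are
consumed backwards from index \<open>n - 1\<close>, so that each new step is independent of the maximum already
formed.\<close>

primrec running_max :: "nat \<Rightarrow> (nat \<Rightarrow> real) \<Rightarrow> nat \<Rightarrow> real" where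
  "running_max n \<xi> 0 = 0"
| "running_max n \<xi> (Suc j) = max 0 (\<xi> (n - Suc j) + running_max n \<xi> j)"

lemma running_max_cong:
  "(\<And>i. n - j \<le> i \<Longrightarrow> i < n \<Longrightarrow> \<xi> i = \<xi>' i) \<Longrightarrow> j \<le> n \<Longrightarrow> running_max n \<xi> j = running_max n \<xi>' j"
  by (induction j) auto

lemma running_max_measurable:
  "j \<le> n \<Longrightarrow> (\<lambda>\<xi>. running_max n \<xi> j) \<in> borel_measurable (PiM {n - j..<n} (\<lambda>_. borel))"
proof (induction j)
  case (Suc j)
  have sub: "{n - j..<n} \<subseteq> {n - Suc j..<n}" by auto
  have 1: "(\<lambda>\<xi>. running_max n (restrict \<xi> {n - j..<n}) j) \<in> borel_measurable (PiM {n - Suc j..<n} (\<lambda>_. borel))"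
    using Suc.prems by (intro measurable_compose[OF measurable_restrict_subset[OF sub] Suc.IH]) simp
  have 2: "running_max n (restrict \<xi> {n - j..<n}) j = running_max n \<xi> j" for \<xi>
    using Suc.prems by (intro running_max_cong) auto
  have "(\<lambda>\<xi>. \<xi> (n - Suc j)) \<in> borel_measurable (PiM {n - Suc j..<n} (\<lambda>_. borel :: real measure))"
    using Suc.prems by (intro measurable_component_singleton) auto
  then show ?case using 1 unfolding 2 by simp
qed simp

lemma running_max_eq:
  fixes y :: "nat \<Rightarrow> real"
  assumes "j \<le> n"
  shows "running_max n (\<lambda>i. y (Suc i) - y i) j = Max ((\<lambda>k. y k - y (n - j)) ` {n - j..n})"
  using assms
proof (induction j)
  case (Suc j)
  define m where "m = n - Suc j"
  have m: "n - j = Suc m" "{m..n} = insert m {Suc m..n}" "{Suc m..n} \<noteq> {}"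
    using Suc.prems by (auto simp: m_def)
  have "running_max n (\<lambda>i. y (Suc i) - y i) (Suc j) = max 0 ((y (Suc m) - y m) + Max ((\<lambda>k. y k - y (Suc m)) ` {Suc m..n}))"
    using Suc by (simp add: m_def[symmetric] m(1))
  also have "(y (Suc m) - y m) + Max ((\<lambda>k. y k - y (Suc m)) ` {Suc m..n}) = Max ((\<lambda>k. y k - y m) ` {Suc m..n})"
  proof -
    have "(y (Suc m) - y m) + Max ((\<lambda>k. y k - y (Suc m)) ` {Suc m..n}) =
       Max ((\<lambda>v. v + (y (Suc m) - y m)) ` ((\<lambda>k. y k - y (Suc m)) ` {Suc m..n}))"
      using m(3) by (subst mono_Max_commute[symmetric, where f="\<lambda>v. v + (y (Suc m) - y m)"]) (auto simp: mono_def)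
    then show ?thesis by (simp add: image_image)
  qed
  also have "max 0 \<dots> = Max ((\<lambda>k. y k - y m) ` {m..n})"
    unfolding m(2) using m(3) by simp
  finally show ?case unfolding m_def .
qed simp

lemma (in prob_space) distr_running_max:
  assumes ind: "indep_vars (\<lambda>_. borel) \<xi> {..<n}"
    and law: "\<And>i. i < n \<Longrightarrow> distr M borel (\<xi> i) = \<nu>"
    and j: "j \<le> n"
  shows "distr M borel (\<lambda>\<omega>. running_max n (\<lambda>i. \<xi> i \<omega>) j) = max_law \<nu> j"
  using j
proof (induction j)
  case 0
  show ?case
  proof (rule measure_eqI)
    fix A assume "A \<in> sets (distr M borel (\<lambda>\<omega>. running_max n (\<lambda>i. \<xi> i \<omega>) 0))"
    then show "emeasure (distr M borel (\<lambda>\<omega>. running_max n (\<lambda>i. \<xi> i \<omega>) 0)) A = emeasure (max_law \<nu> 0) A"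
      by (auto simp: emeasure_distr indicator_def emeasure_space_1)
  qed simp
next
  case (Suc j)
  let ?i = "n - Suc j"
  let ?B = "{n - j..<n}"
  have i: "?i < n" "?i \<in> {..<n}" using Suc.prems by auto
  have rv: "random_variable borel (\<xi> i)" if "i < n" for i
    using ind that unfolding indep_vars_def by auto
  have "indep_var (PiM {?i} (\<lambda>_. borel)) (\<lambda>\<omega>. restrict (\<lambda>i. \<xi> i \<omega>) {?i})
     (PiM ?B (\<lambda>_. borel)) (\<lambda>\<omega>. restrict (\<lambda>i. \<xi> i \<omega>) ?B)"
    using Suc.prems by (intro indep_var_restrict[OF ind]) auto
  then have "indep_var borel ((\<lambda>f. f ?i) \<circ> (\<lambda>\<omega>. restrict (\<lambda>i. \<xi> i \<omega>) {?i}))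
     borel ((\<lambda>f. running_max n f j) \<circ> (\<lambda>\<omega>. restrict (\<lambda>i. \<xi> i \<omega>) ?B))"
  proof (rule indep_var_compose)
    show "(\<lambda>f. running_max n f j) \<in> borel_measurable (PiM ?B (\<lambda>_. borel))"
      using Suc.prems by (intro running_max_measurable) simp
  qed (rule measurable_component_singleton, simp)
  also have "(\<lambda>f. f ?i) \<circ> (\<lambda>\<omega>. restrict (\<lambda>i. \<xi> i \<omega>) {?i}) = \<xi> ?i" by (auto simp: fun_eq_iff)
  also have "(\<lambda>f. running_max n f j) \<circ> (\<lambda>\<omega>. restrict (\<lambda>i. \<xi> i \<omega>) ?B) = (\<lambda>\<omega>. running_max n (\<lambda>i. \<xi> i \<omega>) j)"
    using Suc.prems by (auto simp: fun_eq_iff intro!: running_max_cong)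
  finally have I: "indep_var borel (\<xi> ?i) borel (\<lambda>\<omega>. running_max n (\<lambda>i. \<xi> i \<omega>) j)" .
  have [measurable]: "random_variable borel (\<xi> ?i)" "random_variable borel (\<lambda>\<omega>. running_max n (\<lambda>i. \<xi> i \<omega>) j)"
    using indep_var_rv1[OF I] indep_var_rv2[OF I] by auto
  have "distr M borel (\<lambda>\<omega>. running_max n (\<lambda>i. \<xi> i \<omega>) (Suc j)) =
     pos_part_law (distr M borel (\<lambda>\<omega>. \<xi> ?i \<omega> + running_max n (\<lambda>i. \<xi> i \<omega>) j))"
    by (subst distr_distr) (auto simp: comp_def)
  also have "distr M borel (\<lambda>\<omega>. \<xi> ?i \<omega> + running_max n (\<lambda>i. \<xi> i \<omega>) j) = (\<nu> \<star> max_law \<nu> j)"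
    using sum_indep_random_variable[OF I] Suc law[OF i(1)] by simp
  finally show ?case by simp
qed

lemma (in prob_space) distr_Max_partial_sums:
  assumes ind: "indep_vars (\<lambda>_. borel) (\<lambda>i \<omega>. Y (Suc i) \<omega> - Y i \<omega>) {..<n}"
    and law: "\<And>i. i < n \<Longrightarrow> distr M borel (\<lambda>\<omega>. Y (Suc i) \<omega> - Y i \<omega>) = \<nu>"
  shows "distr M borel (\<lambda>\<omega>. Max ((\<lambda>k. Y k \<omega> - Y 0 \<omega>) ` {..n})) = max_law \<nu> n"
proof -
  have "running_max n (\<lambda>i. Y (Suc i) \<omega> - Y i \<omega>) n = Max ((\<lambda>k. Y k \<omega> - Y 0 \<omega>) ` {..n})" for \<omega>
    using running_max_eq[of n n "\<lambda>k. Y k \<omega>"] by (simp add: atMost_atLeast0)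
  then show ?thesis using distr_running_max[OF ind law, of n] by simp
qed

section \<open>Shifting lines of integration in a strip\<close>

text \<open>Both the shift of the line of integration and the integration by parts below are instances of this
form of the fundamental theorem.\<close>

lemma integral_FTC_real_line:
  fixes f F :: "real \<Rightarrow> 'a :: euclidean_space"
  assumes "\<And>x. (F has_vector_derivative f x) (at x)" "\<And>x. isCont f x"
    and "integrable lborel f" "(F \<longlongrightarrow> A) at_bot" "(F \<longlongrightarrow> B) at_top"
  shows "integral\<^sup>L lborel f = B - A"
proof -
  have "(LBINT x=-\<infinity>..\<infinity>. f x) = B - A"
    using assms by (intro interval_integral_FTC_integrable[where F=F])
      (auto simp: ereal_tendsto_simps set_integrable_def)
  then show ?thesis
    by (simp add: interval_lebesgue_integral_def set_lebesgue_integral_def)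
qed

text \<open>A common integrable majorant in the variable \<open>x = ln t\<close>: it is \<open>t (1 + t) powr (- 3/2)\<close>, which
leaves room for the factor \<open>sqrt (1 + t)\<close> that dominates the logarithm.\<close>

definition envelope :: "real \<Rightarrow> real" where
  "envelope x = exp x * (1 + exp x) powr (-3/2)"

lemma integrable_envelope: "integrable lborel envelope"
proof -
  have "set_integrable lborel (einterval (-\<infinity>) \<infinity>) envelope"
  proof (rule interval_integral_FTC_nonneg(1)[where F="\<lambda>x. - 2 * (1 + exp x) powr (-1/2)" and A="-2" and B=0])
    show "((\<lambda>x. - 2 * (1 + exp x) powr (-1/2)) has_real_derivative envelope x) (at x)" for x
      unfolding envelope_def
      by (auto intro!: derivative_eq_intros simp: add_pos_pos field_simps)
    show "isCont envelope x" for x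
      unfolding envelope_def by (intro continuous_intros) (use exp_gt_zero[of x] in linarith)
    have "((\<lambda>x::real. - 2 * (1 + exp x) powr (-1/2)) \<longlongrightarrow> - 2 * (1 + 0) powr (-1/2)) at_bot"
      by (intro tendsto_intros exp_at_bot) auto
    then show "(((\<lambda>x. - 2 * (1 + exp x) powr (- 1 / 2)) \<circ> real_of_ereal) \<longlongrightarrow> - 2) (at_right (- \<infinity>))"
      by (simp add: ereal_tendsto_simps)
    have "filterlim (\<lambda>x::real. 1 + exp x) at_top at_top"
      by (intro filterlim_tendsto_add_at_top[OF tendsto_const] exp_at_top)
    then have "((\<lambda>x::real. (1 + exp x) powr (-1/2)) \<longlongrightarrow> 0) at_top"
      by (intro tendsto_neg_powr) auto
    from tendsto_mult[OF tendsto_const[of "-2"] this]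
    show "(((\<lambda>x. - 2 * (1 + exp x) powr (- 1 / 2)) \<circ> real_of_ereal) \<longlongrightarrow> 0) (at_left \<infinity>)"
      by (simp add: ereal_tendsto_simps)
  qed (auto simp: envelope_def)
  then show ?thesis by (simp add: set_integrable_def)
qed

lemma envelope_tendsto: "(envelope \<longlongrightarrow> 0) at_bot" "(envelope \<longlongrightarrow> 0) at_top"
proof -
  have "((\<lambda>x::real. exp x * (1 + exp x) powr (-3/2)) \<longlongrightarrow> 0 * (1 + 0) powr (-3/2)) at_bot"
    by (intro tendsto_intros exp_at_bot) auto
  then show "(envelope \<longlongrightarrow> 0) at_bot" by (simp add: envelope_def[abs_def])
  have lim: "filterlim (\<lambda>x::real. 1 + exp x) at_top at_top"
    by (intro filterlim_tendsto_add_at_top[OF tendsto_const] exp_at_top)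
  show "(envelope \<longlongrightarrow> 0) at_top"
  proof (rule tendsto_sandwich[of "\<lambda>_. 0" _ _ "\<lambda>x. (1 + exp x) powr (-1/2)"])
    show "((\<lambda>x::real. (1 + exp x) powr (-1/2)) \<longlongrightarrow> 0) at_top"
      using lim by (intro tendsto_neg_powr) auto
    have "envelope x \<le> (1 + exp x) powr 1 * (1 + exp x) powr (-3/2)" for x
      unfolding envelope_def by (intro mult_right_mono) (auto simp: add_pos_pos)
    also have "(1 + exp x) powr 1 * (1 + exp x) powr (-3/2) = (1 + exp x) powr (-1/2)" for x :: real
      by (subst powr_add[symmetric]) simp
    finally show "\<forall>\<^sub>F x in at_top. envelope x \<le> (1 + exp x) powr (-1/2)" by simp
  qed (auto simp: envelope_def)
qed

text \<open>Cauchy's theorem for an infinite strip. With a primitive \<open>P\<close> of \<open>G\<close>, the difference of the two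
integrands is the derivative of \<open>P (x + iq) - P (x + ip)\<close>, and this vanishes at both ends because the
segment between the two points has fixed length while \<open>G\<close> tends to zero.\<close>

lemma integral_horizontal_line_shift:
  fixes G :: "complex \<Rightarrow> complex"
  assumes "convex S" "open S" and hol: "G holomorphic_on S"
    and S: "\<And>x \<theta>. \<theta> \<in> closed_segment p q \<Longrightarrow> Complex x \<theta> \<in> S"
    and bound: "\<And>x \<theta>. \<theta> \<in> closed_segment p q \<Longrightarrow> cmod (G (Complex x \<theta>)) \<le> K * envelope x"
  shows "integral\<^sup>L lborel (\<lambda>x. G (Complex x p)) = integral\<^sup>L lborel (\<lambda>x. G (Complex x q))"
proof -
  obtain P where P: "\<And>z. z \<in> S \<Longrightarrow> (P has_field_derivative G z) (at z within S)"
    using holomorphic_convex_primitive'[OF assms(1-3)] by metis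
  have P': "(P has_field_derivative G z) (at z)" if "z \<in> S" for z
    using P[OF that] at_within_open[OF that \<open>open S\<close>] by simp
  have cG: "isCont G z" if "z \<in> S" for z
    using holomorphic_on_imp_continuous_on[OF hol] continuous_on_eq_continuous_at[OF \<open>open S\<close>, of G] that by simp
  have cont: "isCont (\<lambda>x. G (Complex x \<theta>)) x" if "\<theta> \<in> closed_segment p q" for x \<theta>
    using S[OF that, of x] unfolding Complex_eq
    by (intro isCont_o2[OF _ cG] continuous_intros) (auto simp: Complex_eq)
  have int: "integrable lborel (\<lambda>x. G (Complex x \<theta>))" if \<theta>: "\<theta> \<in> closed_segment p q" for \<theta>
  proof (rule Bochner_Integration.integrable_bound[of _ "\<lambda>x. K * envelope x"])
    show "(\<lambda>x. G (Complex x \<theta>)) \<in> borel_measurable lborel"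
      using cont[OF \<theta>] by (auto intro!: borel_measurable_continuous_onI continuous_at_imp_continuous_on)
    show "AE x in lborel. cmod (G (Complex x \<theta>)) \<le> norm (K * envelope x)"
      using bound[OF \<theta>] by (intro AE_I2) (auto intro: order_trans[OF _ abs_ge_self])
  qed (intro integrable_mult_right integrable_envelope)
  have der: "((\<lambda>x. P (Complex x \<theta>)) has_vector_derivative G (Complex x \<theta>)) (at x)"
    if "\<theta> \<in> closed_segment p q" for x \<theta>
  proof -
    have "((\<lambda>x. Complex x \<theta>) has_vector_derivative 1) (at x)"
      unfolding Complex_eq by (auto intro!: derivative_eq_intros)
    from field_vector_diff_chain_at[OF this P'[OF S[OF that]]] show ?thesis
      by (simp add: comp_def)
  qed
  have pq: "p \<in> closed_segment p q" "q \<in> closed_segment p q" by auto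
  have diff: "cmod (P (Complex x q) - P (Complex x p)) \<le> K * envelope x * \<bar>q - p\<bar>" for x
  proof -
    have "cmod (P (Complex x q) - P (Complex x p)) \<le> K * envelope x * cmod (Complex x q - Complex x p)"
    proof (rule field_differentiable_bound[where S="closed_segment (Complex x p) (Complex x q)"])
      fix z assume "z \<in> closed_segment (Complex x p) (Complex x q)"
      then have z: "z = Complex x (Im z)" "Im z \<in> closed_segment p q"
        by (auto simp: closed_segment_def complex_eq_iff algebra_simps)
      show "(P has_field_derivative G z) (at z within closed_segment (Complex x p) (Complex x q))"
        using P'[OF S[OF z(2), of x]] z(1) by (auto intro: has_field_derivative_at_within)
      show "cmod (G z) \<le> K * envelope x" using bound[OF z(2), of x] z(1) by simp
    qed auto
    also have "cmod (Complex x q - Complex x p) = \<bar>q - p\<bar>"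
      by (simp add: cmod_def)
    finally show ?thesis .
  qed
  have lim: "((\<lambda>x. P (Complex x q) - P (Complex x p)) \<longlongrightarrow> 0) F" if "(envelope \<longlongrightarrow> 0) F" for F
  proof (rule Lim_null_comparison)
    show "\<forall>\<^sub>F x in F. cmod (P (Complex x q) - P (Complex x p)) \<le> K * envelope x * \<bar>q - p\<bar>"
      using diff by simp
    show "((\<lambda>x. K * envelope x * \<bar>q - p\<bar>) \<longlongrightarrow> 0) F"
      using that by (auto intro!: tendsto_eq_intros)
  qed
  have "integral\<^sup>L lborel (\<lambda>x. G (Complex x q) - G (Complex x p)) = 0 - 0"
    by (rule integral_FTC_real_line[where F="\<lambda>x. P (Complex x q) - P (Complex x p)"])
      (auto intro!: has_vector_derivative_diff der Bochner_Integration.integrable_diff int pq lim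
        envelope_tendsto continuous_diff cont)
  then show ?thesis
    by (simp add: Bochner_Integration.integral_diff int pq)
qed

text \<open>The difference of the squares is \<open>(1 - cos \<phi>) (1 - t)\<^sup>2 / 2\<close> at the extremal angle. The bound
keeps the arguments of logarithms and the denominators away from zero uniformly on closed sectors.\<close>

lemma cmod_one_plus_cis_ge:
  assumes "0 \<le> t" "\<bar>\<phi>\<bar> \<le> \<eta>" "\<eta> < pi"
  shows "cos (\<eta> / 2) * (1 + t) \<le> cmod (1 + of_real t * cis \<phi>)"
proof (rule power2_le_imp_le)
  have "cos (\<eta> / 2) \<le> cos (\<bar>\<phi>\<bar> / 2)"
    using assms by (intro cos_monotone_0_pi_le) auto
  moreover have "0 \<le> cos (\<eta> / 2)"
    using assms by (intro cos_ge_zero) auto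
  ultimately have "(cos (\<eta> / 2))\<^sup>2 \<le> (cos (\<bar>\<phi>\<bar> / 2))\<^sup>2"
    by (intro power_mono) auto
  then have c: "(cos (\<eta> / 2))\<^sup>2 \<le> (1 + cos \<phi>) / 2"
    using cos_double_cos[of "\<bar>\<phi>\<bar> / 2"] by simp
  have "(cos (\<eta> / 2) * (1 + t))\<^sup>2 \<le> (1 + cos \<phi>) / 2 * (1 + t)\<^sup>2"
    unfolding power_mult_distrib using c by (intro mult_right_mono) auto
  also have "\<dots> \<le> (1 + cos \<phi>) / 2 * (1 + t)\<^sup>2 + (1 - cos \<phi>) / 2 * (1 - t)\<^sup>2"
    by simp
  also have "\<dots> = 1 + 2 * t * cos \<phi> + t\<^sup>2"
    by (simp add: power2_eq_square field_simps)
  also have "\<dots> = 1 + 2 * t * cos \<phi> + t\<^sup>2 * ((cos \<phi>)\<^sup>2 + (sin \<phi>)\<^sup>2)"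
    by simp
  also have "\<dots> = (cmod (1 + of_real t * cis \<phi>))\<^sup>2"
    unfolding cmod_power2
    by (simp add: power2_eq_square algebra_simps del: sin_cos_squared_add sin_cos_squared_add2 sin_cos_squared_add3)
  finally show "(cos (\<eta> / 2) * (1 + t))\<^sup>2 \<le> (cmod (1 + of_real t * cis \<phi>))\<^sup>2" .
qed simp

lemma cmod_pos_plus_cis_ge:
  assumes "0 < a" "0 \<le> r" "\<bar>\<phi>\<bar> \<le> \<eta>" "\<eta> < pi"
  shows "cos (\<eta> / 2) * min a 1 * (1 + r) \<le> cmod (of_real a + of_real r * cis \<phi>)"
proof -
  have c: "0 \<le> cos (\<eta> / 2)"
    using assms by (intro cos_ge_zero) auto
  have "min a 1 * (1 + r) \<le> a * (1 + r / a)"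
    using assms by (auto simp: field_simps min_def mult_left_le_one_le)
  then have "cos (\<eta> / 2) * (min a 1 * (1 + r)) \<le> cos (\<eta> / 2) * (a * (1 + r / a))"
    using c by (rule mult_left_mono)
  also have "\<dots> = a * (cos (\<eta> / 2) * (1 + r / a))" by simp
  also have "\<dots> \<le> a * cmod (1 + of_real (r / a) * cis \<phi>)"
    using assms by (intro mult_left_mono cmod_one_plus_cis_ge) auto
  also have "\<dots> = cmod (of_real a * (1 + of_real (r / a) * cis \<phi>))"
    using assms by (simp add: norm_mult)
  also have "of_real a * (1 + of_real (r / a) * cis \<phi>) = of_real a + of_real r * cis \<phi>"
    using assms by (simp add: field_simps)
  finally show ?thesis by (simp add: mult.assoc)
qed

text \<open>The lower bound on \<open>z\<close> controls the real part of the logarithm near zero, and \<open>pi\<close> its imaginary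
part.\<close>

lemma cmod_Ln_le:
  assumes "0 < \<kappa>" "\<kappa> \<le> 1" "\<kappa> \<le> cmod z" "cmod z \<le> 1 + t" "0 \<le> t"
  shows "cmod (Ln z) \<le> ln (1 + t) - ln \<kappa> + pi"
proof -
  have z: "z \<noteq> 0" using assms by auto
  have "ln \<kappa> \<le> ln (cmod z)" "ln (cmod z) \<le> ln (1 + t)" "ln \<kappa> \<le> 0" "0 \<le> ln (1 + t)"
    using assms z by (auto intro: order_less_le_trans)
  then have "\<bar>ln (cmod z)\<bar> \<le> ln (1 + t) - ln \<kappa>" by linarith
  moreover have "\<bar>Im (Ln z)\<bar> \<le> pi"
    using mpi_less_Im_Ln[OF z] Im_Ln_le_pi[OF z] by linarith
  ultimately show ?thesis
    using cmod_le[of "Ln z"] z by simp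
qed

lemma ln_one_plus_exp_le:
  assumes "0 < \<alpha>"
  shows "ln (1 + exp (\<alpha> * x)) \<le> (ln 2 + 2 * \<alpha>) * sqrt (1 + exp x)"
proof -
  have e: "(exp x) powr \<alpha> = exp (\<alpha> * x)" by (simp add: powr_def)
  have "1 + exp (\<alpha> * x) \<le> 2 * (1 + exp x) powr \<alpha>"
  proof -
    have "1 powr \<alpha> \<le> (1 + exp x) powr \<alpha>" "(exp x) powr \<alpha> \<le> (1 + exp x) powr \<alpha>"
      using assms by (intro powr_mono2; simp)+
    then show ?thesis unfolding e by simp
  qed
  then have "ln (1 + exp (\<alpha> * x)) \<le> ln (2 * (1 + exp x) powr \<alpha>)"
  proof (subst ln_le_cancel_iff)
    have "0 < 1 + exp x" by (intro add_pos_pos) auto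
    then show "0 < 2 * (1 + exp x) powr \<alpha>" by simp
  qed (auto intro!: add_pos_pos)
  also have "\<dots> = ln 2 + \<alpha> * ln (1 + exp x)"
    by (subst ln_mult_pos) (auto simp: add_pos_pos add_nonneg_eq_0_iff ln_powr)
  also have "ln (1 + exp x) = 2 * ln (sqrt (1 + exp x))"
    by (simp add: ln_sqrt add_pos_pos)
  also have "\<dots> \<le> 2 * sqrt (1 + exp x)"
    using ln_bound[of "sqrt (1 + exp x)"] by (simp add: add_pos_pos)
  also have "ln 2 + \<alpha> * (2 * sqrt (1 + exp x)) \<le> ln 2 * sqrt (1 + exp x) + \<alpha> * (2 * sqrt (1 + exp x))"
    by (intro add_right_mono) (auto simp: mult_le_cancel_left1)
  finally show ?thesis using assms by (simp add: algebra_simps)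
qed

lemma envelope_eq: "envelope x = exp x * sqrt (1 + exp x) / (1 + exp x)\<^sup>2"
proof -
  have "(1 + exp x) powr (-3/2) = (1 + exp x) powr (1/2) * (1 + exp x) powr (-2)"
    by (subst powr_add[symmetric]) simp
  also have "(1 + exp x) powr (-2) = 1 / (1 + exp x)\<^sup>2"
    by (subst powr_minus, subst powr_numeral) (auto simp: add_pos_pos divide_inverse)
  also have "(1 + exp x) powr (1/2) = sqrt (1 + exp x)"
    by (simp add: powr_half_sqrt)
  finally show ?thesis by (simp add: envelope_def)
qed

text \<open>The argument \<open>z\<close> of the logarithm is left free, so that the same bound serves on shifted
lines and uniformly in the step size of the discretised process.\<close>

lemma resolvent_envelope:
  fixes a b \<alpha> \<kappa> \<eta> :: real
  assumes "0 < a" "0 < b" "0 < \<alpha>" "0 < \<kappa>" "\<kappa> \<le> 1" "\<eta> < pi"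
  obtains K where "\<And>x \<theta> z. \<bar>pi / 2 + \<theta>\<bar> \<le> \<eta> \<Longrightarrow> \<kappa> \<le> cmod z \<Longrightarrow> cmod z \<le> 1 + exp (\<alpha> * x) \<Longrightarrow>
     cmod (exp (Complex x \<theta>) * Ln z *
       (1 / (a + \<i> * exp (Complex x \<theta>)) - 1 / (b + \<i> * exp (Complex x \<theta>)))) \<le> K * envelope x"
proof -
  define C where "C = ln 2 + 2 * \<alpha> - ln \<kappa> + pi"
  define c where "c = cos (\<eta> / 2)"
  define K where "K = C * (\<bar>b - a\<bar> / (c * min a 1 * (c * min b 1)))"
  show thesis
  proof (rule that[of K])
    fix x \<theta> :: real and z :: complex
    assume \<theta>: "\<bar>pi / 2 + \<theta>\<bar> \<le> \<eta>" and z: "\<kappa> \<le> cmod z" "cmod z \<le> 1 + exp (\<alpha> * x)"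
    have "0 < c" unfolding c_def using assms \<theta> by (intro cos_gt_zero_pi) auto
    then have pos: "0 < c * min a 1" "0 < c * min b 1" using assms by auto
    define w where "w = exp (Complex x \<theta>)"
    have w: "\<i> * w = of_real (exp x) * cis (pi / 2 + \<theta>)"
      unfolding w_def by (simp add: exp_eq_polar complex_eq_iff cos_add sin_add)
    have ga: "c * min a 1 * (1 + exp x) \<le> cmod (a + \<i> * w)"
      and gb: "c * min b 1 * (1 + exp x) \<le> cmod (b + \<i> * w)"
      unfolding w c_def using assms \<theta> by (intro cmod_pos_plus_cis_ge; simp)+
    have gpos: "0 < c * min a 1 * (1 + exp x)" "0 < c * min b 1 * (1 + exp x)"
      using pos by (auto intro!: mult_pos_pos[OF _ add_pos_pos])
    then have nz: "a + \<i> * w \<noteq> 0" "b + \<i> * w \<noteq> 0" using ga gb by auto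
    have frac: "u / (p * q) \<le> u / (p' * q')" if "0 < p'" "0 < q'" "p' \<le> p" "q' \<le> q" "0 \<le> u" for u p q p' q' :: real
      using that by (intro divide_left_mono mult_mono mult_pos_pos) auto
    have "1 / (a + \<i> * w) - 1 / (b + \<i> * w) = of_real (b - a) / ((a + \<i> * w) * (b + \<i> * w))"
      using nz by (simp add: field_simps)
    then have "cmod (1 / (a + \<i> * w) - 1 / (b + \<i> * w)) = \<bar>b - a\<bar> / (cmod (a + \<i> * w) * cmod (b + \<i> * w))"
      by (simp add: norm_divide norm_mult del: of_real_diff)
    also have "\<dots> \<le> \<bar>b - a\<bar> / ((c * min a 1 * (1 + exp x)) * (c * min b 1 * (1 + exp x)))"
      by (rule frac[OF gpos ga gb]) simp
    also have "\<dots> = \<bar>b - a\<bar> / (c * min a 1 * (c * min b 1)) / (1 + exp x)\<^sup>2"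
      by (simp add: power2_eq_square mult_ac)
    finally have res: "cmod (1 / (a + \<i> * w) - 1 / (b + \<i> * w)) \<le>
       \<bar>b - a\<bar> / (c * min a 1 * (c * min b 1)) / (1 + exp x)\<^sup>2" .
    have s1: "1 \<le> sqrt (1 + exp x)" by simp
    have nn: "0 \<le> - ln \<kappa> + pi" using assms ln_le_zero_iff[of \<kappa>] pi_gt_zero by linarith
    have "cmod (Ln z) \<le> ln (1 + exp (\<alpha> * x)) - ln \<kappa> + pi"
      using assms z by (intro cmod_Ln_le) auto
    also have "\<dots> \<le> (ln 2 + 2 * \<alpha>) * sqrt (1 + exp x) + (- ln \<kappa> + pi) * sqrt (1 + exp x)"
      using add_mono[OF ln_one_plus_exp_le[OF \<open>0 < \<alpha>\<close>, of x] mult_left_mono[OF s1 nn]] by simp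
    also have "\<dots> = C * sqrt (1 + exp x)" by (simp add: C_def algebra_simps)
    finally have ln: "cmod (Ln z) \<le> C * sqrt (1 + exp x)" .
    have "cmod w = exp x" by (simp add: w_def)
    then have "cmod (w * Ln z * (1 / (a + \<i> * w) - 1 / (b + \<i> * w)))
       \<le> exp x * (C * sqrt (1 + exp x)) * (\<bar>b - a\<bar> / (c * min a 1 * (c * min b 1)) / (1 + exp x)\<^sup>2)"
      unfolding norm_mult using ln res by (intro mult_mono) (auto intro!: mult_nonneg_nonneg[OF _ order_trans[OF norm_ge_zero ln]])
    also have "\<dots> = K * envelope x"
      by (simp add: envelope_eq K_def)
    finally show "cmod (exp (Complex x \<theta>) * Ln z *
       (1 / (a + \<i> * exp (Complex x \<theta>)) - 1 / (b + \<i> * exp (Complex x \<theta>)))) \<le> K * envelope x"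
      unfolding w_def .
  qed
qed

text \<open>The integrand of the Wiener--Hopf exponent in the coordinate \<open>t = exp s\<close>, continued analytically
from real \<open>s\<close>; the factor \<open>exp s\<close> is the Jacobian, and for real \<open>s\<close> the exponential inside the
logarithm is the characteristic exponent at \<open>exp s\<close>.\<close>

definition wh_kernel :: "real \<Rightarrow> real \<Rightarrow> real \<Rightarrow> real \<Rightarrow> complex \<Rightarrow> complex" where
  "wh_kernel \<alpha> \<rho> a b s = exp s * Ln (1 + exp (\<i> * (pi * \<alpha> * (1/2 - \<rho>)) + \<alpha> * s)) *
     (1 / (a + \<i> * exp s) - 1 / (b + \<i> * exp s))"

abbreviation wh_integral :: "real \<Rightarrow> real \<Rightarrow> real \<Rightarrow> real \<Rightarrow> complex" where
  "wh_integral \<alpha> \<rho> a b \<equiv> (\<integral>s. wh_kernel \<alpha> \<rho> a b (Complex s 0) \<partial>lborel)"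

lemma exp_rotate:
  "exp (\<i> * of_real A + of_real \<alpha> * Complex x \<theta>) = of_real (exp (\<alpha> * x)) * cis (A + \<alpha> * \<theta>)"
  by (simp add: exp_eq_polar complex_eq_iff cos_add sin_add)

lemma wh_kernel_bound:
  assumes "0 < a" "0 < b" "0 < \<alpha>" "\<eta> < pi"
  obtains K where "\<And>x \<theta>. \<bar>pi / 2 + \<theta>\<bar> \<le> \<eta> \<Longrightarrow> \<bar>pi * \<alpha> * (1/2 - \<rho>) + \<alpha> * \<theta>\<bar> \<le> \<eta> \<Longrightarrow>
    cmod (wh_kernel \<alpha> \<rho> a b (Complex x \<theta>)) \<le> K * envelope x"
proof (cases "0 \<le> \<eta>")
  case False
  show thesis by (rule that[of 0]) (use False in auto)
next
  case True
  have k: "0 < cos (\<eta> / 2)" using assms True by (intro cos_gt_zero_pi) auto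
  obtain K where K: "\<And>x \<theta> z. \<bar>pi / 2 + \<theta>\<bar> \<le> \<eta> \<Longrightarrow> cos (\<eta> / 2) \<le> cmod z \<Longrightarrow> cmod z \<le> 1 + exp (\<alpha> * x) \<Longrightarrow>
     cmod (exp (Complex x \<theta>) * Ln z *
       (1 / (a + \<i> * exp (Complex x \<theta>)) - 1 / (b + \<i> * exp (Complex x \<theta>)))) \<le> K * envelope x"
    using resolvent_envelope[OF assms(1-3) k _ assms(4)] by (metis cos_le_one)
  show thesis
  proof (rule that[of K])
    fix x \<theta> assume h: "\<bar>pi / 2 + \<theta>\<bar> \<le> \<eta>" "\<bar>pi * \<alpha> * (1/2 - \<rho>) + \<alpha> * \<theta>\<bar> \<le> \<eta>"
    let ?w = "of_real (exp (\<alpha> * x)) * cis (pi * \<alpha> * (1/2 - \<rho>) + \<alpha> * \<theta>)"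
    have "cos (\<eta> / 2) * 1 \<le> cos (\<eta> / 2) * (1 + exp (\<alpha> * x))"
      using k by (intro mult_left_mono) auto
    also have "\<dots> \<le> cmod (1 + ?w)"
      using h(2) assms(4) by (intro cmod_one_plus_cis_ge) auto
    finally have 1: "cos (\<eta> / 2) \<le> cmod (1 + ?w)" by simp
    have 2: "cmod (1 + ?w) \<le> 1 + exp (\<alpha> * x)"
      by (rule order_trans[OF norm_triangle_ineq]) (simp add: norm_mult)
    show "cmod (wh_kernel \<alpha> \<rho> a b (Complex x \<theta>)) \<le> K * envelope x"
      using K[OF h(1) 1 2] exp_rotate[of "pi * \<alpha> * (1/2 - \<rho>)" \<alpha> x \<theta>]
      unfolding wh_kernel_def by simp
  qed
qed

lemma one_plus_cis_not_nonpos: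
  assumes "\<bar>\<phi>\<bar> < pi" "0 < t" "0 < a"
  shows "of_real a + of_real t * cis \<phi> \<notin> \<real>\<^sub>\<le>\<^sub>0"
proof
  assume "of_real a + of_real t * cis \<phi> \<in> \<real>\<^sub>\<le>\<^sub>0"
  then have h: "a + t * cos \<phi> \<le> 0" "sin \<phi> = 0"
    using assms by (auto simp: complex_nonpos_Reals_iff)
  have "\<phi> = 0" using h(2) assms(1)
    using sin_eq_0_pi by auto
  then show False using h(1) assms by auto
qed

text \<open>On the line of height \<open>p\<close> the numbers \<open>i t\<close> and \<open>\<Psi>(t)\<close> have arguments \<open>pi / 2 + p\<close> and
\<open>pi \<alpha> (1/2 - \<rho>) + \<alpha> p\<close>. As long as both stay within \<open>(- pi, pi)\<close>, no pole and no branch cut is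
crossed, and since both are affine in the height it suffices to check the two end lines.\<close>

lemma wh_kernel_line_shift:
  assumes "0 < a" "0 < b" "0 < \<alpha>"
    and "\<bar>pi / 2 + p\<bar> < pi" "\<bar>pi * \<alpha> * (1/2 - \<rho>) + \<alpha> * p\<bar> < pi"
    and "\<bar>pi / 2 + q\<bar> < pi" "\<bar>pi * \<alpha> * (1/2 - \<rho>) + \<alpha> * q\<bar> < pi"
  shows "integral\<^sup>L lborel (\<lambda>x. wh_kernel \<alpha> \<rho> a b (Complex x p)) =
         integral\<^sup>L lborel (\<lambda>x. wh_kernel \<alpha> \<rho> a b (Complex x q))"
proof -
  define A where "A = pi * \<alpha> * (1/2 - \<rho>)"
  define \<eta> where "\<eta> = Max {\<bar>pi / 2 + p\<bar>, \<bar>A + \<alpha> * p\<bar>, \<bar>pi / 2 + q\<bar>, \<bar>A + \<alpha> * q\<bar>}"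
  have \<eta>: "\<eta> < pi" unfolding \<eta>_def A_def using assms by auto
  have ends: "\<bar>pi / 2 + p\<bar> \<le> \<eta>" "\<bar>A + \<alpha> * p\<bar> \<le> \<eta>" "\<bar>pi / 2 + q\<bar> \<le> \<eta>" "\<bar>A + \<alpha> * q\<bar> \<le> \<eta>"
    unfolding \<eta>_def by (rule Max_ge; simp)+
  define S where "S = {z. \<bar>pi / 2 + Im z\<bar> < pi \<and> \<bar>A + \<alpha> * Im z\<bar> < pi}"
  have seg: "\<bar>pi / 2 + \<theta>\<bar> \<le> \<eta>" "\<bar>A + \<alpha> * \<theta>\<bar> \<le> \<eta>" if "\<theta> \<in> closed_segment p q" for \<theta>
  proof -
    have cv: "convex {\<theta>. \<bar>u + v * \<theta>\<bar> \<le> \<eta>}" for u v :: real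
    proof -
      have "{\<theta>. \<bar>u + v * \<theta>\<bar> \<le> \<eta>} = {\<theta>. v \<bullet> \<theta> \<le> \<eta> - u} \<inter> {\<theta>. v \<bullet> \<theta> \<ge> - \<eta> - u}"
        by (auto simp: abs_le_iff)
      then show ?thesis by (metis convex_Int convex_halfspace_ge convex_halfspace_le)
    qed
    have sub: "closed_segment p q \<subseteq> {\<theta>. \<bar>u + v * \<theta>\<bar> \<le> \<eta>}"
      if "\<bar>u + v * p\<bar> \<le> \<eta>" "\<bar>u + v * q\<bar> \<le> \<eta>" for u v
      using that by (intro closed_segment_subset cv) auto
    from sub[of "pi/2" 1] sub[of A \<alpha>] that ends
    show "\<bar>pi / 2 + \<theta>\<bar> \<le> \<eta>" "\<bar>A + \<alpha> * \<theta>\<bar> \<le> \<eta>" by auto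
  qed
  have S_eq: "S = {z. Im z < pi / 2} \<inter> {z. Im z > - 3 * pi / 2} \<inter>
      {z. Im z < (pi - A) / \<alpha>} \<inter> {z. Im z > (- pi - A) / \<alpha>}"
    unfolding S_def using \<open>0 < \<alpha>\<close> by (auto simp: field_simps abs_less_iff)
  obtain K where K: "\<And>x \<theta>. \<bar>pi / 2 + \<theta>\<bar> \<le> \<eta> \<Longrightarrow> \<bar>A + \<alpha> * \<theta>\<bar> \<le> \<eta> \<Longrightarrow>
    cmod (wh_kernel \<alpha> \<rho> a b (Complex x \<theta>)) \<le> K * envelope x"
    using wh_kernel_bound[OF assms(1-3) \<eta>, of \<rho>] unfolding A_def by metis
  show ?thesis
  proof (rule integral_horizontal_line_shift[where S=S])
    show "convex S" unfolding S_eq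
      by (intro convex_Int convex_halfspace_Im_lt convex_halfspace_Im_gt)
    show "open S" unfolding S_eq
      by (intro open_Int open_halfspace_Im_lt open_halfspace_Im_gt)
    show "Complex x \<theta> \<in> S" if "\<theta> \<in> closed_segment p q" for x \<theta>
      using seg[OF that] \<eta> by (auto simp: S_def)
    show "cmod (wh_kernel \<alpha> \<rho> a b (Complex x \<theta>)) \<le> K * envelope x"
      if "\<theta> \<in> closed_segment p q" for x \<theta>
      using K seg[OF that] by blast
    have 1: "1 + exp (\<i> * (pi * \<alpha> * (1/2 - \<rho>)) + \<alpha> * s) \<notin> \<real>\<^sub>\<le>\<^sub>0" if "s \<in> S" for s :: complex
    proof -
      have "\<bar>A + \<alpha> * Im s\<bar> < pi" using that by (simp add: S_def)
      from one_plus_cis_not_nonpos[OF this exp_gt_zero zero_less_one, of "\<alpha> * Re s"]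
      show ?thesis using exp_rotate[of A \<alpha> "Re s" "Im s"] by (simp add: A_def)
    qed
    have 2: "of_real d + \<i> * exp s \<noteq> 0" if "s \<in> S" "0 < d" for s :: complex and d
    proof -
      have "\<bar>pi / 2 + Im s\<bar> < pi" using that by (simp add: S_def)
      from one_plus_cis_not_nonpos[OF this exp_gt_zero \<open>0 < d\<close>, of "Re s"]
      have "of_real d + of_real (exp (Re s)) * cis (pi / 2 + Im s) \<noteq> 0" by auto
      also have "of_real (exp (Re s)) * cis (pi / 2 + Im s) = \<i> * exp s"
        using exp_rotate[of "pi/2" 1 "Re s" "Im s"] by (simp add: exp_add exp_eq_polar complex_eq_iff cos_add sin_add)
      finally show ?thesis .
    qed
    show "wh_kernel \<alpha> \<rho> a b holomorphic_on S"
      unfolding wh_kernel_def by (intro holomorphic_intros 1 2 assms)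
  qed
qed

section \<open>Duality of the Wiener--Hopf integral\<close>

text \<open>Up to normalisation the Poisson kernel of a strip, or of a sector in the coordinate \<open>exp x\<close>.\<close>

definition strip_poisson :: "real \<Rightarrow> real \<Rightarrow> real" where
  "strip_poisson \<rho> x = sin (pi * \<rho>) / (exp x + exp (- x) + 2 * cos (pi * \<rho>))"

lemma poisson_even: "strip_poisson \<rho> (- x) = strip_poisson \<rho> x"
  by (simp add: strip_poisson_def add_ac)

lemma cis_denominator_pos:
  assumes "0 < \<rho>" "\<rho> < 1" "0 < a" "0 < t"
  shows "0 < a\<^sup>2 + 2 * a * t * cos (pi * \<rho>) + t\<^sup>2"
proof -
  have "sin (pi * \<rho>) > 0" using assms by (intro sin_gt_zero) auto
  then have "0 < (t * sin (pi * \<rho>))\<^sup>2 + (a + t * cos (pi * \<rho>))\<^sup>2"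
    using assms by (intro add_pos_nonneg) auto
  also have "\<dots> = t\<^sup>2 * ((sin (pi * \<rho>))\<^sup>2 + (cos (pi * \<rho>))\<^sup>2) + a\<^sup>2 + 2 * a * t * cos (pi * \<rho>)"
    by (simp add: power2_eq_square algebra_simps del: sin_cos_squared_add sin_cos_squared_add2 sin_cos_squared_add3)
  finally show ?thesis by (simp add: add_ac)
qed

lemma poisson_eq:
  assumes "0 < a"
  shows "strip_poisson \<rho> (x - ln a) = a * exp x * sin (pi * \<rho>) / (a\<^sup>2 + 2 * a * exp x * cos (pi * \<rho>) + (exp x)\<^sup>2)"
proof -
  have "exp (x - ln a) + exp (- (x - ln a)) + 2 * cos (pi * \<rho>) =
     (a\<^sup>2 + 2 * a * exp x * cos (pi * \<rho>) + (exp x)\<^sup>2) / (a * exp x)"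
    using assms by (simp add: exp_diff field_simps power2_eq_square)
  then show ?thesis
    by (simp add: strip_poisson_def mult_ac)
qed

lemma poisson_Im:
  assumes "0 < a" "0 < \<rho>" "\<rho> < 1"
  shows "Im (of_real (exp x) * cis (pi * \<rho>) / (a + of_real (exp x) * cis (pi * \<rho>))) = strip_poisson \<rho> (x - ln a)"
proof -
  have d: "(a + exp x * cos (pi * \<rho>))\<^sup>2 + (exp x * sin (pi * \<rho>))\<^sup>2 = a\<^sup>2 + 2 * a * exp x * cos (pi * \<rho>) + (exp x)\<^sup>2"
  proof -
    have "(a + exp x * cos (pi * \<rho>))\<^sup>2 + (exp x * sin (pi * \<rho>))\<^sup>2 =
       a\<^sup>2 + 2 * a * exp x * cos (pi * \<rho>) + (exp x)\<^sup>2 * ((sin (pi * \<rho>))\<^sup>2 + (cos (pi * \<rho>))\<^sup>2)"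
      by (simp add: power2_eq_square algebra_simps del: sin_cos_squared_add sin_cos_squared_add2 sin_cos_squared_add3)
    then show ?thesis by simp
  qed
  have "Im (of_real (exp x) * cis (pi * \<rho>) / (a + of_real (exp x) * cis (pi * \<rho>))) =
     a * exp x * sin (pi * \<rho>) / ((a + exp x * cos (pi * \<rho>))\<^sup>2 + (exp x * sin (pi * \<rho>))\<^sup>2)"
    by (simp add: Im_divide algebra_simps)
  then show ?thesis unfolding d poisson_eq[OF assms(1)] .
qed

lemma isCont_poisson: "0 < \<rho> \<Longrightarrow> \<rho> < 1 \<Longrightarrow> isCont (strip_poisson \<rho>) x"
proof -
  assume \<rho>: "0 < \<rho>" "\<rho> < 1"
  have "exp x + exp (- x) + 2 * cos (pi * \<rho>) = (1\<^sup>2 + 2 * 1 * exp x * cos (pi * \<rho>) + (exp x)\<^sup>2) / exp x"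
    by (simp add: field_simps power2_eq_square exp_minus)
  also have "\<dots> > 0"
    using cis_denominator_pos[OF \<rho> zero_less_one exp_gt_zero, of x] by (intro divide_pos_pos) auto
  finally show ?thesis
    unfolding strip_poisson_def by (intro continuous_intros) auto
qed

lemma poisson_nonneg:
  assumes "0 < \<rho>" "\<rho> < 1"
  shows "0 \<le> strip_poisson \<rho> x"
  using poisson_eq[of 1 \<rho> x] cis_denominator_pos[OF assms zero_less_one exp_gt_zero, of x] assms
  by (auto intro!: divide_nonneg_pos mult_nonneg_nonneg sin_ge_zero)

text \<open>The quadratic decay in \<open>exp x\<close> is what makes the integrals against each single logarithm converge.\<close>

lemma poisson_le:
  assumes "0 < \<rho>" "\<rho> < 1" "0 < a"
  obtains K where "0 \<le> K" "\<And>x. strip_poisson \<rho> (x - ln a) \<le> K * (exp x / (1 + exp x)\<^sup>2)"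
proof -
  define c where "c = cos (pi * \<rho> / 2) * min a 1"
  have c: "0 < c"
  proof -
    have "- pi < pi * \<rho>" "pi * \<rho> < pi"
      using mult_pos_pos[OF pi_gt_zero assms(1)] assms pi_gt_zero by (linarith, simp)
    then show ?thesis unfolding c_def using assms(3) by (intro mult_pos_pos cos_gt_zero_pi) (linarith | simp)+
  qed
  show thesis
  proof (rule that[of "a / c\<^sup>2"])
    show "0 \<le> a / c\<^sup>2" using assms by simp
    fix x
    let ?w = "of_real (exp x) * cis (pi * \<rho>)"
    have 1: "c * (1 + exp x) \<le> cmod (a + ?w)"
      unfolding c_def using assms by (intro cmod_pos_plus_cis_ge) auto
    have p: "0 < c * (1 + exp x)" using c by (intro mult_pos_pos add_pos_pos) auto
    then have nz: "a + ?w \<noteq> 0" using 1 by auto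
    have "strip_poisson \<rho> (x - ln a) = a * exp x * sin (pi * \<rho>) / (cmod (a + ?w))\<^sup>2"
      unfolding poisson_Im[OF assms(3,1,2), symmetric]
      by (simp add: Im_divide cmod_power2 algebra_simps)
    also have "\<dots> \<le> a * exp x * 1 / (c * (1 + exp x))\<^sup>2"
      using 1 p assms by (intro frac_le mult_left_mono power_mono) auto
    also have "\<dots> = a / c\<^sup>2 * (exp x / (1 + exp x)\<^sup>2)"
      by (simp add: power_mult_distrib)
    finally show "strip_poisson \<rho> (x - ln a) \<le> a / c\<^sup>2 * (exp x / (1 + exp x)\<^sup>2)" .
  qed
qed

lemma integrable_ln_poisson:
  assumes "0 < \<rho>" "\<rho> < 1" "0 < a" "0 < \<alpha>"
  shows "integrable lborel (\<lambda>x. ln (1 + exp (\<alpha> * x)) * strip_poisson \<rho> (x - ln a))"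
proof -
  obtain K where K: "0 \<le> K" "\<And>x. strip_poisson \<rho> (x - ln a) \<le> K * (exp x / (1 + exp x)\<^sup>2)"
    using poisson_le[OF assms(1-3)] by metis
  show ?thesis
  proof (rule Bochner_Integration.integrable_bound)
    show "integrable lborel (\<lambda>x. (ln 2 + 2 * \<alpha>) * K * envelope x)"
      by (intro integrable_mult_right integrable_envelope)
    have "isCont (\<lambda>x. ln (1 + exp (\<alpha> * x)) * strip_poisson \<rho> (x - ln a)) x" for x
    proof (intro continuous_intros isCont_o2[OF _ isCont_poisson] assms)
      show "1 + exp (\<alpha> * x) \<noteq> 0" using exp_gt_zero[of "\<alpha> * x"] by linarith
    qed
    then show "(\<lambda>x. ln (1 + exp (\<alpha> * x)) * strip_poisson \<rho> (x - ln a)) \<in> borel_measurable lborel"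
      by (auto intro!: borel_measurable_continuous_onI continuous_at_imp_continuous_on)
    show "AE x in lborel. norm (ln (1 + exp (\<alpha> * x)) * strip_poisson \<rho> (x - ln a)) \<le>
       norm ((ln 2 + 2 * \<alpha>) * K * envelope x)"
    proof (intro AE_I2)
      fix x
      have l0: "0 \<le> ln (1 + exp (\<alpha> * x))" by simp
      have "norm (ln (1 + exp (\<alpha> * x)) * strip_poisson \<rho> (x - ln a)) = ln (1 + exp (\<alpha> * x)) * strip_poisson \<rho> (x - ln a)"
        using poisson_nonneg[OF assms(1,2)] l0 by (simp add: abs_mult)
      also have "\<dots> \<le> ((ln 2 + 2 * \<alpha>) * sqrt (1 + exp x)) * (K * (exp x / (1 + exp x)\<^sup>2))"
        using assms by (intro mult_mono ln_one_plus_exp_le K poisson_nonneg) auto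
      also have "\<dots> = (ln 2 + 2 * \<alpha>) * K * envelope x" by (simp add: envelope_eq)
      also have "\<dots> \<le> norm \<dots>" by simp
      finally show "norm (ln (1 + exp (\<alpha> * x)) * strip_poisson \<rho> (x - ln a)) \<le>
       norm ((ln 2 + 2 * \<alpha>) * K * envelope x)" .
    qed
  qed
qed

text \<open>At height \<open>pi \<rho> - pi / 2\<close> the characteristic exponent is the positive number \<open>exp (\<alpha> x)\<close>.\<close>

lemma wh_kernel_on_positive_line:
  assumes "0 < a" "0 < b" "0 < \<rho>" "\<rho> < 1"
  shows "Re (wh_kernel \<alpha> \<rho> a b (Complex x (pi * \<rho> - pi / 2))) =
     ln (1 + exp (\<alpha> * x)) * strip_poisson \<rho> (x - ln a) - ln (1 + exp (\<alpha> * x)) * strip_poisson \<rho> (x - ln b)"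
proof -
  let ?s = "Complex x (pi * \<rho> - pi / 2)"
  let ?w = "of_real (exp x) * cis (pi * \<rho>)"
  have e1: "exp ?s = - \<i> * ?w"
    by (simp add: exp_eq_polar complex_eq_iff cos_diff sin_diff)
  have e2: "exp (\<i> * (pi * \<alpha> * (1/2 - \<rho>)) + \<alpha> * ?s) = exp (\<alpha> * x)"
  proof -
    have z: "pi * \<alpha> * (1/2 - \<rho>) + \<alpha> * (pi * \<rho> - pi / 2) = 0" by (simp add: algebra_simps)
    show ?thesis
      using exp_rotate[of "pi * \<alpha> * (1/2 - \<rho>)" \<alpha> x "pi * \<rho> - pi / 2"] unfolding z by simp
  qed
  have p: "0 < 1 + exp (\<alpha> * x)" by (intro add_pos_pos) auto
  have L: "Ln (1 + complex_of_real (exp (\<alpha> * x))) = of_real (ln (1 + exp (\<alpha> * x)))"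
    using Ln_of_real[OF p] by simp
  have Re_scaled: "Re (of_real c * (- \<i> * (u - v))) = c * (Im u - Im v)" for c u v
    by (simp add: algebra_simps)
  have "wh_kernel \<alpha> \<rho> a b ?s = of_real (ln (1 + exp (\<alpha> * x))) * (- \<i> * (?w / (a + ?w) - ?w / (b + ?w)))"
    unfolding wh_kernel_def e2 L unfolding e1 by (simp add: algebra_simps)
  then have "Re (wh_kernel \<alpha> \<rho> a b ?s) = ln (1 + exp (\<alpha> * x)) * (Im (?w / (a + ?w)) - Im (?w / (b + ?w)))"
    using Re_scaled[of _ "?w / (a + ?w)" "?w / (b + ?w)"] by simp
  then show ?thesis
    unfolding poisson_Im[OF assms(1,3,4)] poisson_Im[OF assms(2,3,4)]
    by (simp add: algebra_simps)
qed

lemma wh_kernel_integrable: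
  assumes "0 < a" "0 < b" "0 < \<alpha>" "\<bar>pi / 2 + p\<bar> < pi" "\<bar>pi * \<alpha> * (1/2 - \<rho>) + \<alpha> * p\<bar> < pi"
  shows "integrable lborel (\<lambda>x. wh_kernel \<alpha> \<rho> a b (Complex x p))"
proof -
  define \<eta> where "\<eta> = max \<bar>pi / 2 + p\<bar> \<bar>pi * \<alpha> * (1/2 - \<rho>) + \<alpha> * p\<bar>"
  have \<eta>: "\<eta> < pi" using assms by (simp add: \<eta>_def)
  obtain K where K: "\<And>x \<theta>. \<bar>pi / 2 + \<theta>\<bar> \<le> \<eta> \<Longrightarrow> \<bar>pi * \<alpha> * (1/2 - \<rho>) + \<alpha> * \<theta>\<bar> \<le> \<eta> \<Longrightarrow>
    cmod (wh_kernel \<alpha> \<rho> a b (Complex x \<theta>)) \<le> K * envelope x"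
    using wh_kernel_bound[OF assms(1-3) \<eta>] by metis
  show ?thesis
  proof (rule Bochner_Integration.integrable_bound[of _ "\<lambda>x. K * envelope x"])
    show "(\<lambda>x. wh_kernel \<alpha> \<rho> a b (Complex x p)) \<in> borel_measurable lborel"
      unfolding wh_kernel_def Complex_eq by measurable
    show "AE x in lborel. cmod (wh_kernel \<alpha> \<rho> a b (Complex x p)) \<le> norm (K * envelope x)"
      using K[of p] by (intro AE_I2) (auto simp: \<eta>_def intro: order_trans[OF _ abs_ge_self])
  qed (intro integrable_mult_right integrable_envelope)
qed


text \<open>After moving to the line where the characteristic exponent is positive, the contributions of \<open>a\<close>
and \<open>b\<close> converge separately. Translating each by the logarithm of its parameter and reflecting
uses evenness of the kernel; the linear terms \<open>\<alpha> x\<close> that appear cancel in the difference.\<close>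

lemma wh_integral_poisson:
  assumes "0 < a" "0 < b" "0 < \<alpha>" "0 < \<rho>" "\<rho> < 1" "\<bar>\<alpha> * (1 - 2 * \<rho>)\<bar> \<le> 1"
  shows "Re (wh_integral \<alpha> \<rho> a b) =
    (\<integral>x. (ln (a powr \<alpha> + exp (\<alpha> * x)) - ln (b powr \<alpha> + exp (\<alpha> * x))) * strip_poisson \<rho> x \<partial>lborel)"
proof -
  define p where "p = pi * \<rho> - pi / 2"
  have A0: "\<bar>pi * \<alpha> * (1/2 - \<rho>)\<bar> < pi"
  proof -
    have "pi * \<alpha> * (1/2 - \<rho>) = pi / 2 * (\<alpha> * (1 - 2 * \<rho>))" by (simp add: algebra_simps)
    then have "\<bar>pi * \<alpha> * (1/2 - \<rho>)\<bar> = pi / 2 * \<bar>\<alpha> * (1 - 2 * \<rho>)\<bar>"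
      by (simp only: abs_mult) simp
    also have "\<dots> \<le> pi / 2 * 1" using assms by (intro mult_left_mono) auto
    finally show ?thesis using pi_gt_zero by linarith
  qed
  have Ap: "pi * \<alpha> * (1/2 - \<rho>) + \<alpha> * p = 0" by (simp add: p_def algebra_simps)
  have p: "\<bar>pi / 2 + p\<bar> < pi" using assms by (simp add: p_def)
  have half: "\<bar>pi / 2 + 0\<bar> < pi" using pi_gt_zero by simp
  have "wh_integral \<alpha> \<rho> a b =
        integral\<^sup>L lborel (\<lambda>x. wh_kernel \<alpha> \<rho> a b (Complex x p))"
    by (rule wh_kernel_line_shift[OF assms(1-3) half _ p]) (use A0 Ap in auto)
  also have "Re \<dots> = integral\<^sup>L lborel (\<lambda>x. Re (wh_kernel \<alpha> \<rho> a b (Complex x p)))"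
    by (rule integral_Re[symmetric], rule wh_kernel_integrable[OF assms(1-3) p]) (use Ap in simp)
  also have "\<dots> = (\<integral>x. ln (1 + exp (\<alpha> * x)) * strip_poisson \<rho> (x - ln a) - ln (1 + exp (\<alpha> * x)) * strip_poisson \<rho> (x - ln b) \<partial>lborel)"
    unfolding p_def wh_kernel_on_positive_line[OF assms(1,2,4,5)] ..
  also have "\<dots> = (\<integral>x. ln (1 + exp (\<alpha> * x)) * strip_poisson \<rho> (x - ln a) \<partial>lborel) -
      (\<integral>x. ln (1 + exp (\<alpha> * x)) * strip_poisson \<rho> (x - ln b) \<partial>lborel)"
    by (intro Bochner_Integration.integral_diff integrable_ln_poisson assms)
  also have "\<dots> = (\<integral>x. ln (1 + exp (\<alpha> * (ln a - x))) * strip_poisson \<rho> x \<partial>lborel) -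
      (\<integral>x. ln (1 + exp (\<alpha> * (ln b - x))) * strip_poisson \<rho> x \<partial>lborel)"
    using lborel_integral_real_affine[of "-1" "\<lambda>x. ln (1 + exp (\<alpha> * x)) * strip_poisson \<rho> (x - ln a)" "ln a"]
      lborel_integral_real_affine[of "-1" "\<lambda>x. ln (1 + exp (\<alpha> * x)) * strip_poisson \<rho> (x - ln b)" "ln b"]
    by (simp add: poisson_even)
  also have "\<dots> = (\<integral>x. ln (1 + exp (\<alpha> * (ln a - x))) * strip_poisson \<rho> x - ln (1 + exp (\<alpha> * (ln b - x))) * strip_poisson \<rho> x \<partial>lborel)"
  proof (rule Bochner_Integration.integral_diff[symmetric])
    show "integrable lborel (\<lambda>x. ln (1 + exp (\<alpha> * (ln a - x))) * strip_poisson \<rho> x)"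
      using lborel_integrable_real_affine[OF integrable_ln_poisson[OF assms(4,5,1,3)], of "-1" "ln a"]
      by (simp add: poisson_even)
    show "integrable lborel (\<lambda>x. ln (1 + exp (\<alpha> * (ln b - x))) * strip_poisson \<rho> x)"
      using lborel_integrable_real_affine[OF integrable_ln_poisson[OF assms(4,5,2,3)], of "-1" "ln b"]
      by (simp add: poisson_even)
  qed
  also have "\<dots> = (\<integral>x. (ln (a powr \<alpha> + exp (\<alpha> * x)) - ln (b powr \<alpha> + exp (\<alpha> * x))) * strip_poisson \<rho> x \<partial>lborel)"
  proof -
    have *: "ln (1 + exp (\<alpha> * (ln d - x))) = ln (d powr \<alpha> + exp (\<alpha> * x)) - \<alpha> * x" if "0 < d" for d x
    proof -
      have pos: "0 < d powr \<alpha> + exp (\<alpha> * x)" using that by (intro add_pos_pos) auto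
      have "1 + exp (\<alpha> * (ln d - x)) = (d powr \<alpha> + exp (\<alpha> * x)) / exp (\<alpha> * x)"
        using that by (simp add: powr_def field_simps exp_add[symmetric] exp_diff)
      then show ?thesis using pos by (simp add: ln_div)
    qed
    show ?thesis
      by (intro Bochner_Integration.integral_cong refl)
        (simp only: *[OF assms(1)] *[OF assms(2)], simp add: algebra_simps)
  qed
  finally show ?thesis .
qed

abbreviation sector_arg :: "real \<Rightarrow> real \<Rightarrow> real" where
  "sector_arg \<rho> r \<equiv> Im (Ln (1 + of_real r * cis (- (pi * \<rho>))))"

text \<open>The argument of \<open>1 + exp x cis (- pi \<rho>)\<close> falls from \<open>0\<close> to \<open>- pi \<rho>\<close> at a rate given by the Poisson
kernel. This is what makes the kernel appear in the integration by parts.\<close>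

lemma has_derivative_sector_arg:
  assumes "0 < \<rho>" "\<rho> < 1"
  shows "((\<lambda>x. sector_arg \<rho> (exp x)) has_real_derivative - strip_poisson \<rho> x) (at x)"
proof -
  let ?c = "cis (- (pi * \<rho>))"
  have nn: "1 + of_real (exp x) * ?c \<notin> \<real>\<^sub>\<le>\<^sub>0"
    using one_plus_cis_not_nonpos[of "- (pi * \<rho>)" "exp x" 1] assms by simp
  have "((\<lambda>x. complex_of_real (exp x)) has_vector_derivative of_real (exp x)) (at x)"
    by (intro has_vector_derivative_of_real DERIV_exp)
  from has_vector_derivative_add[OF has_vector_derivative_const[of 1] has_vector_derivative_mult_left[OF this, of ?c]]
  have "((\<lambda>x. 1 + of_real (exp x) * ?c) has_vector_derivative of_real (exp x) * ?c) (at x)"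
    by simp
  from field_vector_diff_chain_at[OF this has_field_derivative_Ln[OF nn]]
  have "((\<lambda>x. Ln (1 + of_real (exp x) * ?c)) has_vector_derivative of_real (exp x) * ?c / (1 + of_real (exp x) * ?c)) (at x)"
    by (simp add: comp_def divide_inverse)
  from bounded_linear.has_vector_derivative[OF bounded_linear_Im this]
  have 1: "((\<lambda>x. Im (Ln (1 + of_real (exp x) * ?c))) has_real_derivative Im (of_real (exp x) * ?c / (1 + of_real (exp x) * ?c))) (at x)"
    by (simp add: has_real_derivative_iff_has_vector_derivative)
  have "of_real (exp x) * ?c / (1 + of_real (exp x) * ?c) = cnj (of_real (exp x) * cis (pi * \<rho>) / (1 + of_real (exp x) * cis (pi * \<rho>)))"
    by (simp add: cis_cnj)
  from arg_cong[OF this, of Im]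
  have "Im (of_real (exp x) * ?c / (1 + of_real (exp x) * ?c)) =
     - Im (of_real (exp x) * cis (pi * \<rho>) / (1 + of_real (exp x) * cis (pi * \<rho>)))"
    by (simp only: cnj.sel)
  also have "\<dots> = - strip_poisson \<rho> x"
    using poisson_Im[OF zero_less_one assms, of x] by simp
  finally have "Im (of_real (exp x) * ?c / (1 + of_real (exp x) * ?c)) = - strip_poisson \<rho> x" .
  with 1 show ?thesis by simp
qed


lemma isCont_sector_arg:
  assumes "0 < \<rho>" "\<rho> < 1"
  shows "isCont (\<lambda>x. sector_arg \<rho> (exp x)) x"
  using has_derivative_sector_arg[OF assms] by (rule DERIV_isCont)

text \<open>At height \<open>- pi / 2\<close> the denominators are real, so the real part picks out the argument of the
logarithm.\<close>

lemma wh_kernel_on_negative_line: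
  "Re (wh_kernel \<alpha> \<rho> a b (Complex x (- (pi / 2)))) =
     sector_arg (\<alpha> * \<rho>) (exp (\<alpha> * x)) * (exp x / (a + exp x) - exp x / (b + exp x))"
proof -
  let ?s = "Complex x (- (pi / 2))"
  have e1: "exp ?s = - \<i> * of_real (exp x)"
    by (simp add: exp_eq_polar complex_eq_iff)
  have e2: "exp (\<i> * (pi * \<alpha> * (1/2 - \<rho>)) + \<alpha> * ?s) = of_real (exp (\<alpha> * x)) * cis (- (pi * (\<alpha> * \<rho>)))"
  proof -
    have z: "pi * \<alpha> * (1/2 - \<rho>) + \<alpha> * (- (pi / 2)) = - (pi * (\<alpha> * \<rho>))" by (simp add: algebra_simps)
    show ?thesis
      using exp_rotate[of "pi * \<alpha> * (1/2 - \<rho>)" \<alpha> x "- (pi / 2)"] unfolding z by simp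
  qed
  have "wh_kernel \<alpha> \<rho> a b ?s = - \<i> * Ln (1 + of_real (exp (\<alpha> * x)) * cis (- (pi * (\<alpha> * \<rho>)))) *
      of_real (exp x / (a + exp x) - exp x / (b + exp x))"
    unfolding wh_kernel_def e2 unfolding e1 by (simp add: algebra_simps)
  moreover have "Re (- \<i> * u * of_real r) = Im u * r" for u r by simp
  ultimately show ?thesis by metis
qed

text \<open>The difference of logarithms shrinks as \<open>t\<close> grows, so it is bounded by its value at zero.\<close>

lemma abs_ln_ratio_le:
  fixes a b t :: real
  assumes "0 < a" "0 < b" "0 \<le> t"
  shows "\<bar>ln (a + t) - ln (b + t)\<bar> \<le> \<bar>ln a - ln b\<bar>"
proof -
  have *: "ln (q + t) - ln (p + t) \<le> ln q - ln p" if "0 < p" "p \<le> q" for p q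
  proof -
    have "(q + t) / (p + t) \<le> q / p" using that assms(3) by (simp add: field_simps mult_right_mono)
    then have "ln ((q + t) / (p + t)) \<le> ln (q / p)"
      using that assms(3) by (subst ln_le_cancel_iff) auto
    then show ?thesis using that assms(3) by (simp add: ln_div)
  qed
  show ?thesis
  proof (cases "a \<le> b")
    case True
    then show ?thesis using *[of a b] assms by (simp add: abs_if)
  next
    case False
    then show ?thesis using *[of b a] assms by (simp add: abs_if)
  qed
qed

text \<open>The angle vanishes at the left end and the difference of logarithms at the right end, so the
boundary terms disappear.\<close>

lemma wh_integral_by_parts:
  assumes "0 < a" "0 < b" "0 < \<alpha>" "0 < \<rho>" "\<rho> < 1"
    and int: "integrable lborel (\<lambda>x. sector_arg \<rho> (exp x) *
       (\<alpha> * (exp (\<alpha> * x) / (a + exp (\<alpha> * x)) - exp (\<alpha> * x) / (b + exp (\<alpha> * x)))))" (is "integrable _ ?f")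
  shows "(\<integral>x. sector_arg \<rho> (exp x) *
       (\<alpha> * (exp (\<alpha> * x) / (a + exp (\<alpha> * x)) - exp (\<alpha> * x) / (b + exp (\<alpha> * x)))) \<partial>lborel) =
     (\<integral>x. (ln (a + exp (\<alpha> * x)) - ln (b + exp (\<alpha> * x))) * strip_poisson \<rho> x \<partial>lborel)" (is "_ = integral\<^sup>L _ ?g")
proof -
  define \<Theta> where "\<Theta> x = sector_arg \<rho> (exp x)" for x
  define R where "R x = ln (a + exp (\<alpha> * x)) - ln (b + exp (\<alpha> * x))" for x
  have pos: "0 < d + exp (\<alpha> * x)" if "0 < d" for d x using that by (intro add_pos_pos) auto
  have dT: "(\<Theta> has_real_derivative - strip_poisson \<rho> x) (at x)" for x
    unfolding \<Theta>_def by (rule has_derivative_sector_arg) fact+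
  have dR: "(R has_real_derivative \<alpha> * (exp (\<alpha> * x) / (a + exp (\<alpha> * x)) - exp (\<alpha> * x) / (b + exp (\<alpha> * x)))) (at x)" for x
    unfolding R_def using pos[OF assms(1), of x] pos[OF assms(2), of x]
    by (auto intro!: derivative_eq_intros simp: algebra_simps)
  have cR: "isCont R x" for x using dR by (rule DERIV_isCont)
  have cg: "isCont ?g x" for x
    using isCont_mult[OF cR[of x] isCont_poisson[OF assms(4,5), of x]] unfolding R_def .
  have cf: "isCont ?f x" for x
    using pos[OF assms(1), of x] pos[OF assms(2), of x]
    by (intro continuous_intros isCont_sector_arg assms) auto
  obtain K where K: "0 \<le> K" "\<And>x. strip_poisson \<rho> (x - ln 1) \<le> K * (exp x / (1 + exp x)\<^sup>2)"
    using poisson_le[OF assms(4,5) zero_less_one] by metis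
  have pb: "strip_poisson \<rho> x \<le> K * envelope x" for x
  proof -
    have "strip_poisson \<rho> x \<le> K * (exp x / (1 + exp x)\<^sup>2)" using K(2)[of x] by simp
    also have "\<dots> \<le> K * envelope x"
      unfolding envelope_eq using K(1) by (intro mult_left_mono divide_right_mono) (auto simp: mult_le_cancel_left1)
    finally show ?thesis .
  qed
  have ig: "integrable lborel ?g"
  proof (rule Bochner_Integration.integrable_bound[of _ "\<lambda>x. \<bar>ln a - ln b\<bar> * (K * envelope x)"])
    show "?g \<in> borel_measurable lborel"
      using cg by (auto intro!: borel_measurable_continuous_onI continuous_at_imp_continuous_on)
    show "AE x in lborel. norm (?g x) \<le> norm (\<bar>ln a - ln b\<bar> * (K * envelope x))"
    proof (intro AE_I2)
      fix x
      have "norm (?g x) \<le> \<bar>ln a - ln b\<bar> * (K * envelope x)"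
        using abs_ln_ratio_le[OF assms(1,2), of "exp (\<alpha> * x)"] pb[of x] poisson_nonneg[OF assms(4,5), of x]
        by (auto simp: abs_mult intro!: mult_mono)
      then show "norm (?g x) \<le> norm (\<bar>ln a - ln b\<bar> * (K * envelope x))" by simp
    qed
  qed (intro integrable_mult_right integrable_envelope)
  have e_bot: "((\<lambda>x. exp (c * x)) \<longlongrightarrow> 0) at_bot" if "0 < c" for c :: real
    using that by (intro filterlim_compose[OF exp_at_bot] filterlim_tendsto_pos_mult_at_bot[OF tendsto_const _ filterlim_ident])
  have e_top: "filterlim (\<lambda>x. exp (\<alpha> * x)) at_top at_top"
    using \<open>0 < \<alpha>\<close> by (intro filterlim_compose[OF exp_at_top] filterlim_tendsto_pos_mult_at_top[OF tendsto_const _ filterlim_ident])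
  have T_bot: "(\<Theta> \<longlongrightarrow> 0) at_bot"
  proof -
    have "((\<lambda>x. sector_arg \<rho> (exp x)) \<longlongrightarrow> Im (Ln (1 + of_real 0 * cis (- (pi * \<rho>))))) at_bot"
      by (intro tendsto_intros exp_at_bot) auto
    then show ?thesis unfolding \<Theta>_def by simp
  qed
  have T_bd: "\<bar>\<Theta> x\<bar> \<le> pi" for x
  proof -
    have "1 + of_real (exp x) * cis (- (pi * \<rho>)) \<noteq> 0"
      using one_plus_cis_not_nonpos[of "- (pi * \<rho>)" "exp x" 1] assms by auto
    from mpi_less_Im_Ln[OF this] Im_Ln_le_pi[OF this] show ?thesis
      unfolding \<Theta>_def by linarith
  qed
  have R_bot: "(R \<longlongrightarrow> ln a - ln b) at_bot"
  proof -
    have "(R \<longlongrightarrow> ln (a + 0) - ln (b + 0)) at_bot"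
      unfolding R_def using assms by (intro tendsto_intros e_bot) auto
    then show ?thesis by simp
  qed
  have R_top: "(R \<longlongrightarrow> 0) at_top"
  proof -
    have "((\<lambda>x. ln (1 + (a - b) / (b + exp (\<alpha> * x)))) \<longlongrightarrow> ln (1 + 0)) at_top"
      by (intro tendsto_intros tendsto_divide_0[OF tendsto_const]
          filterlim_at_top_imp_at_infinity filterlim_tendsto_add_at_top[OF tendsto_const e_top]) auto
    then have "((\<lambda>x. ln (1 + (a - b) / (b + exp (\<alpha> * x)))) \<longlongrightarrow> 0) at_top" by simp
    moreover have "R = (\<lambda>x. ln (1 + (a - b) / (b + exp (\<alpha> * x))))"
    proof
      fix x
      have "1 + (a - b) / (b + exp (\<alpha> * x)) = (a + exp (\<alpha> * x)) / (b + exp (\<alpha> * x))"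
        using pos[OF assms(2), of x] by (simp add: field_simps)
      then show "R x = ln (1 + (a - b) / (b + exp (\<alpha> * x)))"
        unfolding R_def using pos[OF assms(1), of x] pos[OF assms(2), of x] by (simp add: ln_div)
    qed
    ultimately show ?thesis by (simp only:)
  qed
  have "integral\<^sup>L lborel (\<lambda>x. ?f x - ?g x) = 0 - 0 * (ln a - ln b)"
  proof (rule integral_FTC_real_line[where F="\<lambda>x. \<Theta> x * R x"])
    show "((\<lambda>x. \<Theta> x * R x) has_vector_derivative ?f x - ?g x) (at x)" for x
      unfolding has_real_derivative_iff_has_vector_derivative[symmetric]
      by (rule DERIV_cong[OF DERIV_mult[OF dT dR]]) (simp only: \<Theta>_def R_def, simp)
    show "isCont (\<lambda>x. ?f x - ?g x) x" for x by (intro continuous_diff cf cg)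
    show "integrable lborel (\<lambda>x. ?f x - ?g x)" by (intro Bochner_Integration.integrable_diff int ig)
    show "((\<lambda>x. \<Theta> x * R x) \<longlongrightarrow> 0 * (ln a - ln b)) at_bot" by (intro tendsto_mult T_bot R_bot)
    show "((\<lambda>x. \<Theta> x * R x) \<longlongrightarrow> 0) at_top"
    proof (rule Lim_null_comparison)
      show "\<forall>\<^sub>F x in at_top. norm (\<Theta> x * R x) \<le> pi * \<bar>R x\<bar>"
        using T_bd by (intro always_eventually) (auto simp: abs_mult intro!: mult_right_mono)
      show "((\<lambda>x. pi * \<bar>R x\<bar>) \<longlongrightarrow> 0) at_top"
        using tendsto_mult[OF tendsto_const[of pi] tendsto_rabs_zero[OF R_top]] by simp
    qed
  qed
  then show ?thesis by (simp add: Bochner_Integration.integral_diff[OF int ig])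
qed

text \<open>For \<open>(\<alpha>, \<rho>)\<close> the integral is brought to the Poisson form directly; for the dual parameters the line
is moved to height \<open>- pi / 2\<close>, the variable is scaled by \<open>\<alpha>\<close>, and an integration by parts gives the
same Poisson form.\<close>

theorem wh_integral_dual:
  assumes "0 < a" "0 < b" "0 < \<alpha>" "0 < \<rho>" "\<rho> < 1"
    and "\<bar>\<alpha> * (1 - 2 * \<rho>)\<bar> \<le> 1" "\<bar>1 / \<alpha> * (1 - 2 * (\<alpha> * \<rho>))\<bar> \<le> 1"
  shows "Re (wh_integral \<alpha> \<rho> a b) =
    Re (wh_integral (1 / \<alpha>) (\<alpha> * \<rho>) (a powr \<alpha>) (b powr \<alpha>))"
proof -
  define A where "A = a powr \<alpha>"
  define B where "B = b powr \<alpha>"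
  have AB: "0 < A" "0 < B" using assms by (auto simp: A_def B_def)
  have \<alpha>': "0 < 1 / \<alpha>" using assms by simp
  have A0: "\<bar>pi * (1 / \<alpha>) * (1/2 - \<alpha> * \<rho>) + 1 / \<alpha> * 0\<bar> < pi"
  proof -
    have "pi * (1 / \<alpha>) * (1/2 - \<alpha> * \<rho>) = pi / 2 * (1 / \<alpha> * (1 - 2 * (\<alpha> * \<rho>)))" by (simp add: algebra_simps)
    then have "\<bar>pi * (1 / \<alpha>) * (1/2 - \<alpha> * \<rho>)\<bar> = pi / 2 * \<bar>1 / \<alpha> * (1 - 2 * (\<alpha> * \<rho>))\<bar>"
      by (simp only: abs_mult) simp
    also have "\<dots> \<le> pi / 2 * 1" using assms by (intro mult_left_mono) auto
    also have "pi / 2 * 1 < pi" by simp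
    finally show ?thesis by (simp only: mult_zero_right add_0_right)
  qed
  have Ap: "pi * (1 / \<alpha>) * (1/2 - \<alpha> * \<rho>) + 1 / \<alpha> * (- (pi / 2)) = - (pi * \<rho>)"
    using assms by (simp add: field_simps)
  have Ap': "\<bar>pi * (1 / \<alpha>) * (1/2 - \<alpha> * \<rho>) + 1 / \<alpha> * (- (pi / 2))\<bar> < pi"
    unfolding Ap using assms by simp
  have half: "\<bar>pi / 2 + 0\<bar> < pi" "\<bar>pi / 2 + (- (pi / 2))\<bar> < pi" using pi_gt_zero by auto
  have K: "integrable lborel (\<lambda>x. wh_kernel (1 / \<alpha>) (\<alpha> * \<rho>) A B (Complex x (- (pi / 2))))"
    by (rule wh_kernel_integrable[OF AB \<alpha>' half(2) Ap'])
  have Re: "Re (wh_kernel (1 / \<alpha>) (\<alpha> * \<rho>) A B (Complex x (- (pi / 2)))) =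
     sector_arg \<rho> (exp (x / \<alpha>)) * (exp x / (A + exp x) - exp x / (B + exp x))" for x
    using wh_kernel_on_negative_line[of "1 / \<alpha>" "\<alpha> * \<rho>" A B x] assms by simp
  let ?f = "\<lambda>x. sector_arg \<rho> (exp (x / \<alpha>)) * (exp x / (A + exp x) - exp x / (B + exp x))"
  let ?g = "\<lambda>x. sector_arg \<rho> (exp x) *
       (\<alpha> * (exp (\<alpha> * x) / (A + exp (\<alpha> * x)) - exp (\<alpha> * x) / (B + exp (\<alpha> * x))))"
  have intf: "integrable lborel ?f"
    using integrable_Re[OF K] unfolding Re .
  have fg: "\<alpha> * ?f (0 + \<alpha> * x) = ?g x" for x using assms by simp
  have intg: "integrable lborel ?g"
    using integrable_mult_right[OF lborel_integrable_real_affine[OF intf, of \<alpha> 0], of \<alpha>] assms(3)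
    unfolding fg by simp
  have "Re (wh_integral (1 / \<alpha>) (\<alpha> * \<rho>) A B) =
        Re (integral\<^sup>L lborel (\<lambda>x. wh_kernel (1 / \<alpha>) (\<alpha> * \<rho>) A B (Complex x (- (pi / 2)))))"
    by (rule arg_cong[where f=Re], rule wh_kernel_line_shift[OF AB \<alpha>' half(1) A0 half(2) Ap'])
  also have "\<dots> = integral\<^sup>L lborel ?f"
    unfolding integral_Re[OF K, symmetric] Re ..
  also have "\<dots> = \<bar>\<alpha>\<bar> *\<^sub>R (\<integral>x. ?f (0 + \<alpha> * x) \<partial>lborel)"
    using assms(3) by (intro lborel_integral_real_affine[of \<alpha> ?f 0]) simp
  also have "\<dots> = (\<integral>x. \<alpha> * ?f (0 + \<alpha> * x) \<partial>lborel)"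
    using assms(3) by (simp only: integral_mult_right_zero real_scaleR_def abs_of_pos)
  also have "\<dots> = integral\<^sup>L lborel ?g" by (simp only: fg)
  also have "\<dots> = (\<integral>x. (ln (A + exp (\<alpha> * x)) - ln (B + exp (\<alpha> * x))) * strip_poisson \<rho> x \<partial>lborel)"
    by (rule wh_integral_by_parts[OF AB assms(3-5) intg])
  also have "\<dots> = Re (wh_integral \<alpha> \<rho> a b)"
    unfolding A_def B_def by (rule wh_integral_poisson[symmetric]) fact+
  finally show ?thesis unfolding A_def B_def ..
qed

section \<open>Fourier inversion for differences of resolvents\<close>

text \<open>Levy's inversion formula gives the mass of \<open>(x, x + h]\<close> as an absolutely convergent integral.
Dividing by \<open>h\<close> and letting \<open>h\<close> tend to zero gives the density on one side and the inverse Fourier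
integral, by dominated convergence, on the other.\<close>

lemma density_inversion:
  fixes f :: "real \<Rightarrow> real"
  assumes "real_distribution (density lborel (\<lambda>x. ennreal (f x)))" (is "real_distribution ?M")
    and cont: "continuous_on UNIV f" and nonneg: "\<And>x. 0 \<le> f x"
    and int: "integrable lborel (char (density lborel (\<lambda>x. ennreal (f x))))"
  shows "of_real (f x) = 1 / (2 * pi) * (CLBINT t. iexp (- (t * x)) * char (density lborel (\<lambda>x. ennreal (f x))) t)"
proof -
  define M where "M = ?M"
  interpret real_distribution M unfolding M_def by fact
  have f_meas [measurable]: "f \<in> borel_measurable borel"
    using cont by (rule borel_measurable_continuous_onI)
  have point: "measure M {y} = 0" for y
  proof -
    have "AE x in lborel. x \<noteq> y" by (rule AE_lborel_singleton)
    then have "emeasure M {y} = 0"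
      unfolding M_def
      by (subst emeasure_density) (auto intro!: nn_integral_0_iff_AE[THEN iffD2] elim!: eventually_mono simp: indicator_def)
    then show ?thesis by (simp add: measure_def)
  qed
  have int': "integrable lborel (char M)" unfolding M_def by fact
  let ?k = "\<lambda>h t. (iexp (- (t * x)) - iexp (- (t * (x + h)))) / (\<i> * t) * char M t"
  have k_bound: "cmod (?k h t) \<le> h * cmod (char M t)" if "0 < h" for h t
  proof (cases "t = 0")
    case True
    then show ?thesis using that by simp
  next
    case False
    have "cmod ((iexp (- (t * x)) - iexp (- (t * (x + h)))) / (\<i> * t)) \<le> h"
      using Levy_Inversion_aux2[of "- (x + h)" "- x" t] that False
      unfolding mult_minus_right by simp
    then show ?thesis unfolding norm_mult by (rule mult_right_mono) simp
  qed
  have k_int: "integrable lborel (?k h)" if "0 < h" for h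
  proof (rule Bochner_Integration.integrable_bound[of _ "\<lambda>t. h * cmod (char M t)"])
    show "AE t in lborel. cmod (?k h t) \<le> norm (h * cmod (char M t))"
      using k_bound[OF that] by (auto intro!: AE_I2 order_trans[OF _ abs_ge_self])
  qed (use int' in auto)
  have interval: "of_real (measure M {x<..x + h}) = 1 / (2 * pi) * (CLBINT t. ?k h t)" if "0 < h" for h
  proof (rule LIMSEQ_unique)
    show "(\<lambda>T. 1 / (2 * pi) * (CLBINT t=- real T..real T. ?k h t)) \<longlonglongrightarrow> of_real (measure M {x<..x + h})"
      using Levy_Inversion[of x "x + h"] that point by simp
    have "(\<lambda>T::nat. CLBINT t. indicator {- real T<..<real T} t *\<^sub>R ?k h t) \<longlonglongrightarrow> (CLBINT t. ?k h t)"
    proof (rule integral_dominated_convergence[where w="\<lambda>t. h * cmod (char M t)"])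
      show "AE t in lborel. (\<lambda>T::nat. indicator {- real T<..<real T} t *\<^sub>R ?k h t) \<longlonglongrightarrow> ?k h t"
      proof (rule AE_I2, rule tendsto_eventually)
        fix t :: real
        obtain N where N: "\<bar>t\<bar> < real N" using reals_Archimedean2 by blast
        show "\<forall>\<^sub>F T in sequentially. indicator {- real T<..<real T} t *\<^sub>R ?k h t = ?k h t"
          using eventually_ge_at_top[of N] by eventually_elim (use N in \<open>auto simp: indicator_def\<close>)
      qed
      show "AE t in lborel. cmod (indicator {- real T<..<real T} t *\<^sub>R ?k h t) \<le> h * cmod (char M t)" for T
        using k_bound[OF that] that by (intro AE_I2) (auto simp: indicator_def)
    qed (use int' in auto)
    then have "(\<lambda>T::nat. CLBINT t=- real T..real T. ?k h t) \<longlonglongrightarrow> (CLBINT t. ?k h t)"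
      by (simp add: interval_lebesgue_integral_def set_lebesgue_integral_def)
    then show "(\<lambda>T. 1 / (2 * pi) * (CLBINT t=- real T..real T. ?k h t)) \<longlonglongrightarrow> 1 / (2 * pi) * (CLBINT t. ?k h t)"
      by (intro tendsto_mult tendsto_const)
  qed
  define h where "h n = 1 / real (Suc n)" for n
  have h: "0 < h n" "h n \<le> 1" for n by (auto simp: h_def)
  have h_ne: "h n \<noteq> 0" for n using h(1)[of n] by simp
  have h0: "h \<longlonglongrightarrow> 0" unfolding h_def by (rule LIMSEQ_Suc[OF lim_1_over_n])
  have "(\<lambda>n. of_real (measure M {x<..x + h n} / h n)) \<longlonglongrightarrow> complex_of_real (f x)"
  proof (rule tendsto_of_real)
    have meas: "measure M {x<..x + u} = integral {x..x + u} f" if "0 < u" for u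
    proof -
      have si: "set_integrable lborel {x..x + u} f"
        using continuous_on_subset[OF cont] by (intro borel_integrable_atLeastAtMost') auto
      have "emeasure M {x<..x + u} = (\<integral>\<^sup>+y. ennreal (f y) * indicator {x<..x + u} y \<partial>lborel)"
        unfolding M_def by (rule emeasure_density) auto
      also have "\<dots> = (\<integral>\<^sup>+y. ennreal (indicator {x..x + u} y * f y) \<partial>lborel)"
        using AE_lborel_singleton[of x]
        by (intro nn_integral_cong_AE) (auto elim!: eventually_mono simp: indicator_def)
      also have "\<dots> = ennreal (LBINT y:{x..x + u}. f y)"
        using si nonneg unfolding set_integrable_def set_lebesgue_integral_def
        by (subst nn_integral_eq_integral) auto
      also have "(LBINT y:{x..x + u}. f y) = integral {x..x + u} f"
        by (rule set_borel_integral_eq_integral) fact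
      finally show ?thesis
        using nonneg by (simp add: measure_def integral_nonneg enn2real_ennreal set_borel_integral_eq_integral[OF si])
    qed
    have "((\<lambda>u. integral {x..u} f) has_real_derivative f x) (at x within {x..x + 1})"
      using continuous_on_subset[OF cont] by (intro integral_has_real_derivative) auto
    then have "((\<lambda>y. (integral {x..y} f - integral {x..x} f) / (y - x)) \<longlongrightarrow> f x) (at x within {x..x + 1})"
      by (simp add: has_field_derivative_iff)
    moreover have "filterlim (\<lambda>n. x + h n) (at x within {x..x + 1}) sequentially"
      unfolding filterlim_at using h tendsto_add[OF tendsto_const h0, of x]
      by (auto intro!: always_eventually simp: less_imp_le h_ne)
    ultimately have "(\<lambda>n. (integral {x..x + h n} f - integral {x..x} f) / (x + h n - x)) \<longlonglongrightarrow> f x"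
      by (rule filterlim_compose)
    then show "(\<lambda>n. measure M {x<..x + h n} / h n) \<longlonglongrightarrow> f x"
      using meas h by simp
  qed
  moreover have "(\<lambda>n. of_real (measure M {x<..x + h n} / h n)) \<longlonglongrightarrow> 1 / (2 * pi) * (CLBINT t. iexp (- (t * x)) * char M t)"
  proof -
    have "(\<lambda>n. CLBINT t. ?k (h n) t / h n) \<longlonglongrightarrow> (CLBINT t. iexp (- (t * x)) * char M t)"
    proof (rule integral_dominated_convergence[where w="\<lambda>t. cmod (char M t)"])
      show "AE t in lborel. cmod (?k (h n) t / h n) \<le> cmod (char M t)" for n
      proof (rule AE_I2)
        fix t
        have "cmod (?k (h n) t / h n) = cmod (?k (h n) t) / h n"
          using h(1)[of n] by (subst norm_divide) simp
        also have "\<dots> \<le> cmod (char M t)"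
          using k_bound[OF h(1)[of n], of t] h(1)[of n] by (subst pos_divide_le_eq) (auto simp: mult.commute)
        finally show "cmod (?k (h n) t / h n) \<le> cmod (char M t)" .
      qed
      show "AE t in lborel. (\<lambda>n. ?k (h n) t / h n) \<longlonglongrightarrow> iexp (- (t * x)) * char M t"
        using AE_lborel_singleton[of 0]
      proof eventually_elim
        fix t :: real assume t: "t \<noteq> 0"
        have "((\<lambda>u. exp (- (\<i> * t) * u)) has_field_derivative - (\<i> * t) * exp (- (\<i> * t) * of_real x)) (at (complex_of_real x))"
          by (auto intro!: derivative_eq_intros)
        then have "((\<lambda>y. (exp (- (\<i> * t) * y) - exp (- (\<i> * t) * of_real x)) / (y - of_real x)) \<longlongrightarrow> - (\<i> * t) * exp (- (\<i> * t) * of_real x)) (at (complex_of_real x))"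
          by (simp add: has_field_derivative_iff)
        moreover have "filterlim (\<lambda>n. complex_of_real (x + h n)) (at (of_real x)) sequentially"
          unfolding filterlim_at using h tendsto_of_real[OF tendsto_add[OF tendsto_const h0, of x]]
          by (auto intro!: always_eventually simp: h_ne)
        ultimately have "(\<lambda>n. (exp (- (\<i> * t) * of_real (x + h n)) - exp (- (\<i> * t) * of_real x)) / (of_real (x + h n) - of_real x)) \<longlonglongrightarrow> - (\<i> * t) * exp (- (\<i> * t) * of_real x)"
          by (rule filterlim_compose)
        then have "(\<lambda>n. (exp (- (\<i> * t) * of_real (x + h n)) - exp (- (\<i> * t) * of_real x)) / (of_real (x + h n) - of_real x) * (- char M t / (\<i> * t))) \<longlonglongrightarrow> - (\<i> * t) * exp (- (\<i> * t) * of_real x) * (- char M t / (\<i> * t))"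
          by (intro tendsto_mult tendsto_const)
        also have "- (\<i> * t) * exp (- (\<i> * t) * of_real x) * (- char M t / (\<i> * t)) = iexp (- (t * x)) * char M t"
          using t by (simp add: field_simps)
        also have "(\<lambda>n. (exp (- (\<i> * t) * of_real (x + h n)) - exp (- (\<i> * t) * of_real x)) / (of_real (x + h n) - of_real x) * (- char M t / (\<i> * t))) = (\<lambda>n. ?k (h n) t / h n)"
          using t by (auto simp: fun_eq_iff divide_simps mult_ac) (auto simp: algebra_simps)
        finally show "(\<lambda>n. ?k (h n) t / h n) \<longlonglongrightarrow> iexp (- (t * x)) * char M t" .
      qed
    qed (use int' in auto)
    then have "(\<lambda>n. 1 / (2 * pi) * (CLBINT t. ?k (h n) t / h n)) \<longlonglongrightarrow> 1 / (2 * pi) * (CLBINT t. iexp (- (t * x)) * char M t)"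
      by (intro tendsto_mult tendsto_const)
    also have "(\<lambda>n. 1 / (2 * pi) * (CLBINT t. ?k (h n) t / h n)) = (\<lambda>n. of_real (measure M {x<..x + h n} / h n))"
    proof
      fix n
      have "(CLBINT t. ?k (h n) t / h n) = (CLBINT t. ?k (h n) t) / h n"
        by (rule integral_divide_zero)
      then show "1 / (2 * pi) * (CLBINT t. ?k (h n) t / h n) = of_real (measure M {x<..x + h n} / h n)"
        using interval[OF h(1)[of n]] by (simp add: mult.commute)
    qed
    finally show ?thesis .
  qed
  ultimately show ?thesis
    unfolding M_def[symmetric] by (rule LIMSEQ_unique)
qed

lemma laplace_exponential:
  fixes c :: complex
  assumes "Re c < 0"
  shows "set_integrable lborel {0<..} (\<lambda>x. exp (c * of_real x))"
    and "(CLBINT x:{0<..}. exp (c * of_real x)) = - 1 / c"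
proof -
  have c0: "c \<noteq> 0" using assms by auto
  have lim: "((\<lambda>x. exp (r * x)) \<longlongrightarrow> 0) at_top" if "r < 0" for r :: real
    using that by (intro filterlim_compose[OF exp_at_bot] filterlim_tendsto_neg_mult_at_bot[OF tendsto_const _ filterlim_ident])
  have "set_integrable lborel (einterval 0 \<infinity>) (\<lambda>x. exp (Re c * x))"
  proof (rule interval_integral_FTC_nonneg(1)[where F="\<lambda>x. exp (Re c * x) / Re c"])
    show "(((\<lambda>x. exp (Re c * x) / Re c) \<circ> real_of_ereal) \<longlongrightarrow> exp (Re c * 0) / Re c) (at_right 0)"
      unfolding zero_ereal_def ereal_tendsto_simps using assms by (intro tendsto_intros) auto
    show "(((\<lambda>x. exp (Re c * x) / Re c) \<circ> real_of_ereal) \<longlongrightarrow> 0 / Re c) (at_left \<infinity>)"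
      unfolding ereal_tendsto_simps using assms by (intro tendsto_intros lim) auto
  qed (use assms in \<open>auto intro!: derivative_eq_intros continuous_intros\<close>)
  then have 1: "set_integrable lborel {0<..} (\<lambda>x. exp (Re c * x))"
    by (simp add: zero_ereal_def)
  show 2: "set_integrable lborel {0<..} (\<lambda>x. exp (c * of_real x))"
    by (rule set_integrable_bound[OF 1]) (auto simp: set_borel_measurable_def)
  have "(LBINT x=0..\<infinity>. exp (c * of_real x)) = 0 - exp (c * of_real 0) / c"
  proof (rule interval_integral_FTC_integrable[where F="\<lambda>x. exp (c * of_real x) / c"])
    show "((\<lambda>x. exp (c * of_real x) / c) has_vector_derivative exp (c * of_real x)) (at x)" for x
    proof -
      have "((\<lambda>z. exp (c * z) / c) has_field_derivative exp (c * of_real x)) (at (of_real x))"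
        using c0 by (auto intro!: derivative_eq_intros)
      from has_vector_derivative_real_field[OF this] show ?thesis .
    qed
    show "set_integrable lborel (einterval 0 \<infinity>) (\<lambda>x. exp (c * of_real x))"
      using 2 by (simp add: zero_ereal_def)
    show "(((\<lambda>x. exp (c * of_real x) / c) \<circ> real_of_ereal) \<longlongrightarrow> exp (c * of_real 0) / c) (at_right 0)"
      unfolding zero_ereal_def ereal_tendsto_simps using c0 by (intro tendsto_intros) auto
    have "((\<lambda>x. exp (c * of_real x)) \<longlongrightarrow> 0) at_top"
      by (rule tendsto_norm_zero_cancel) (use lim[OF assms] in simp)
    from tendsto_divide[OF this tendsto_const[of c]] c0
    show "(((\<lambda>x. exp (c * of_real x) / c) \<circ> real_of_ereal) \<longlongrightarrow> 0) (at_left \<infinity>)"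
      unfolding ereal_tendsto_simps by simp
  qed (auto intro!: continuous_intros)
  then show "(CLBINT x:{0<..}. exp (c * of_real x)) = - 1 / c"
    by (simp add: interval_lebesgue_integral_def zero_ereal_def)
qed


lemma integrable_resolvent_diff:
  fixes a b :: real
  assumes "0 < a" "0 < b"
  shows "integrable lborel (\<lambda>t::real. 1 / (a + \<i> * t) - 1 / (b + \<i> * t))"
proof (rule Bochner_Integration.integrable_bound[of _ "\<lambda>t. \<bar>b - a\<bar> / (min 1 a * min 1 b) * inverse (1 + t\<^sup>2)"])
  show "integrable lborel (\<lambda>t. \<bar>b - a\<bar> / (min 1 a * min 1 b) * inverse (1 + t\<^sup>2))"
    using integrable_inverse_1_plus_square by (simp add: set_integrable_def)
  show "AE t in lborel. cmod (1 / (a + \<i> * t) - 1 / (b + \<i> * t)) \<le>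
      norm (\<bar>b - a\<bar> / (min 1 a * min 1 b) * inverse (1 + t\<^sup>2))"
  proof (rule AE_I2)
    fix t :: real
    have g: "min 1 d * sqrt (1 + t\<^sup>2) \<le> cmod (d + \<i> * t)" if "0 < d" for d
    proof -
      have "(min 1 d)\<^sup>2 \<le> d\<^sup>2" "(min 1 d)\<^sup>2 \<le> 1"
        using that by (auto intro!: power_mono power_le_one)
      from this(1) mult_right_mono[OF this(2), of "t\<^sup>2"]
      have "sqrt ((min 1 d)\<^sup>2 * (1 + t\<^sup>2)) \<le> sqrt (d\<^sup>2 + t\<^sup>2)"
        by (simp add: algebra_simps)
      then show ?thesis using that by (simp add: real_sqrt_mult cmod_def)
    qed
    have pos: "0 < min 1 d * sqrt (1 + t\<^sup>2)" if "0 < d" for d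
      using that by (intro mult_pos_pos) (auto simp: add_pos_nonneg)
    have nz: "d + \<i> * t \<noteq> 0" if "0 < d" for d :: real using g[OF that] pos[OF that] by auto
    have "1 / (a + \<i> * t) - 1 / (b + \<i> * t) = of_real (b - a) / ((a + \<i> * t) * (b + \<i> * t))"
      using nz[OF assms(1)] nz[OF assms(2)] by (simp add: field_simps)
    then have "cmod (1 / (a + \<i> * t) - 1 / (b + \<i> * t)) = \<bar>b - a\<bar> / (cmod (a + \<i> * t) * cmod (b + \<i> * t))"
      by (simp add: norm_divide norm_mult del: of_real_diff)
    also have "\<dots> \<le> \<bar>b - a\<bar> / ((min 1 a * sqrt (1 + t\<^sup>2)) * (min 1 b * sqrt (1 + t\<^sup>2)))"
    proof -
      have "u / (p * q) \<le> u / (p' * q')" if "0 < p'" "0 < q'" "p' \<le> p" "q' \<le> q" "0 \<le> u" for u p q p' q' :: real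
        using that by (intro divide_left_mono mult_mono mult_pos_pos) auto
      from this[OF pos[OF assms(1)] pos[OF assms(2)] g[OF assms(1)] g[OF assms(2)]] show ?thesis by simp
    qed
    also have "(min 1 a * sqrt (1 + t\<^sup>2)) * (min 1 b * sqrt (1 + t\<^sup>2)) = (min 1 a * min 1 b) * (1 + t\<^sup>2)"
      by (simp add: mult_ac real_sqrt_mult_self abs_of_nonneg)
    finally show "cmod (1 / (a + \<i> * t) - 1 / (b + \<i> * t)) \<le>
      norm (\<bar>b - a\<bar> / (min 1 a * min 1 b) * inverse (1 + t\<^sup>2))"
      using assms by (simp add: divide_inverse mult_ac abs_mult)
  qed
qed measurable

text \<open>Up to the constant \<open>k\<close>, the right side is the density of a sum of two independent exponential
variables with rates \<open>a\<close> and \<open>b\<close>. It is continuous with integrable characteristic function, unlike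
the exponential density itself, and this is why differences at two points are considered.\<close>

lemma resolvent_diff_inversion:
  fixes a b x :: real
  assumes "0 < a" "a < b"
  shows "1 / (2 * pi) * (CLBINT t. iexp (t * x) * (1 / (a + \<i> * t) - 1 / (b + \<i> * t))) =
     of_real (exp (- a * max 0 x) - exp (- b * max 0 x))"
proof -
  \<comment> \<open>The normalisation that makes the right side a probability density.\<close>
  define k where "k = a * b / (b - a)"
  have k: "0 < k" using assms by (simp add: k_def)
  define f where "f y = k * (exp (- a * max 0 y) - exp (- b * max 0 y))" for y :: real
  have f_nonneg: "0 \<le> f y" for y
    unfolding f_def using k assms by (intro mult_nonneg_nonneg) (auto simp: mult_right_mono)
  have f_cont: "continuous_on UNIV f"
    unfolding f_def by (intro continuous_intros)
  then have f_meas [measurable]: "f \<in> borel_measurable borel"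
    by (rule borel_measurable_continuous_onI)
  have f_exp: "f y *\<^sub>R iexp (t * y) = k * (indicator {0<..} y *\<^sub>R exp ((\<i> * t - a) * of_real y) -
      indicator {0<..} y *\<^sub>R exp ((\<i> * t - b) * of_real y))" for y t
  proof -
    have "exp ((\<i> * t - d) * of_real y) = of_real (exp (- d * y)) * iexp (t * y)" for d :: real
    proof -
      have "(\<i> * t - d) * of_real y = of_real (- d * y) + \<i> * of_real (t * y)" by (simp add: algebra_simps)
      then show ?thesis by (simp only: exp_add exp_of_real)
    qed
    then show ?thesis
      by (cases "0 < y") (auto simp: f_def scaleR_conv_of_real max_def algebra_simps)
  qed
  have neg: "Re (\<i> * t - a) < 0" "Re (\<i> * t - b) < 0" for t :: real using assms by auto
  have f_int: "integrable lborel (\<lambda>y. f y *\<^sub>R iexp (t * y))" for t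
    unfolding f_exp using laplace_exponential(1)[OF neg(1)] laplace_exponential(1)[OF neg(2)]
    unfolding set_integrable_def by (intro integrable_mult_right Bochner_Integration.integrable_diff)
  have f_val: "(CLBINT y. f y *\<^sub>R iexp (t * y)) = k * (1 / (a - \<i> * t) - 1 / (b - \<i> * t))" for t
  proof -
    have "(CLBINT y. f y *\<^sub>R iexp (t * y)) = k * (- 1 / (\<i> * t - a) - - 1 / (\<i> * t - b))"
      unfolding f_exp using laplace_exponential[OF neg(1)] laplace_exponential[OF neg(2)]
      unfolding set_integrable_def set_lebesgue_integral_def
      by (simp add: Bochner_Integration.integral_diff)
    moreover have "- 1 / (\<i> * t - a) = 1 / (a - \<i> * t)" "- 1 / (\<i> * t - b) = 1 / (b - \<i> * t)"
      by (metis minus_diff_eq minus_divide_divide minus_minus)+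
    ultimately show ?thesis by (simp only:)
  qed
  define N where "N = density lborel (\<lambda>y. ennreal (f y))"
  have f_int0: "integrable lborel f" "(\<integral>y. f y \<partial>lborel) = 1"
  proof -
    have eq: "f y *\<^sub>R iexp (0 * y) = of_real (f y)" for y by (simp add: scaleR_conv_of_real)
    show 1: "integrable lborel f" using integrable_Re[OF f_int[of 0]] unfolding eq by simp
    have "complex_of_real (\<integral>y. f y \<partial>lborel) = complex_of_real (k * (1 / a - 1 / b))"
      using f_val[of 0] unfolding eq by simp
    then have "(\<integral>y. f y \<partial>lborel) = k * (1 / a - 1 / b)" by (metis of_real_eq_iff)
    also have "\<dots> = 1" using assms by (simp add: k_def field_simps)
    finally show "(\<integral>y. f y \<partial>lborel) = 1" .
  qed
  have N: "real_distribution N"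
  proof -
    have "prob_space N"
    proof
      show "emeasure N (space N) = 1"
        unfolding N_def using f_int0 f_nonneg by (simp add: emeasure_density nn_integral_eq_integral)
    qed
    then show ?thesis
      by (simp add: real_distribution_def real_distribution_axioms_def N_def)
  qed
  have charN: "char N t = k * (1 / (a - \<i> * t) - 1 / (b - \<i> * t))" for t
    unfolding char_def N_def f_val[symmetric] using f_nonneg by (subst integral_density) auto
  have "integrable lborel (char N)"
    using integrable_mult_right[OF lborel_integrable_real_affine[OF integrable_resolvent_diff[of a b], of "-1" 0], of k] assms
    unfolding charN by simp
  from density_inversion[OF N[unfolded N_def] f_cont f_nonneg this[unfolded N_def], of x]
  have "of_real (f x) = 1 / (2 * pi) * (CLBINT t. iexp (- (t * x)) * char N t)"
    unfolding N_def[symmetric] .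
  also have "(CLBINT t. iexp (- (t * x)) * char N t) =
     (CLBINT t. k * (iexp (- (t * x)) * (1 / (a - \<i> * t) - 1 / (b - \<i> * t))))"
    unfolding charN by (simp add: mult_ac)
  also have "\<dots> = k * (CLBINT t. iexp (- (t * x)) * (1 / (a - \<i> * t) - 1 / (b - \<i> * t)))"
    by (rule integral_mult_right_zero)
  also have "(CLBINT t. iexp (- (t * x)) * (1 / (a - \<i> * t) - 1 / (b - \<i> * t))) =
      (CLBINT t. iexp (t * x) * (1 / (a + \<i> * t) - 1 / (b + \<i> * t)))"
    using lborel_integral_real_affine[of "-1" "\<lambda>t. iexp (t * x) * (1 / (a + \<i> * t) - 1 / (b + \<i> * t))" 0]
    by simp
  finally have "complex_of_real k * of_real (exp (- a * max 0 x) - exp (- b * max 0 x)) =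
     k * (1 / (2 * pi) * (CLBINT t. iexp (t * x) * (1 / (a + \<i> * t) - 1 / (b + \<i> * t))))"
    unfolding f_def by simp
  note scaled = this
  have "complex_of_real k \<noteq> 0" using k by simp
  from mult_left_cancel[THEN iffD1, OF this scaled] show ?thesis ..
qed

text \<open>Parseval's formula for the test function of \<open>resolvent_diff_inversion\<close>.\<close>

lemma expectation_pos_part_char:
  fixes a b :: real
  assumes "real_distribution w" "0 < a" "a < b"
  shows "of_real (\<integral>x. exp (- a * max 0 x) - exp (- b * max 0 x) \<partial>w) =
     1 / (2 * pi) * (CLBINT t. char w t * (1 / (a + \<i> * t) - 1 / (b + \<i> * t)))"
proof -
  interpret w: real_distribution w by fact
  interpret pair_sigma_finite lborel w ..
  let ?g = "\<lambda>t::real. 1 / (a + \<i> * t) - 1 / (b + \<i> * t)"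
  have g: "integrable lborel ?g" by (rule integrable_resolvent_diff) (use assms in auto)
  have "integrable (lborel \<Otimes>\<^sub>M w) (\<lambda>(t, x). iexp (t * x) * ?g t)"
  proof (rule Fubini_integrable)
    have "integrable lborel (\<lambda>t. cmod (?g t))" using g by (rule integrable_norm)
    then show "integrable lborel (\<lambda>t. \<integral>x. norm (case (t, x) of (t, x) \<Rightarrow> iexp (t * x) * ?g t) \<partial>w)"
      by (simp add: norm_mult w.prob_space[simplified])
    show "AE t in lborel. integrable w (\<lambda>x. case (t, x) of (t, x) \<Rightarrow> iexp (t * x) * ?g t)"
      by (intro AE_I2) (auto intro!: w.integrable_const_bound[where B="cmod (?g t)" for t] simp: norm_mult)
  qed measurable
  then have "(\<integral>x. (CLBINT t. iexp (t * x) * ?g t) \<partial>w) = (CLBINT t. (\<integral>x. iexp (t * x) * ?g t \<partial>w))"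
    by (rule Fubini_integral)
  also have "\<dots> = (CLBINT t. char w t * ?g t)"
    unfolding char_def by simp
  finally have "1 / (2 * pi) * (CLBINT t. char w t * ?g t) = (\<integral>x. 1 / (2 * pi) * (CLBINT t. iexp (t * x) * ?g t) \<partial>w)"
    by simp
  also have "\<dots> = (\<integral>x. complex_of_real (exp (- a * max 0 x) - exp (- b * max 0 x)) \<partial>w)"
    unfolding resolvent_diff_inversion[OF assms(2,3)] ..
  also have "\<dots> = of_real (\<integral>x. exp (- a * max 0 x) - exp (- b * max 0 x) \<partial>w)"
    by (rule integral_complex_of_real)
  finally show ?thesis ..
qed

section \<open>The exponent in Spitzer's identity for a stable walk\<close>

lemma stable_exponent_eq:
  assumes "0 < t"
  shows "stable_exponent \<alpha> \<rho> t = cis (pi * \<alpha> * (1/2 - \<rho>)) * of_real (t powr \<alpha>)"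
    and "stable_exponent \<alpha> \<rho> (- t) = cnj (stable_exponent \<alpha> \<rho> t)"
proof -
  have e: "exp (pi * \<i> * (complex_of_real \<alpha> * (1 - 2 * complex_of_real \<rho>)) / 2) = cis (pi * \<alpha> * (1/2 - \<rho>))"
    unfolding cis_conv_exp by (rule arg_cong[where f=exp]) (simp add: field_simps)
  show 1: "stable_exponent \<alpha> \<rho> t = cis (pi * \<alpha> * (1/2 - \<rho>)) * of_real (t powr \<alpha>)"
    using assms by (simp only: stable_exponent_def Let_def if_True e abs_of_pos)
  have "exp (- (pi * \<i> * (complex_of_real \<alpha> * (1 - 2 * complex_of_real \<rho>)) / 2)) = cnj (cis (pi * \<alpha> * (1/2 - \<rho>)))"
    unfolding e[symmetric] exp_minus by (simp add: cis_cnj e flip: cis_inverse)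
  then show "stable_exponent \<alpha> \<rho> (- t) = cnj (stable_exponent \<alpha> \<rho> t)"
    unfolding 1 using assms by (simp only: stable_exponent_def Let_def) simp
qed

lemma Re_stable_exponent_nonneg:
  assumes "\<bar>\<alpha> * (1 - 2 * \<rho>)\<bar> \<le> 1"
  shows "0 \<le> Re (stable_exponent \<alpha> \<rho> t)"
proof -
  have "pi * \<alpha> * (1/2 - \<rho>) = pi / 2 * (\<alpha> * (1 - 2 * \<rho>))" by (simp add: algebra_simps)
  then have "\<bar>pi * \<alpha> * (1/2 - \<rho>)\<bar> = pi / 2 * \<bar>\<alpha> * (1 - 2 * \<rho>)\<bar>"
    by (simp only: abs_mult) simp
  also have "\<dots> \<le> pi / 2 * 1" using assms by (intro mult_left_mono) auto
  finally have "- (pi / 2) \<le> pi * \<alpha> * (1/2 - \<rho>)" "pi * \<alpha> * (1/2 - \<rho>) \<le> pi / 2"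
    unfolding mult_1_right by (simp_all only: abs_le_iff minus_le_iff)
  then have c: "0 \<le> cos (pi * \<alpha> * (1/2 - \<rho>))" by (rule cos_ge_zero)
  have pos: "0 \<le> Re (stable_exponent \<alpha> \<rho> t)" if "0 < t" for t
    unfolding stable_exponent_eq(1)[OF that] using c by simp
  consider "0 < t" | "t = 0" | "0 < - t" by linarith
  then show ?thesis
  proof cases
    case 3
    then show ?thesis using pos[OF 3] stable_exponent_eq(2)[OF 3, of \<alpha> \<rho>] by simp
  qed (use pos in \<open>auto simp: stable_exponent_def\<close>)
qed

lemma norm_stable_exponent: "0 < t \<Longrightarrow> cmod (stable_exponent \<alpha> \<rho> t) = t powr \<alpha>"
  by (simp add: stable_exponent_eq norm_mult)

lemma stable_exponent_measurable [measurable]: "stable_exponent \<alpha> \<rho> \<in> borel_measurable borel"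
  unfolding stable_exponent_def[abs_def] Let_def by measurable

lemma cmod_one_minus_exp_le:
  fixes z :: complex
  assumes "0 \<le> Re z"
  shows "cmod (1 - exp (- z)) \<le> cmod z"
proof -
  have "cmod (exp (- z) - exp (- 0)) \<le> 1 * cmod (z - 0)"
  proof (rule field_differentiable_bound[where S="{z. 0 \<le> Re z}" and f="\<lambda>z. exp (- z)" and f'="\<lambda>z. - exp (- z)"])
    show "convex {z. 0 \<le> Re z}" by (rule convex_halfspace_Re_ge)
  qed (use assms in \<open>auto intro!: derivative_eq_intros\<close>)
  then show ?thesis by (simp add: norm_minus_commute)
qed

text \<open>The values on the negative half line are the conjugates of those on the positive one, where
\<open>t = exp s\<close> is substituted.\<close>

lemma integral_hermitian_log_coordinates:
  fixes H :: "real \<Rightarrow> complex"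
  assumes int: "integrable lborel H" and herm: "\<And>t. 0 < t \<Longrightarrow> H (- t) = cnj (H t)"
    and cont: "\<And>t. 0 < t \<Longrightarrow> isCont H t"
    and int': "integrable lborel (\<lambda>s. of_real (exp s) * H (exp s))"
  shows "integral\<^sup>L lborel H = of_real (2 * Re (CLBINT s. of_real (exp s) * H (exp s)))"
proof -
  have [measurable]: "H \<in> borel_measurable borel" using int by auto
  have pos: "integrable lborel (\<lambda>t. indicator {0<..} t *\<^sub>R H t)"
    using int by (intro integrable_mult_indicator) auto
  have neg: "integrable lborel (\<lambda>t. indicator {..<0} t *\<^sub>R H t)"
    using int by (intro integrable_mult_indicator) auto
  have "integral\<^sup>L lborel H = (CLBINT t. indicator {0<..} t *\<^sub>R H t + indicator {..<0} t *\<^sub>R H t)"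
    using AE_lborel_singleton[of 0]
    by (intro integral_cong_AE) (auto elim!: eventually_mono simp: indicator_def)
  also have "\<dots> = (CLBINT t. indicator {0<..} t *\<^sub>R H t) + (CLBINT t. indicator {..<0} t *\<^sub>R H t)"
    by (rule Bochner_Integration.integral_add[OF pos neg])
  also have "(CLBINT t. indicator {..<0} t *\<^sub>R H t) = (CLBINT t. indicator {..<0} (- t) *\<^sub>R H (- t))"
    using lborel_integral_real_affine[of "-1" "\<lambda>t. indicator {..<0} t *\<^sub>R H t" 0] by simp
  also have "\<dots> = (CLBINT t. cnj (indicator {0<..} t *\<^sub>R H t))"
    by (intro Bochner_Integration.integral_cong refl) (auto simp: indicator_def herm)
  also have "\<dots> = cnj (CLBINT t. indicator {0<..} t *\<^sub>R H t)"
    using pos by (intro Bochner_Integration.integral_bounded_linear bounded_linear_cnj)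
  also have "(CLBINT t. indicator {0<..} t *\<^sub>R H t) + cnj (CLBINT t. indicator {0<..} t *\<^sub>R H t) =
     of_real (2 * Re (CLBINT t. indicator {0<..} t *\<^sub>R H t))"
    by (rule complex_add_cnj)
  also have "(CLBINT t. indicator {0<..} t *\<^sub>R H t) = (CLBINT s. of_real (exp s) * H (exp s))"
  proof -
    have "(LBINT x=0..\<infinity>. H x) = (LBINT s=-\<infinity>..\<infinity>. exp s *\<^sub>R H (exp s))"
    proof (rule interval_integral_substitution_integrable)
      show "set_integrable lborel (einterval (-\<infinity>) \<infinity>) (\<lambda>x. exp x *\<^sub>R H (exp x))"
        using int' by (simp add: set_integrable_def scaleR_conv_of_real)
      show "set_integrable lborel (einterval 0 \<infinity>) H"
        using pos by (simp add: set_integrable_def zero_ereal_def)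
      have "((\<lambda>x. ereal (exp x)) \<longlongrightarrow> ereal 0) at_bot"
        by (intro tendsto_intros exp_at_bot)
      then show "((ereal \<circ> exp \<circ> real_of_ereal) \<longlongrightarrow> 0) (at_right (- \<infinity>))"
        unfolding ereal_tendsto_simps by (simp add: zero_ereal_def comp_def)
      have "((\<lambda>x. ereal (exp x)) \<longlongrightarrow> \<infinity>) at_top"
        using exp_at_top by (simp add: tendsto_PInfty_eq_at_top)
      then show "((ereal \<circ> exp \<circ> real_of_ereal) \<longlongrightarrow> \<infinity>) (at_left \<infinity>)"
        using exp_at_top unfolding ereal_tendsto_simps by (simp add: comp_def)
    qed (auto intro: cont)
    then show ?thesis
      by (simp add: interval_lebesgue_integral_def set_lebesgue_integral_def zero_ereal_def scaleR_conv_of_real)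
  qed
  finally show ?thesis .
qed

text \<open>Estimates uniform in the step size \<open>h\<close>: the quotient \<open>(1 - exp (- h w)) / h\<close> replaces \<open>w\<close> in the
discretised exponent and is comparable to it, because \<open>w\<close> has real part at least \<open>1\<close>.\<close>

lemma one_minus_exp_bounds:
  assumes \<gamma>: "\<bar>\<alpha> * (1 - 2 * \<rho>)\<bar> \<le> 1" and h: "0 < h" "h \<le> 1"
  defines "z t \<equiv> exp (- (of_real h * (1 + stable_exponent \<alpha> \<rho> t)))"
  shows "cmod (z t) \<le> exp (- h)"
    and "0 < Re (1 - z t)"
    and "1 / 2 \<le> cmod ((1 - z t) / h)"
    and "cmod ((1 - z t) / h) \<le> cmod (1 + stable_exponent \<alpha> \<rho> t)"
    and "cmod ((1 - z t) / h) \<le> 2 / h"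
proof -
  have R: "0 \<le> Re (stable_exponent \<alpha> \<rho> t)" by (rule Re_stable_exponent_nonneg) fact
  have "0 \<le> h * Re (stable_exponent \<alpha> \<rho> t)" using R h by simp
  then show 1: "cmod (z t) \<le> exp (- h)"
    unfolding z_def by (simp add: algebra_simps)
  have "exp (- h) < 1" using h by simp
  then show "0 < Re (1 - z t)" using 1 complex_Re_le_cmod[of "z t"]
    unfolding minus_complex.simps one_complex.simps by linarith
  have "1 - exp (- h) \<ge> h / 2"
  proof -
    have "exp (- h) \<le> 1 / (1 + h)"
      using exp_ge_add_one_self[of h] h by (simp add: exp_minus field_simps)
    moreover have "1 - 1 / (1 + h) \<ge> h / 2" using h by (simp add: field_simps)
    ultimately show ?thesis by linarith
  qed
  also have "1 - exp (- h) \<le> cmod (1 - z t)"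
    using 1 norm_triangle_ineq2[of 1 "z t"] by simp
  finally show "1 / 2 \<le> cmod ((1 - z t) / h)"
    using h by (simp add: norm_divide field_simps)
  have "cmod (1 - z t) \<le> cmod (of_real h * (1 + stable_exponent \<alpha> \<rho> t))"
    unfolding z_def using R h by (intro cmod_one_minus_exp_le) auto
  then have "cmod (1 - z t) \<le> h * cmod (1 + stable_exponent \<alpha> \<rho> t)"
    unfolding norm_mult using h by simp
  then show "cmod ((1 - z t) / h) \<le> cmod (1 + stable_exponent \<alpha> \<rho> t)"
    using h by (simp add: norm_divide norm_mult field_simps)
  have "cmod (1 - z t) \<le> 1 + 1"
    using 1 \<open>exp (- h) < 1\<close> norm_triangle_ineq4[of 1 "z t"] unfolding norm_one by linarith
  then show "cmod ((1 - z t) / h) \<le> 2 / h"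
    using h by (simp add: norm_divide divide_right_mono)
qed

text \<open>By \<open>expectation_pos_part_char\<close> each summand is an integral over the characteristic function, and
summing \<open>z ^ k / k\<close> under the integral gives \<open>- Ln (1 - z)\<close>.\<close>

lemma spitzer_exponent_fourier:
  fixes a b h :: real
  assumes ab: "0 < a" "a < b" and \<gamma>: "\<bar>\<alpha> * (1 - 2 * \<rho>)\<bar> \<le> 1" and h: "0 < h" "h \<le> 1"
    and w: "\<And>k. real_distribution (w k)"
    and char_w: "\<And>k t. char (w k) t = exp (- (real k * h * stable_exponent \<alpha> \<rho> t))"
  shows "of_real (\<Sum>k. (\<integral>x. exp (- a * max 0 x) - exp (- b * max 0 x) \<partial>w k) / real k * exp (- h) ^ k) =
    - (1 / (2 * pi)) * (CLBINT t. Ln (1 - exp (- (of_real h * (1 + stable_exponent \<alpha> \<rho> t)))) *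
        (1 / (a + \<i> * t) - 1 / (b + \<i> * t)))"
    and "summable (\<lambda>k. (\<integral>x. exp (- a * max 0 x) - exp (- b * max 0 x) \<partial>w k) / real k * exp (- h) ^ k)"
proof -
  define z where "z t = exp (- (of_real h * (1 + stable_exponent \<alpha> \<rho> t)))" for t
  define g where "g t = 1 / (a + \<i> * t) - 1 / (b + \<i> * t)" for t :: real
  define f where "f k t = z t ^ k / of_nat k * g t" for k t
  have [measurable]: "z \<in> borel_measurable borel" "g \<in> borel_measurable borel"
    unfolding z_def g_def by measurable
  have g: "integrable lborel g" unfolding g_def using ab by (intro integrable_resolvent_diff) auto
  have z1: "cmod (z t) \<le> exp (- h)" for t unfolding z_def by (rule one_minus_exp_bounds) fact+
  have e1: "exp (- h) < 1" using h by simp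
  have f_le: "cmod (f k t) \<le> exp (- h) ^ k * cmod (g t)" for k t
  proof -
    have "cmod (z t ^ k / of_nat k) \<le> exp (- h) ^ k"
    proof (cases "k = 0")
      case False
      then have "cmod (z t) ^ k / real k \<le> cmod (z t) ^ k / 1"
        by (intro divide_left_mono) auto
      then show ?thesis using power_mono[OF z1[of t], of k] by (simp add: norm_divide norm_power)
    qed simp
    then show ?thesis unfolding f_def norm_mult by (rule mult_right_mono) simp
  qed
  have geo: "summable (\<lambda>k. exp (- h) ^ k * c)" for c :: real
    using e1 by (intro summable_mult2 summable_geometric) simp
  have f_int: "integrable lborel (f k)" for k
  proof (rule Bochner_Integration.integrable_bound[of _ "\<lambda>t. exp (- h) ^ k * cmod (g t)"])
    show "integrable lborel (\<lambda>t. exp (- h) ^ k * cmod (g t))" using g by (intro integrable_mult_right integrable_norm)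
    show "f k \<in> borel_measurable lborel" unfolding f_def by measurable
    show "AE t in lborel. cmod (f k t) \<le> norm (exp (- h) ^ k * cmod (g t))"
      using f_le by (intro AE_I2) (simp add: order_trans[OF _ abs_ge_self])
  qed
  have sums: "(\<lambda>k. integral\<^sup>L lborel (f k)) sums (CLBINT t. (\<Sum>k. f k t))"
  proof (rule sums_integral[OF f_int])
    show "AE t in lborel. summable (\<lambda>k. cmod (f k t))"
      using f_le by (intro AE_I2 summable_comparison_test'[OF geo]) auto
    show "summable (\<lambda>k. \<integral>t. cmod (f k t) \<partial>lborel)"
    proof (rule summable_comparison_test'[OF geo[of "\<integral>t. cmod (g t) \<partial>lborel"]])
      fix k :: nat
      have "(\<integral>t. cmod (f k t) \<partial>lborel) \<le> (\<integral>t. exp (- h) ^ k * cmod (g t) \<partial>lborel)"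
        using g f_int by (intro integral_mono f_le integrable_norm integrable_mult_right)
      then show "norm (\<integral>t. cmod (f k t) \<partial>lborel) \<le> exp (- h) ^ k * (\<integral>t. cmod (g t) \<partial>lborel)"
        by simp
    qed
  qed
  have "(\<Sum>k. f k t) = - Ln (1 - z t) * g t" for t
  proof -
    have "cmod (- z t) < 1" using le_less_trans[OF z1[of t] e1] by simp
    note log_series = sums_minus[OF Ln_series[OF this]]
    have "- ((- 1) ^ Suc k / of_nat k * (- z t) ^ k) = z t ^ k / of_nat k" for k
      by (cases "even k") auto
    with log_series have "(\<lambda>k. z t ^ k / of_nat k) sums - Ln (1 - z t)"
      by (simp only: add_uminus_conv_diff)
    from sums_mult2[OF this, of "g t"] show ?thesis
      unfolding f_def by (rule sums_unique[symmetric])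
  qed
  then have sums': "(\<lambda>k. integral\<^sup>L lborel (f k)) sums - (CLBINT t. Ln (1 - z t) * g t)"
    using sums by simp
  let ?c = "\<lambda>k. (\<integral>x. exp (- a * max 0 x) - exp (- b * max 0 x) \<partial>w k) / real k * exp (- h) ^ k"
  have c_eq: "complex_of_real (?c k) = 1 / (2 * pi) * integral\<^sup>L lborel (f k)" for k
  proof -
    have f_k: "f k t = of_real (exp (- h) ^ k / real k) * (char (w k) t * g t)" for t
    proof -
      have "z t ^ k = exp (of_nat k * (- (of_real h * (1 + stable_exponent \<alpha> \<rho> t))))"
        unfolding z_def by (rule exp_of_nat_mult[symmetric])
      also have "of_nat k * (- (of_real h * (1 + stable_exponent \<alpha> \<rho> t))) =
         of_nat k * of_real (- h) + (- (real k * h * stable_exponent \<alpha> \<rho> t))"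
        by (simp add: algebra_simps)
      also have "exp \<dots> = of_real (exp (- h) ^ k) * char (w k) t"
        unfolding char_w exp_add exp_of_nat_mult exp_of_real by simp
      finally show ?thesis unfolding f_def by simp
    qed
    have "1 / (2 * pi) * integral\<^sup>L lborel (f k) =
       of_real (exp (- h) ^ k / real k) * (1 / (2 * pi) * (CLBINT t. char (w k) t * g t))"
      unfolding f_k integral_mult_right_zero by simp
    also have "1 / (2 * pi) * (CLBINT t. char (w k) t * g t) =
       of_real (\<integral>x. exp (- a * max 0 x) - exp (- b * max 0 x) \<partial>w k)"
      unfolding g_def by (rule expectation_pos_part_char[OF w ab, symmetric])
    finally show ?thesis by (simp add: mult.commute)
  qed
  have "(\<lambda>k. complex_of_real (?c k)) sums (1 / (2 * pi) * - (CLBINT t. Ln (1 - z t) * g t))"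
    unfolding c_eq by (rule sums_mult[OF sums'])
  then have S: "summable (\<lambda>k. complex_of_real (?c k))"
      "(\<Sum>k. complex_of_real (?c k)) = 1 / (2 * pi) * - (CLBINT t. Ln (1 - z t) * g t)"
    by (auto simp: sums_iff)
  show sum: "summable ?c" using S(1) by (rule summable_of_real_iff[THEN iffD1])
  show "of_real (\<Sum>k. ?c k) = - (1 / (2 * pi)) * (CLBINT t. Ln (1 - exp (- (of_real h * (1 + stable_exponent \<alpha> \<rho> t)))) *
        (1 / (a + \<i> * t) - 1 / (b + \<i> * t)))"
    unfolding suminf_of_real[OF sum] S(2) z_def g_def by simp
qed


lemma wh_kernel_real_line:
  "wh_kernel \<alpha> \<rho> a b (Complex s 0) = of_real (exp s) *
     (Ln (1 + stable_exponent \<alpha> \<rho> (exp s)) * (1 / (a + \<i> * of_real (exp s)) - 1 / (b + \<i> * of_real (exp s))))"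
proof -
  have e: "exp (Complex s 0) = of_real (exp s)"
    by (simp add: exp_eq_polar)
  have "exp (\<i> * (pi * \<alpha> * (1/2 - \<rho>)) + \<alpha> * Complex s 0) = stable_exponent \<alpha> \<rho> (exp s)"
    using exp_rotate[of "pi * \<alpha> * (1/2 - \<rho>)" \<alpha> s 0]
    unfolding stable_exponent_eq(1)[OF exp_gt_zero] by (simp add: powr_def mult.commute)
  then show ?thesis unfolding wh_kernel_def e by (simp add: mult.assoc)
qed

text \<open>As \<open>h\<close> tends to zero the logarithm in \<open>spitzer_exponent_fourier\<close> diverges like \<open>ln h\<close>. This constant
can be subtracted at no cost, since the difference of the resolvents integrates to zero.\<close>

theorem spitzer_exponent_limit:
  fixes a b :: real and h :: "nat \<Rightarrow> real"
  assumes ab: "0 < a" "a < b" and \<alpha>: "0 < \<alpha>" and \<gamma>: "\<bar>\<alpha> * (1 - 2 * \<rho>)\<bar> \<le> 1"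
    and h: "\<And>n. 0 < h n" "\<And>n. h n \<le> 1" and h0: "h \<longlonglongrightarrow> 0"
    and w: "\<And>n k. real_distribution (w n k)"
    and char_w: "\<And>n k t. char (w n k) t = exp (- (real k * h n * stable_exponent \<alpha> \<rho> t))"
  shows "(\<lambda>n. \<Sum>k. (\<integral>x. exp (- a * max 0 x) - exp (- b * max 0 x) \<partial>w n k) / real k * exp (- h n) ^ k)
    \<longlonglongrightarrow> - (1 / pi) * Re (wh_integral \<alpha> \<rho> a b)"
proof -
  define z where "z n t = exp (- (of_real (h n) * (1 + stable_exponent \<alpha> \<rho> t)))" for n t
  define g where "g t = 1 / (a + \<i> * t) - 1 / (b + \<i> * t)" for t :: real
  define L where "L n t = Ln ((1 - z n t) / h n)" for n t
  have b: "0 < b" using ab by simp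
  have [measurable]: "z n \<in> borel_measurable borel" "g \<in> borel_measurable borel" for n
    unfolding z_def g_def by measurable
  have [measurable]: "L n \<in> borel_measurable borel" for n
    unfolding L_def by measurable
  note z = one_minus_exp_bounds[OF \<gamma> h, folded z_def]
  have g_int: "integrable lborel g" unfolding g_def using ab b by (intro integrable_resolvent_diff)
  have g0: "(CLBINT t. g t) = 0"
    using resolvent_diff_inversion[OF ab, of 0] unfolding g_def by simp
  \<comment> \<open>On the real line the angle of \<open>i t\<close> is \<open>pi / 2\<close>, and \<open>1 / 2\<close> is the lower bound of
    \<open>one_minus_exp_bounds\<close>.\<close>
  obtain K where K: "\<And>x \<theta> z. \<bar>pi / 2 + \<theta>\<bar> \<le> pi / 2 \<Longrightarrow> 1 / 2 \<le> cmod z \<Longrightarrow> cmod z \<le> 1 + exp (\<alpha> * x) \<Longrightarrow>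
     cmod (exp (Complex x \<theta>) * Ln z *
       (1 / (a + \<i> * exp (Complex x \<theta>)) - 1 / (b + \<i> * exp (Complex x \<theta>)))) \<le> K * envelope x"
  proof -
    have "0 < (1 / 2 :: real)" "(1 / 2 :: real) \<le> 1" "pi / 2 < pi" by simp_all
    from resolvent_envelope[OF ab(1) b \<alpha> this] show thesis using that by blast
  qed
  have bound: "cmod (of_real (exp s) * (L n (exp s) * g (exp s))) \<le> K * envelope s" for n s
  proof -
    have "cmod ((1 - z n (exp s)) / h n) \<le> cmod (1 + stable_exponent \<alpha> \<rho> (exp s))" by (rule z)
    also have "\<dots> \<le> 1 + cmod (stable_exponent \<alpha> \<rho> (exp s))"
      using norm_triangle_ineq[of 1 "stable_exponent \<alpha> \<rho> (exp s)"] by simp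
    also have "cmod (stable_exponent \<alpha> \<rho> (exp s)) = exp (\<alpha> * s)"
      by (simp add: norm_stable_exponent powr_def)
    finally have "cmod ((1 - z n (exp s)) / h n) \<le> 1 + exp (\<alpha> * s)" .
    from K[of 0, OF _ z(3) this]
    have "cmod (exp (Complex s 0) * L n (exp s) * (1 / (a + \<i> * exp (Complex s 0)) - 1 / (b + \<i> * exp (Complex s 0)))) \<le> K * envelope s"
      unfolding L_def by simp
    moreover have "exp (Complex s 0) = of_real (exp s)"
      by (simp add: exp_eq_polar)
    ultimately show ?thesis unfolding g_def by (simp only: mult.assoc)
  qed
  have log_int: "integrable lborel (\<lambda>s. K * envelope s)"
    by (intro integrable_mult_right integrable_envelope)
  have Lg_int: "integrable lborel (\<lambda>t. L n t * g t)" for n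
  proof (rule Bochner_Integration.integrable_bound)
    let ?B = "ln (1 + 2 / h n) - ln (1 / 2) + pi"
    show "integrable lborel (\<lambda>t. ?B * cmod (g t))" using g_int by (intro integrable_mult_right integrable_norm)
    show "AE t in lborel. cmod (L n t * g t) \<le> norm (?B * cmod (g t))"
    proof (rule AE_I2)
      fix t
      have "cmod ((1 - z n t) / h n) \<le> 1 + 2 / h n" using z(5)[where n1=n and t=t] by linarith
      then have "cmod (L n t) \<le> ?B"
        unfolding L_def using h(1)[of n] by (intro cmod_Ln_le z(3)) auto
      then have "cmod (L n t * g t) \<le> ?B * cmod (g t)"
        unfolding norm_mult by (rule mult_right_mono) simp
      then show "cmod (L n t * g t) \<le> norm (?B * cmod (g t))" by simp
    qed
  qed measurable
  have exponent: "(\<Sum>k. (\<integral>x. exp (- a * max 0 x) - exp (- b * max 0 x) \<partial>w n k) / real k * exp (- h n) ^ k) =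
     - (1 / pi) * Re (CLBINT s. of_real (exp s) * (L n (exp s) * g (exp s)))" (is "?S = _") for n
  proof -
    have "Ln (1 - z n t) * g t = L n t * g t + ln (h n) * g t" for t
    proof -
      have "1 - z n t \<noteq> 0" using z(2)[where n1=n and t=t] by auto
      from Ln_divide_of_real[OF h(1) this, of n]
      have "Ln (1 - z n t) = L n t + ln (h n)" unfolding L_def by simp
      then show ?thesis by (simp only: distrib_right)
    qed
    then have "(CLBINT t. Ln (1 - z n t) * g t) = (CLBINT t. L n t * g t + ln (h n) * g t)"
      by (simp only:)
    also have "\<dots> = (CLBINT t. L n t * g t) + (CLBINT t. ln (h n) * g t)"
      by (rule Bochner_Integration.integral_add[OF Lg_int integrable_mult_right[OF g_int]])
    also have "(CLBINT t. ln (h n) * g t) = ln (h n) * (CLBINT t. g t)"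
      by (rule integral_mult_right_zero)
    also have "(CLBINT t. L n t * g t) + ln (h n) * (CLBINT t. g t) = (CLBINT t. L n t * g t)" by (simp only: g0 mult_zero_right add_0_right)
    also have "\<dots> = of_real (2 * Re (CLBINT s. of_real (exp s) * (L n (exp s) * g (exp s))))"
    proof (rule integral_hermitian_log_coordinates[OF Lg_int])
      fix t :: real assume t: "0 < t"
      have "L n (- t) = cnj (L n t)"
      proof -
        have "(1 - z n (- t)) / h n = cnj ((1 - z n t) / h n)"
          unfolding z_def stable_exponent_eq(2)[OF t] by (simp add: exp_cnj)
        moreover have "0 < Re ((1 - z n t) / h n)"
          using z(2)[where n1=n and t=t] h(1)[of n] by (simp add: Re_divide_of_real)
        ultimately show ?thesis unfolding L_def by (subst cnj_Ln) (auto simp: complex_nonpos_Reals_iff)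
      qed
      moreover have "g (- t) = cnj (g t)" by (simp add: g_def)
      ultimately show "L n (- t) * g (- t) = cnj (L n t * g t)" by simp
      have "isCont (stable_exponent \<alpha> \<rho>) t"
      proof -
        have "isCont (\<lambda>t. cis (pi * \<alpha> * (1/2 - \<rho>)) * of_real (t powr \<alpha>)) t"
          using t by (intro continuous_intros) auto
        moreover have "\<forall>\<^sub>F t in nhds t. stable_exponent \<alpha> \<rho> t = cis (pi * \<alpha> * (1/2 - \<rho>)) * of_real (t powr \<alpha>)"
          using eventually_nhds_in_open[of "{0<..}" t] t
          by (auto elim!: eventually_mono simp: stable_exponent_eq)
        ultimately show ?thesis by (simp add: isCont_cong)
      qed
      then have "isCont (\<lambda>t. (1 - z n t) / h n) t"
        unfolding z_def using h(1)[of n] by (intro continuous_intros) auto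
      moreover have "0 < Re ((1 - z n t) / h n)"
        using z(2)[where n1=n and t=t] h(1)[of n] by (simp add: Re_divide_of_real)
      ultimately have cL: "isCont (L n) t"
        unfolding L_def by (intro isCont_Ln') (auto simp: complex_nonpos_Reals_iff)
      have "d + \<i> * t \<noteq> 0" if "0 < d" for d :: real
        using that by (auto simp: complex_eq_iff)
      then have "isCont g t" unfolding g_def using ab(1) b by (intro continuous_intros) auto
      with cL show "isCont (\<lambda>t. L n t * g t) t" by (rule isCont_mult)
    next
      show "integrable lborel (\<lambda>s. of_real (exp s) * (L n (exp s) * g (exp s)))"
      proof (rule Bochner_Integration.integrable_bound[OF log_int])
        show "AE s in lborel. cmod (of_real (exp s) * (L n (exp s) * g (exp s))) \<le> norm (K * envelope s)"
          using bound by (intro AE_I2) (auto intro: order_trans[OF _ abs_ge_self])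
      qed measurable
    qed
    finally have eq: "(CLBINT t. Ln (1 - z n t) * g t) = of_real (2 * Re (CLBINT s. of_real (exp s) * (L n (exp s) * g (exp s))))" .
    have "complex_of_real ?S = - (1 / (2 * pi)) * (CLBINT t. Ln (1 - z n t) * g t)"
      unfolding z_def g_def
      by (rule spitzer_exponent_fourier(1)[OF ab \<gamma> h w char_w])
    also have "\<dots> = of_real (- (1 / pi) * Re (CLBINT s. of_real (exp s) * (L n (exp s) * g (exp s))))"
      unfolding eq by simp
    finally show ?thesis unfolding of_real_eq_iff .
  qed
  have "(\<lambda>n. CLBINT s. of_real (exp s) * (L n (exp s) * g (exp s))) \<longlonglongrightarrow> (wh_integral \<alpha> \<rho> a b)"
  proof (rule integral_dominated_convergence[OF _ _ log_int])
    show "AE s in lborel. (\<lambda>n. of_real (exp s) * (L n (exp s) * g (exp s))) \<longlonglongrightarrow> wh_kernel \<alpha> \<rho> a b (Complex s 0)"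
    proof (rule AE_I2)
      fix s :: real
      define v where "v = 1 + stable_exponent \<alpha> \<rho> (exp s)"
      have "0 < Re v" unfolding v_def using Re_stable_exponent_nonneg[OF \<gamma>, of "exp s"] by simp
      then have v: "v \<notin> \<real>\<^sub>\<le>\<^sub>0" by (auto simp: complex_nonpos_Reals_iff)
      have "((\<lambda>u. - exp (- (u * v))) has_field_derivative v) (at 0)"
        by (auto intro!: derivative_eq_intros)
      then have "((\<lambda>u. (- exp (- (u * v)) - (- exp (- (0 * v)))) / (u - 0)) \<longlongrightarrow> v) (at 0)"
        by (simp only: has_field_derivative_iff)
      then have "((\<lambda>u. (1 - exp (- (u * v))) / u) \<longlongrightarrow> v) (at 0)" by simp
      moreover have "filterlim (\<lambda>n. complex_of_real (h n)) (at 0) sequentially"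
        unfolding filterlim_at using h0 h(1) tendsto_of_real[OF h0, where 'a=complex]
        by (auto intro!: always_eventually simp: less_imp_neq[THEN not_sym])
      ultimately have "(\<lambda>n. (1 - exp (- (of_real (h n) * v))) / of_real (h n)) \<longlonglongrightarrow> v"
        by (rule filterlim_compose)
      then have "(\<lambda>n. L n (exp s)) \<longlonglongrightarrow> Ln v"
        unfolding L_def z_def v_def[symmetric] using v by (intro tendsto_Ln)
      then have "(\<lambda>n. of_real (exp s) * (L n (exp s) * g (exp s))) \<longlonglongrightarrow> of_real (exp s) * (Ln v * g (exp s))"
        by (intro tendsto_mult tendsto_const)
      then show "(\<lambda>n. of_real (exp s) * (L n (exp s) * g (exp s))) \<longlonglongrightarrow> wh_kernel \<alpha> \<rho> a b (Complex s 0)"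
        unfolding wh_kernel_real_line v_def g_def .
    qed
    show "(\<lambda>s. wh_kernel \<alpha> \<rho> a b (Complex s 0)) \<in> borel_measurable lborel"
      unfolding wh_kernel_def Complex_eq by measurable
  qed (use bound in auto)
  then have "(\<lambda>n. - (1 / pi) * Re (CLBINT s. of_real (exp s) * (L n (exp s) * g (exp s))))
     \<longlonglongrightarrow> - (1 / pi) * Re (wh_integral \<alpha> \<rho> a b)"
    by (intro tendsto_mult tendsto_const tendsto_Re)
  then show ?thesis unfolding exponent .
qed

section \<open>Suprema of cadlag paths as limits of grid maxima\<close>

text \<open>The one-sided limits bound a cadlag function on a neighbourhood of each time, and finitely many of
these neighbourhoods cover the interval.\<close>

lemma cadlag_bounded_above:
  assumes "cadlag f"
  obtains B where "\<And>u. u \<in> {0..1} \<Longrightarrow> f u \<le> B"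
proof -
  have local: "\<exists>d>0. \<exists>B. \<forall>u. 0 \<le> u \<and> \<bar>u - t\<bar> < d \<longrightarrow> f u \<le> B" if t: "0 \<le> t" for t
  proof -
    have "(f \<longlongrightarrow> f t) (at_right t)"
      using assms t unfolding cadlag_def continuous_within by auto
    then have "\<forall>\<^sub>F u in at_right t. f u < f t + 1"
      by (rule order_tendstoD) simp
    then obtain d1 where d1: "d1 > t" "\<And>u. t < u \<Longrightarrow> u < d1 \<Longrightarrow> f u < f t + 1"
      unfolding eventually_at_right_field by blast
    obtain d2 B2 where d2: "d2 < t" "\<And>u. 0 \<le> u \<Longrightarrow> d2 < u \<Longrightarrow> u < t \<Longrightarrow> f u < B2"
    proof (cases "t = 0")
      case True
      then show ?thesis by (intro that[of "-1" 0]) auto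
    next
      case False
      then obtain l where "(f \<longlongrightarrow> l) (at_left t)"
        using assms t unfolding cadlag_def by (metis less_eq_real_def)
      then have "\<forall>\<^sub>F u in at_left t. f u < l + 1"
        by (rule order_tendstoD) simp
      then obtain d2 where "d2 < t" "\<And>u. d2 < u \<Longrightarrow> u < t \<Longrightarrow> f u < l + 1"
        unfolding eventually_at_left_field by blast
      then show ?thesis by (intro that[of d2 "l + 1"]) auto
    qed
    show ?thesis
    proof (intro exI conjI allI impI)
      show "0 < min (d1 - t) (t - d2)" using d1 d2 by simp
      fix u assume u: "0 \<le> u \<and> \<bar>u - t\<bar> < min (d1 - t) (t - d2)"
      consider "t < u" | "u = t" | "u < t" by linarith
      then show "f u \<le> max (f t + 1) B2"
      proof cases
        case 1
        then show ?thesis using d1(2)[of u] u by auto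
      next
        case 3
        then show ?thesis using d2(2)[of u] u by auto
      qed auto
    qed
  qed
  then obtain d B where dB: "\<And>t. 0 \<le> t \<Longrightarrow> 0 < d t" "\<And>t u. 0 \<le> t \<Longrightarrow> 0 \<le> u \<Longrightarrow> \<bar>u - t\<bar> < d t \<Longrightarrow> f u \<le> B t"
    by metis
  have "{0..1::real} \<subseteq> (\<Union>t\<in>{0..1}. ball t (d t))"
    using dB(1) by force
  then obtain T where T: "T \<subseteq> {0..1}" "finite T" "{0..1::real} \<subseteq> (\<Union>t\<in>T. ball t (d t))"
    by (rule compactE_image[OF compact_Icc, rotated 1]) auto
  show thesis
  proof (rule that[of "Max (B ` T)"])
    fix u :: real assume u: "u \<in> {0..1}"
    then obtain t where t: "t \<in> T" "u \<in> ball t (d t)" using T(3) by blast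
    have "f u \<le> B t" using dB(2)[of t u] t T(1) u by (auto simp: dist_real_def abs_minus_commute)
    also have "\<dots> \<le> Max (B ` T)" using T t by (intro Max_ge) auto
    finally show "f u \<le> Max (B ` T)" .
  qed
qed

text \<open>If \<open>f u\<close> nearly attains the supremum, right continuity keeps \<open>f\<close> nearly as large on an interval
\<open>[u, d)\<close>, which contains a grid point once the mesh is below \<open>d - u\<close>. For \<open>u = 1\<close> the grid point
is \<open>1\<close> itself.\<close>

lemma grid_max_tendsto_Sup:
  assumes "cadlag f"
  shows "(\<lambda>n. Max ((\<lambda>k. f (real k / real n)) ` {..n})) \<longlonglongrightarrow> (SUP u\<in>{0..1}. f u)"
proof (rule LIMSEQ_I)
  define S where "S = (SUP u\<in>{0..1}. f u)"
  obtain B where B: "\<And>u. u \<in> {0..1} \<Longrightarrow> f u \<le> B" using cadlag_bounded_above[OF assms] by blast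
  have bdd: "bdd_above (f ` {0..1})" using B by (intro bdd_aboveI2) auto
  have upper: "Max ((\<lambda>k. f (real k / real n)) ` {..n}) \<le> S" for n
  proof (subst Max_le_iff)
    show "\<forall>a\<in>(\<lambda>k. f (real k / real n)) ` {..n}. a \<le> S"
      unfolding S_def by (auto intro!: cSUP_upper bdd simp: divide_le_eq)
  qed auto
  fix e :: real assume e: "0 < e"
  obtain u where u: "u \<in> {0..1}" "S - e < f u"
    using less_cSUP_iff[OF _ bdd, of "S - e"] e unfolding S_def by auto
  obtain d where d: "u < d" "\<And>v. u \<le> v \<Longrightarrow> v < d \<Longrightarrow> S - e < f v"
  proof -
    have "(f \<longlongrightarrow> f u) (at_right u)"
      using assms u(1) unfolding cadlag_def continuous_within by auto
    from order_tendstoD(1)[OF this u(2)] obtain d where "u < d" "\<And>v. u < v \<Longrightarrow> v < d \<Longrightarrow> S - e < f v"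
      unfolding eventually_at_right_field by blast
    then show thesis using u(2) by (intro that[of d]) (auto simp: le_less)
  qed
  obtain N :: nat where N: "1 / (d - u) < real N" using reals_Archimedean2 by blast
  have Npos: "0 < N" using N d(1) by (cases "N = 0") (auto simp: field_simps)
  show "\<exists>N. \<forall>n\<ge>N. norm (Max ((\<lambda>k. f (real k / real n)) ` {..n}) - (SUP u\<in>{0..1}. f u)) < e"
  proof (intro exI allI impI)
    fix n assume n: "N \<le> n"
    then have n0: "0 < real n" using Npos by simp
    have dn: "1 / real n < d - u"
    proof -
      have "1 / (d - u) < real n" using N n by linarith
      then show ?thesis using d(1) n0 by (simp add: field_simps)
    qed
    define k where "k = nat \<lceil>u * real n\<rceil>"
    have k1: "u * real n \<le> real k" "real k < u * real n + 1"
    proof -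
      have "0 \<le> u * real n" using u(1) by simp
      then have "real k = of_int \<lceil>u * real n\<rceil>" by (simp add: k_def)
      then show "u * real n \<le> real k" "real k < u * real n + 1"
        using ceiling_correct[of "u * real n"] by linarith+
    qed
    have "u * real n \<le> 1 * real n" using u(1) n0 by (intro mult_right_mono) auto
    then have kn: "k \<le> n" unfolding k_def by (simp add: nat_le_iff ceiling_le_iff)
    have "u \<le> real k / real n" "real k / real n < d"
    proof -
      show "u \<le> real k / real n" using k1 n0 by (simp add: field_simps)
      have "real k / real n < (u * real n + 1) / real n" using k1 n0 by (intro divide_strict_right_mono)
      also have "\<dots> = u + 1 / real n" using n0 by (simp add: field_simps)
      finally show "real k / real n < d" using dn by linarith
    qed
    then have "S - e < f (real k / real n)" by (rule d(2))
    also have "\<dots> \<le> Max ((\<lambda>k. f (real k / real n)) ` {..n})"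
      using kn by (intro Max_ge) auto
    finally show "norm (Max ((\<lambda>k. f (real k / real n)) ` {..n}) - (SUP u\<in>{0..1}. f u)) < e"
      using upper[of n] unfolding S_def by simp
  qed
qed

section \<open>The supremum of a stable process at an independent exponential time\<close>

lemma integrable_exp_decay: "set_integrable lborel {0..} (\<lambda>t::real. exp (- t))"
  and integral_exp_decay: "(LBINT t:{0..}. exp (- t)) = (1::real)"
proof -
  have D: "prob_space (density lborel (exponential_density 1))" by (rule prob_space_exponential_density) simp
  have e: "exponential_density 1 t = indicator {0..} t * exp (- t)" for t :: real
    by (simp add: exponential_density_def indicator_def)
  have n: "(\<integral>\<^sup>+t. ennreal (indicator {0..} t * exp (- t)) \<partial>lborel) = 1"
  proof -
    have "emeasure (density lborel (exponential_density 1)) (space (density lborel (exponential_density 1))) =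
        (\<integral>\<^sup>+t. ennreal (exponential_density 1 t) \<partial>lborel)"
      by (simp add: emeasure_density)
    then show ?thesis using prob_space.emeasure_space_1[OF D] unfolding e by simp
  qed
  have "integrable lborel (\<lambda>t::real. indicator {0..} t * exp (- t))"
    using n by (intro integrableI_nonneg) auto
  then show "set_integrable lborel {0..} (\<lambda>t::real. exp (- t))" by (simp add: set_integrable_def)
  have "(LBINT t. indicator {0..} t * exp (- t)) = (1::real)"
    using n by (subst integral_eq_nn_integral) auto
  then show "(LBINT t:{0..}. exp (- t)) = (1::real)" by (simp add: set_lebesgue_integral_def)
qed

text \<open>The weights \<open>exp (- h) ^ n (1 - exp (- h))\<close> are the masses that the exponential law gives to the
intervals \<open>[n h, (n + 1) h)\<close>.\<close>

lemma geometric_sum_eq_step_integral: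
  fixes c :: "nat \<Rightarrow> real"
  assumes c: "\<And>n. \<bar>c n\<bar> \<le> 1" and h: "0 < h"
  shows "(LBINT t:{0..}. exp (- t) * c (nat \<lfloor>t / h\<rfloor>)) = (\<Sum>n. c n * exp (- h) ^ n) * (1 - exp (- h))"
proof -
  define I where "I n = {real n * h..<real (Suc n) * h}" for n
  let ?f = "\<lambda>t. exp (- t) * c (nat \<lfloor>t / h\<rfloor>)"
  have floor: "nat \<lfloor>t / h\<rfloor> = n \<longleftrightarrow> t \<in> I n" if "0 \<le> t" for t n
  proof -
    have "0 \<le> t / h" using that h by simp
    then have "nat \<lfloor>t / h\<rfloor> = n \<longleftrightarrow> \<lfloor>t / h\<rfloor> = int n" by (simp add: nat_eq_iff)
    also have "\<dots> \<longleftrightarrow> real n \<le> t / h \<and> t / h < real n + 1" by (simp add: floor_eq_iff)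
    also have "\<dots> \<longleftrightarrow> t \<in> I n" using h by (simp add: I_def field_simps)
    finally show ?thesis .
  qed
  have I0: "0 \<le> t" if "t \<in> I n" for t n
    using that h mult_nonneg_nonneg[of "real n" h] unfolding I_def by (simp del: of_nat_Suc mult_nonneg_nonneg)
  have un: "(\<Union>n. I n) = {0..}"
  proof (intro equalityI subsetI)
    fix t :: real assume "t \<in> {0..}"
    then have "t \<in> I (nat \<lfloor>t / h\<rfloor>)" using floor[THEN iffD1, OF _ refl] by simp
    then show "t \<in> (\<Union>n. I n)" by blast
  qed (use I0 in auto)
  have disj: "disjoint_family I"
    unfolding disjoint_family_on_def using floor I0 by (metis disjoint_iff)
  have f_int: "set_integrable lborel {0..} ?f"
  proof (rule set_integrable_bound[OF integrable_exp_decay])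
    show "set_borel_measurable lborel {0..} ?f"
      unfolding set_borel_measurable_def by measurable
    show "AE x in lborel. x \<in> {0..} \<longrightarrow> norm (?f x) \<le> norm (exp (- x))"
      using c by (intro AE_I2) (auto simp: abs_mult mult_left_le)
  qed
  have "(LBINT t:{0..}. ?f t) = (\<Sum>n. LBINT t:I n. ?f t)"
    unfolding un[symmetric]
    by (rule lebesgue_integral_countable_add) (use disj f_int un in \<open>auto simp: I_def disjoint_family_on_def\<close>)
  also have "\<dots> = (\<Sum>n. c n * exp (- h) ^ n * (1 - exp (- h)))"
  proof (rule suminf_cong)
    fix n
    have "(LBINT t:I n. ?f t) = (LBINT t:I n. c n * exp (- t))"
    proof (rule set_lebesgue_integral_cong)
      have "?f t = c n * exp (- t)" if "t \<in> I n" for t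
        using floor[OF I0[OF that], of n] that by simp
      then show "\<forall>t. t \<in> I n \<longrightarrow> ?f t = c n * exp (- t)" by blast
    qed (simp add: I_def)
    also have "\<dots> = c n * (LBINT t:I n. exp (- t))"
      by (rule set_integral_mult_right)
    also have "(LBINT t:I n. exp (- t)) = (LBINT t:{real n * h..real (Suc n) * h}. exp (- t))"
      unfolding set_lebesgue_integral_def
      using AE_lborel_singleton[of "real (Suc n) * h"]
      by (intro integral_cong_AE) (auto elim!: eventually_mono simp: indicator_def I_def)
    also have "\<dots> = - exp (- (real (Suc n) * h)) - - exp (- (real n * h))"
      unfolding set_lebesgue_integral_def
      using h by (intro integral_FTC_atLeastAtMost[where F="\<lambda>x. - exp (- x)"])
        (auto intro!: derivative_eq_intros continuous_intros mult_right_mono simp: has_real_derivative_iff_has_vector_derivative[symmetric])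
    also have "\<dots> = exp (- h) ^ n * (1 - exp (- h))"
      by (simp add: exp_of_nat_mult[symmetric] algebra_simps exp_add[symmetric] exp_diff)
    finally show "(LBINT t:I n. ?f t) = c n * exp (- h) ^ n * (1 - exp (- h))" by simp
  qed
  also have "\<dots> = (\<Sum>n. c n * exp (- h) ^ n) * (1 - exp (- h))"
  proof (rule suminf_mult2[symmetric])
    show "summable (\<lambda>n. c n * exp (- h) ^ n)"
    proof (rule summable_comparison_test'[of "\<lambda>n. exp (- h) ^ n" 0])
      show "summable (\<lambda>n. exp (- h) ^ n)" using h by (intro summable_geometric) simp
      show "norm (c n * exp (- h) ^ n) \<le> exp (- h) ^ n" for n
        using c[of n] by (simp add: abs_mult mult_left_le_one_le)
    qed
  qed
  finally show ?thesis .
qed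

lemma stable_exponent_scale:
  assumes "0 < c"
  shows "stable_exponent \<alpha> \<rho> (c * t) = of_real (c powr \<alpha>) * stable_exponent \<alpha> \<rho> t"
proof -
  have "\<bar>c * t\<bar> powr \<alpha> = c powr \<alpha> * \<bar>t\<bar> powr \<alpha>"
    using assms by (simp add: abs_mult powr_mult)
  moreover have "0 < c * t \<longleftrightarrow> 0 < t" "c * t < 0 \<longleftrightarrow> t < 0"
    using assms by (auto simp: zero_less_mult_iff mult_less_0_iff)
  ultimately show ?thesis
    unfolding stable_exponent_def Let_def by simp
qed

context stable_process
begin

abbreviation sup_laplace :: "real \<Rightarrow> real" where
  "sup_laplace c \<equiv> expectation (\<lambda>\<omega>. exp (- (c * sup_process X 1 \<omega>)))"

text \<open>The maximum over the grid \<open>0, 1/n, ..., 1\<close>, normalised by the starting point so that it is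
nonnegative everywhere and not only almost surely.\<close>

definition grid_max :: "nat \<Rightarrow> 'a \<Rightarrow> real" where
  "grid_max n \<omega> = Max ((\<lambda>k. X (real k / real n) \<omega> - X 0 \<omega>) ` {..n})"

lemma alpha_pos: "0 < \<alpha>"
  using admissible_params by (auto simp: admissible_def)

lemma grid_max_nonneg: "0 \<le> grid_max n \<omega>"
  unfolding grid_max_def by (rule Max_ge) (auto intro!: image_eqI[where x=0])

lemma grid_max_measurable [measurable]: "grid_max n \<in> borel_measurable M"
proof -
  note measurable_X [measurable]
  show ?thesis unfolding grid_max_def[abs_def]
    by (intro borel_measurable_Max) (auto intro!: borel_measurable_diff measurable_X)
qed

lemma real_distribution_X: "0 \<le> t \<Longrightarrow> real_distribution (distr M borel (X t))"
  by (intro real_distribution_distr measurable_X)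

lemma distr_scaled_X:
  assumes "0 < h" "0 < n"
  shows "distr M borel (\<lambda>\<omega>. (h * real n) powr (1 / \<alpha>) * X (1 / real n) \<omega>) = distr M borel (X h)"
proof (rule Levy_uniqueness)
  let ?c = "(h * real n) powr (1 / \<alpha>)"
  have [measurable]: "random_variable borel (X (1 / real n))" by (rule measurable_X) simp
  have c: "0 < ?c" "?c powr \<alpha> = h * real n"
    using assms alpha_pos by (auto simp: powr_powr)
  show "real_distribution (distr M borel (\<lambda>\<omega>. ?c * X (1 / real n) \<omega>))"
    by (rule real_distribution_distr) simp
  show "real_distribution (distr M borel (X h))" using assms by (intro real_distribution_X) simp
  show "char (distr M borel (\<lambda>\<omega>. ?c * X (1 / real n) \<omega>)) = char (distr M borel (X h))"
  proof
    fix t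
    have "char (distr M borel (\<lambda>\<omega>. ?c * X (1 / real n) \<omega>)) t = char (distr M borel (X (1 / real n))) (?c * t)"
      unfolding char_def by (simp add: integral_distr mult_ac)
    also have "\<dots> = exp (- (complex_of_real (1 / real n) * (of_real (h * real n) * stable_exponent \<alpha> \<rho> t)))"
      by (subst char_X) (simp_all only: stable_exponent_scale[OF c(1)] c(2), simp)
    also have "\<dots> = char (distr M borel (X h)) t"
      using assms by (subst char_X) auto
    finally show "char (distr M borel (\<lambda>\<omega>. ?c * X (1 / real n) \<omega>)) t = char (distr M borel (X h)) t" .
  qed
qed

text \<open>Self-similarity at the level of the walk: \<open>n\<close> steps of length \<open>h\<close> have the same joint law as \<open>n\<close> steps
of length \<open>1/n\<close> scaled by the factor \<open>(h n) powr (1/\<alpha>)\<close>. On the fixed interval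
\<open>[0, 1]\<close> the grid maxima then converge almost surely.\<close>

lemma distr_scaled_grid_max:
  assumes h: "0 < h" and n: "0 < n"
  shows "distr M borel (\<lambda>\<omega>. (h * real n) powr (1 / \<alpha>) * grid_max n \<omega>) = max_law (distr M borel (X h)) n"
proof -
  let ?c = "(h * real n) powr (1 / \<alpha>)"
  let ?t = "\<lambda>i. real i / real n"
  have m [measurable]: "random_variable borel (X (real i / real n))" for i by (rule measurable_X) simp
  have "indep_vars (\<lambda>_. borel) (\<lambda>i \<omega>. X (?t (Suc i)) \<omega> - X (?t i) \<omega>) {..<n}"
    by (rule indep_increments) (auto simp: divide_right_mono)
  from indep_vars_compose2[OF this, of "\<lambda>_ x. ?c * x" "\<lambda>_. borel"]
  have ind: "indep_vars (\<lambda>_. borel) (\<lambda>i \<omega>. ?c * X (?t (Suc i)) \<omega> - ?c * X (?t i) \<omega>) {..<n}"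
    by (simp add: right_diff_distrib)
  have law: "distr M borel (\<lambda>\<omega>. ?c * X (?t (Suc i)) \<omega> - ?c * X (?t i) \<omega>) = distr M borel (X h)" for i
  proof -
    have t: "?t (Suc i) = ?t i + 1 / real n" by (simp add: add_divide_distrib)
    have [measurable]: "random_variable borel (X (1 / real n))" "random_variable borel (X (?t i + 1 / real n))"
      using m[of "Suc i"] by (auto simp: measurable_X t)
    have "distr M borel (\<lambda>\<omega>. ?c * X (?t (Suc i)) \<omega> - ?c * X (?t i) \<omega>) =
       distr (distr M borel (\<lambda>\<omega>. X (?t i + 1 / real n) \<omega> - X (?t i) \<omega>)) borel (\<lambda>x. ?c * x)"
      unfolding t by (subst distr_distr) (auto simp: comp_def right_diff_distrib)
    also have "\<dots> = distr (distr M borel (X (1 / real n))) borel (\<lambda>x. ?c * x)"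
      by (subst stationary_increments) auto
    also have "\<dots> = distr M borel (X h)"
      unfolding distr_scaled_X[OF h n, symmetric] by (subst distr_distr) (auto simp: comp_def)
    finally show ?thesis .
  qed
  have "?c * grid_max n \<omega> = Max ((\<lambda>k. ?c * X (?t k) \<omega> - ?c * X (?t 0) \<omega>) ` {..n})" for \<omega>
    unfolding grid_max_def
    by (subst mono_Max_commute[where f="\<lambda>v. ?c * v"])
      (auto simp: mono_def image_image right_diff_distrib mult_left_mono)
  then show ?thesis
    using distr_Max_partial_sums[OF ind law] by simp
qed

lemma integral_max_law:
  assumes "0 < h"
  shows "(\<integral>x. exp (- a * x) \<partial>max_law (distr M borel (X h)) n) =
    expectation (\<lambda>\<omega>. exp (- (a * (h * real n) powr (1 / \<alpha>) * grid_max n \<omega>)))"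
proof (cases "n = 0")
  case True
  then show ?thesis by (simp add: integral_return prob_space)
next
  case False
  then have n: "0 < n" by simp
  show ?thesis
    unfolding distr_scaled_grid_max[OF assms n, symmetric]
    by (subst integral_distr) (auto simp: mult_ac)
qed

lemma AE_cadlag_start: "AE \<omega> in M. cadlag (\<lambda>t. X t \<omega>) \<and> X 0 \<omega> = 0"
  using cadlag_paths start_zero by eventually_elim simp

lemma AE_grid_max_tendsto: "AE \<omega> in M. (\<lambda>n. grid_max n \<omega>) \<longlonglongrightarrow> sup_process X 1 \<omega>"
  using AE_cadlag_start
proof eventually_elim
  case (elim \<omega>)
  then show ?case
    using grid_max_tendsto_Sup[of "\<lambda>t. X t \<omega>"] by (simp add: grid_max_def[abs_def] sup_process_def)
qed

lemma AE_sup_nonneg: "AE \<omega> in M. 0 \<le> sup_process X 1 \<omega>"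
  using AE_grid_max_tendsto by eventually_elim (auto intro: LIMSEQ_le_const grid_max_nonneg)

lemma sup_laplace_limit:
  assumes [measurable]: "sup_process X 1 \<in> borel_measurable M"
    and "filterlim N sequentially sequentially" "c \<longlonglongrightarrow> l" "\<And>j. 0 \<le> c j"
  shows "(\<lambda>j. expectation (\<lambda>\<omega>. exp (- (c j * grid_max (N j) \<omega>)))) \<longlonglongrightarrow> sup_laplace l"
proof (rule integral_dominated_convergence[where w="\<lambda>_. 1"])
  show "AE \<omega> in M. (\<lambda>j. exp (- (c j * grid_max (N j) \<omega>))) \<longlonglongrightarrow> exp (- (l * sup_process X 1 \<omega>))"
    using AE_grid_max_tendsto
    by eventually_elim (intro tendsto_intros assms(3) filterlim_compose[OF _ assms(2)])
  show "AE \<omega> in M. norm (exp (- (c j * grid_max (N j) \<omega>))) \<le> 1" for j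
    using assms(4) grid_max_nonneg by (intro AE_I2) simp
qed auto

end

context stable_process
begin

text \<open>The Laplace transform of \<open>\<epsilon> powr (1/\<alpha>) S\<^sub>1\<close>, and hence of the supremum at the exponential time \<open>\<epsilon>\<close>.\<close>

definition sup_transform :: "real \<Rightarrow> real" where
  "sup_transform a = (LBINT t:{0..}. exp (- t) *
     sup_laplace (a * t powr (1 / \<alpha>)))"

text \<open>This bound makes the real part of the characteristic exponent nonnegative.\<close>

lemma skewness_bound: "\<bar>\<alpha> * (1 - 2 * \<rho>)\<bar> \<le> 1"
proof -
  consider "0 < \<alpha>" "\<alpha> < 1" "0 < \<rho>" "\<rho> < 1" | "\<alpha> = 1" "\<rho> = 1 / 2"
    | "1 < \<alpha>" "\<alpha> < 2" "1 - 1 / \<alpha> \<le> \<rho>" "\<rho> \<le> 1 / \<alpha>"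
    using admissible_params by (auto simp: admissible_def)
  then show ?thesis
  proof cases
    case 1
    then have "\<bar>\<alpha>\<bar> * \<bar>1 - 2 * \<rho>\<bar> \<le> 1 * 1" by (intro mult_mono) auto
    then show ?thesis by (simp add: abs_mult)
  next
    case 3
    have "\<alpha> * (1 - 1 / \<alpha>) \<le> \<alpha> * \<rho>" "\<alpha> * \<rho> \<le> \<alpha> * (1 / \<alpha>)"
      using 3 by (intro mult_left_mono; simp)+
    then have "\<alpha> - 1 \<le> \<alpha> * \<rho>" "\<alpha> * \<rho> \<le> 1" using 3 by (simp_all add: right_diff_distrib)
    moreover have "\<alpha> * (1 - 2 * \<rho>) = \<alpha> - 2 * (\<alpha> * \<rho>)" by (simp add: algebra_simps)
    ultimately show ?thesis using 3 by (simp add: abs_le_iff)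
  qed simp
qed

lemma exp_grid_bound: "0 \<le> c \<Longrightarrow> \<bar>expectation (\<lambda>\<omega>. exp (- (c * grid_max n \<omega>)))\<bar> \<le> 1"
proof -
  assume c: "0 \<le> c"
  have e: "exp (- (c * grid_max n \<omega>)) \<le> 1" for \<omega>
    using c grid_max_nonneg[of n \<omega>] by simp
  have "expectation (\<lambda>\<omega>. exp (- (c * grid_max n \<omega>))) \<le> expectation (\<lambda>_. 1)"
    using e by (intro integral_mono integrable_const_bound[where B=1]) auto
  moreover have "0 \<le> expectation (\<lambda>\<omega>. exp (- (c * grid_max n \<omega>)))" by (intro integral_nonneg_AE) auto
  ultimately show ?thesis by (simp add: prob_space)
qed

lemma exp_sup_bound:
  assumes [measurable]: "sup_process X 1 \<in> borel_measurable M" and c: "0 \<le> c"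
  shows "\<bar>sup_laplace c\<bar> \<le> 1"
proof -
  have e: "AE \<omega> in M. exp (- (c * sup_process X 1 \<omega>)) \<le> 1"
    using AE_sup_nonneg by eventually_elim (use c in simp)
  have "sup_laplace c \<le> expectation (\<lambda>_. 1)"
    using e by (intro integral_mono_AE integrable_const_bound[where B=1]) auto
  moreover have "0 \<le> sup_laplace c" by (intro integral_nonneg_AE) auto
  ultimately show ?thesis by (simp add: prob_space)
qed

text \<open>By \<open>geometric_sum_eq_step_integral\<close> the generating function of the walk of step \<open>h\<close> is the transform
of its maximum at the exponential time rounded down to the grid.\<close>

lemma geometric_sum_tendsto_sup_transform:
  assumes S [measurable]: "sup_process X 1 \<in> borel_measurable M" and a: "0 \<le> a"
    and h: "\<And>j. 0 < h j" and h0: "h \<longlonglongrightarrow> 0"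
  shows "(\<lambda>j. (\<Sum>n. (\<integral>x. exp (- a * x) \<partial>max_law (distr M borel (X (h j))) n) * exp (- h j) ^ n) * (1 - exp (- h j)))
     \<longlonglongrightarrow> sup_transform a"
proof -
  define c where "c j n = expectation (\<lambda>\<omega>. exp (- (a * (h j * real n) powr (1 / \<alpha>) * grid_max n \<omega>)))" for j n
  have c1: "\<bar>c j n\<bar> \<le> 1" for j n
    unfolding c_def using a by (intro exp_grid_bound) simp
  have eq: "(\<Sum>n. (\<integral>x. exp (- a * x) \<partial>max_law (distr M borel (X (h j))) n) * exp (- h j) ^ n) * (1 - exp (- h j)) =
     (LBINT t:{0..}. exp (- t) * c j (nat \<lfloor>t / h j\<rfloor>))" for j
    unfolding integral_max_law[OF h] c_def[symmetric]
    by (rule geometric_sum_eq_step_integral[OF c1 h, symmetric])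
  have "(\<lambda>j. LBINT t:{0..}. exp (- t) * c j (nat \<lfloor>t / h j\<rfloor>)) \<longlonglongrightarrow> sup_transform a"
    unfolding sup_transform_def set_lebesgue_integral_def
  proof (rule integral_dominated_convergence[where w="\<lambda>t::real. indicator {0..} t *\<^sub>R exp (- t)"])
    show "integrable lborel (\<lambda>t::real. indicat_real {0..} t *\<^sub>R exp (- t))"
      using integrable_exp_decay by (simp add: set_integrable_def)
    show "AE t in lborel. norm (indicat_real {0..} t *\<^sub>R (exp (- t) * c j (nat \<lfloor>t / h j\<rfloor>))) \<le> indicat_real {0..} t *\<^sub>R exp (- t)" for j
      using c1 by (intro AE_I2) (auto simp: indicator_def abs_mult mult_left_le)
    show "AE t in lborel. (\<lambda>j. indicat_real {0..} t *\<^sub>R (exp (- t) * c j (nat \<lfloor>t / h j\<rfloor>))) \<longlonglongrightarrow>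
       indicat_real {0..} t *\<^sub>R (exp (- t) * sup_laplace (a * t powr (1 / \<alpha>)))"
      using AE_lborel_singleton[of 0]
    proof eventually_elim
      fix t :: real assume t: "t \<noteq> 0"
      show "(\<lambda>j. indicat_real {0..} t *\<^sub>R (exp (- t) * c j (nat \<lfloor>t / h j\<rfloor>))) \<longlonglongrightarrow>
       indicat_real {0..} t *\<^sub>R (exp (- t) * sup_laplace (a * t powr (1 / \<alpha>)))"
      proof (cases "0 < t")
        case True
        \<comment> \<open>The step function samples the walk at time \<open>N j\<close>, which tends to infinity with \<open>h j * N j\<close>
          tending to \<open>t\<close>.\<close>
        define N where "N j = nat \<lfloor>t / h j\<rfloor>" for j
        have N: "real (N j) \<le> t / h j" "t / h j < real (N j) + 1" for j
        proof -
          have "0 \<le> t / h j" using True h[of j] by simp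
          then have "real (N j) = of_int \<lfloor>t / h j\<rfloor>" by (simp add: N_def)
          then show "real (N j) \<le> t / h j" "t / h j < real (N j) + 1"
            by linarith+
        qed
        have "filterlim (\<lambda>j. t * inverse (h j)) at_top sequentially"
          using True h h0
          by (intro filterlim_tendsto_pos_mult_at_top[OF tendsto_const] filterlim_inverse_at_top) auto
        then have "filterlim (\<lambda>j. real (N j) + 1) at_top sequentially"
          by (rule filterlim_at_top_mono) (use N in \<open>auto intro!: always_eventually less_imp_le simp: divide_inverse\<close>)
        then have "filterlim (\<lambda>j. (- 1) + (real (N j) + 1)) at_top sequentially"
          by (intro filterlim_tendsto_add_at_top[OF tendsto_const])
        then have Nlim: "filterlim N sequentially sequentially"
          by (simp add: filterlim_sequentially_iff_filterlim_real)
        have "(\<lambda>j. h j * real (N j)) \<longlonglongrightarrow> t"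
        proof (rule tendsto_sandwich[of "\<lambda>j. t - h j" _ _ "\<lambda>_. t"])
          show "\<forall>\<^sub>F j in sequentially. t - h j \<le> h j * real (N j)"
            using N(2) h by (intro always_eventually) (auto simp: field_simps intro: less_imp_le)
          show "\<forall>\<^sub>F j in sequentially. h j * real (N j) \<le> t"
            using N(1) h by (intro always_eventually) (auto simp: field_simps)
          show "(\<lambda>j. t - h j) \<longlonglongrightarrow> t" using tendsto_diff[OF tendsto_const h0, of t] by simp
        qed simp
        then have "(\<lambda>j. a * (h j * real (N j)) powr (1 / \<alpha>)) \<longlonglongrightarrow> a * t powr (1 / \<alpha>)"
          using True by (intro tendsto_intros) auto
        from sup_laplace_limit[OF S Nlim this] a
        have "(\<lambda>j. c j (N j)) \<longlonglongrightarrow> sup_laplace (a * t powr (1 / \<alpha>))"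
          unfolding c_def by simp
        then show ?thesis unfolding N_def by (intro tendsto_intros)
      qed (use t in simp)
    qed
  qed measurable
  then show ?thesis unfolding eq .
qed

text \<open>Spitzer's identity for the walk of step \<open>h\<close>, divided at two points, has a convergent exponent even
though the exponents themselves diverge as \<open>h\<close> tends to zero.\<close>

theorem sup_transform_ratio:
  assumes S: "sup_process X 1 \<in> borel_measurable M" and ab: "0 < a" "a < b"
  shows "sup_transform b = sup_transform a *
     exp (1 / pi * Re (wh_integral \<alpha> \<rho> a b))"
proof -
  define h where "h j = 1 / real (Suc j)" for j
  have h: "0 < h j" "h j \<le> 1" for j by (auto simp: h_def)
  have h0: "h \<longlonglongrightarrow> 0" unfolding h_def by (rule LIMSEQ_Suc[OF lim_1_over_n])
  define \<nu> where "\<nu> j = distr M borel (X (h j))" for j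
  have \<nu>: "real_distribution (\<nu> j)" for j unfolding \<nu>_def using h(1)[of j] by (intro real_distribution_X) simp
  define w where "w j = walk_law (\<nu> j)" for j
  have w: "real_distribution (w j k)" for j k unfolding w_def by (rule real_distribution_walk_law[OF \<nu>])
  have char_w: "char (w j k) t = exp (- (real k * h j * stable_exponent \<alpha> \<rho> t))" for j k t
  proof -
    have "char (\<nu> j) t = exp (- (h j * stable_exponent \<alpha> \<rho> t))"
      unfolding \<nu>_def using h(1)[of j] by (intro char_X) simp
    then show ?thesis
      unfolding w_def char_walk_law[OF \<nu>] by (simp add: exp_of_nat_mult[symmetric] mult.assoc)
  qed
  define p where "p c j k = (\<integral>x. exp (- c * max 0 x) \<partial>w j k)" for c j k
  define P where "P c j = (\<Sum>k. p c j k / real k * exp (- h j) ^ k)" for c j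
  define \<Phi> where "\<Phi> c j = (\<Sum>n. (\<integral>x. exp (- c * x) \<partial>max_law (\<nu> j) n) * exp (- h j) ^ n) * (1 - exp (- h j))" for c j
  have \<Phi>_eq: "\<Phi> c j = exp (P c j) * (1 - exp (- h j))" if "0 < c" for c j
    unfolding \<Phi>_def P_def p_def w_def using that h(1)[of j]
    by (subst Spitzer_identity[OF \<nu>]) auto
  have \<Phi>_lim: "\<Phi> c \<longlonglongrightarrow> sup_transform c" if "0 < c" for c
    unfolding \<Phi>_def \<nu>_def using that by (intro geometric_sum_tendsto_sup_transform S h h0) simp
  have int: "integrable (w j k) (\<lambda>x. exp (- c * max 0 x))" if "0 < c" for c j k
    using that by (intro real_distribution_integrable_bounded[OF w, where B=1]) auto
  have p1: "\<bar>p c j k\<bar> \<le> 1" if "0 < c" for c j k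
  proof -
    interpret wjk: real_distribution "w j k" by (rule w)
    have "p c j k \<le> (\<integral>x. 1 \<partial>w j k)"
      unfolding p_def using that by (intro integral_mono int) auto
    moreover have "0 \<le> p c j k" unfolding p_def by (intro integral_nonneg_AE) auto
    ultimately show ?thesis using wjk.prob_space by simp
  qed
  have summ: "summable (\<lambda>k. p c j k / real k * exp (- h j) ^ k)" if "0 < c" for c j
  proof (rule summable_comparison_test'[of "\<lambda>k. exp (- h j) ^ k" 0])
    show "summable (\<lambda>k. exp (- h j) ^ k)" using h(1)[of j] by (intro summable_geometric) simp
    show "norm (p c j k / real k * exp (- h j) ^ k) \<le> exp (- h j) ^ k" for k
    proof -
      have "\<bar>p c j k / real k\<bar> \<le> 1"
        using p1[OF that, of j k] by (cases "k = 0") (auto simp: divide_le_eq)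
      from mult_right_mono[OF this, of "exp (- h j) ^ k"] show ?thesis by (simp add: abs_mult)
    qed
  qed
  have b: "0 < b" using ab by simp
  have "P a j - P b j = (\<Sum>k. (\<integral>x. exp (- a * max 0 x) - exp (- b * max 0 x) \<partial>w j k) / real k * exp (- h j) ^ k)" for j
  proof -
    have "P a j - P b j = (\<Sum>k. p a j k / real k * exp (- h j) ^ k - p b j k / real k * exp (- h j) ^ k)"
      unfolding P_def by (rule suminf_diff[OF summ[OF ab(1)] summ[OF b]])
    also have "\<dots> = (\<Sum>k. (\<integral>x. exp (- a * max 0 x) - exp (- b * max 0 x) \<partial>w j k) / real k * exp (- h j) ^ k)"
      unfolding p_def Bochner_Integration.integral_diff[OF int[OF ab(1)] int[OF b]]
      by (simp add: diff_divide_distrib left_diff_distrib)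
    finally show ?thesis .
  qed
  with spitzer_exponent_limit[OF ab alpha_pos skewness_bound h h0 w char_w]
  have "(\<lambda>j. P a j - P b j) \<longlonglongrightarrow> - (1 / pi) * Re (wh_integral \<alpha> \<rho> a b)"
    by simp
  from tendsto_minus[OF this]
  have "(\<lambda>j. P b j - P a j) \<longlonglongrightarrow> 1 / pi * Re (wh_integral \<alpha> \<rho> a b)" by simp
  then have "(\<lambda>j. \<Phi> a j * exp (P b j - P a j)) \<longlonglongrightarrow>
      sup_transform a * exp (1 / pi * Re (wh_integral \<alpha> \<rho> a b))"
    by (intro tendsto_mult \<Phi>_lim tendsto_exp ab)
  moreover have "\<Phi> a j * exp (P b j - P a j) = \<Phi> b j" for j
    unfolding \<Phi>_eq[OF ab(1)] \<Phi>_eq[OF b] by (simp add: exp_diff)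
  ultimately have "\<Phi> b \<longlonglongrightarrow> sup_transform a * exp (1 / pi * Re (wh_integral \<alpha> \<rho> a b))"
    by simp
  with \<Phi>_lim[OF b] show ?thesis by (rule LIMSEQ_unique)
qed

lemma sup_transform_tendsto_1:
  assumes S [measurable]: "sup_process X 1 \<in> borel_measurable M" and a: "\<And>i. 0 \<le> a i" "a \<longlonglongrightarrow> 0"
  shows "(\<lambda>i. sup_transform (a i)) \<longlonglongrightarrow> 1"
proof -
  have "(\<lambda>i. sup_transform (a i)) \<longlonglongrightarrow> (LBINT t:{0..}. exp (- t) * 1)"
    unfolding sup_transform_def set_lebesgue_integral_def
  proof (rule integral_dominated_convergence[where w="\<lambda>t::real. indicator {0..} t *\<^sub>R exp (- t)"])
    show "integrable lborel (\<lambda>t::real. indicat_real {0..} t *\<^sub>R exp (- t))"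
      using integrable_exp_decay by (simp add: set_integrable_def)
    have e: "\<bar>sup_laplace (a i * t powr (1 / \<alpha>))\<bar> \<le> 1" for i t
      using a(1) by (intro exp_sup_bound S) simp
    show "AE t in lborel. norm (indicat_real {0..} t *\<^sub>R (exp (- t) * sup_laplace (a i * t powr (1 / \<alpha>)))) \<le> indicat_real {0..} t *\<^sub>R exp (- t)" for i
      using e by (intro AE_I2) (auto simp: indicator_def abs_mult mult_left_le)
    show "AE t in lborel. (\<lambda>i. indicat_real {0..} t *\<^sub>R (exp (- t) * sup_laplace (a i * t powr (1 / \<alpha>)))) \<longlonglongrightarrow>
       indicat_real {0..} t *\<^sub>R (exp (- t) * 1)"
    proof (rule AE_I2)
      fix t :: real
      have "(\<lambda>i. sup_laplace (a i * t powr (1 / \<alpha>))) \<longlonglongrightarrow> expectation (\<lambda>\<omega>. 1)"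
      proof (rule integral_dominated_convergence[where w="\<lambda>_. 1"])
        show "AE \<omega> in M. (\<lambda>i. exp (- (a i * t powr (1 / \<alpha>) * sup_process X 1 \<omega>))) \<longlonglongrightarrow> 1"
        proof (rule AE_I2)
          fix \<omega>
          have "(\<lambda>i. exp (- (a i * t powr (1 / \<alpha>) * sup_process X 1 \<omega>))) \<longlonglongrightarrow> exp (- (0 * t powr (1 / \<alpha>) * sup_process X 1 \<omega>))"
            by (intro tendsto_intros a(2))
          then show "(\<lambda>i. exp (- (a i * t powr (1 / \<alpha>) * sup_process X 1 \<omega>))) \<longlonglongrightarrow> 1" by simp
        qed
        show "AE \<omega> in M. norm (exp (- (a i * t powr (1 / \<alpha>) * sup_process X 1 \<omega>))) \<le> 1" for i
          using AE_sup_nonneg by eventually_elim (use a(1) in simp)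
      qed auto
      then show "(\<lambda>i. indicat_real {0..} t *\<^sub>R (exp (- t) * sup_laplace (a i * t powr (1 / \<alpha>)))) \<longlonglongrightarrow>
         indicat_real {0..} t *\<^sub>R (exp (- t) * 1)"
        by (intro tendsto_intros) (simp add: prob_space)
    qed
  qed measurable
  then show ?thesis using integral_exp_decay by simp
qed

end

text \<open>Both transforms satisfy the ratio formula with the same factor by \<open>wh_integral_dual\<close>, and both tend
to \<open>1\<close> at zero.\<close>

theorem sup_transform_dual:
  assumes X: "stable_process M X \<alpha> \<rho>" and X': "stable_process M' X' (1 / \<alpha>) (\<alpha> * \<rho>)"
    and S: "sup_process X 1 \<in> borel_measurable M" and S': "sup_process X' 1 \<in> borel_measurable M'"
    and \<rho>: "0 < \<rho>" "\<rho> < 1" and b: "0 < b"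
  shows "stable_process.sup_transform M X \<alpha> b = stable_process.sup_transform M' X' (1 / \<alpha>) (b powr \<alpha>)"
proof -
  interpret X: stable_process M X \<alpha> \<rho> by fact
  interpret X': stable_process M' X' "1 / \<alpha>" "\<alpha> * \<rho>" by fact
  note \<alpha> = X.alpha_pos
  define a where "a i = b / (2 + real i)" for i
  have a: "0 < a i" "a i < b" for i using b by (auto simp: a_def divide_less_eq)
  have a0: "a \<longlonglongrightarrow> 0"
    unfolding a_def using b
    by (intro tendsto_divide_0[OF tendsto_const] filterlim_at_top_imp_at_infinity
        filterlim_tendsto_add_at_top[OF tendsto_const] filterlim_real_sequentially)
  have a0': "(\<lambda>i. a i powr \<alpha>) \<longlonglongrightarrow> 0"
    using tendsto_powr2[OF a0 tendsto_const[of \<alpha>]] a \<alpha> by (auto intro!: always_eventually less_imp_le)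
  define E where "E i = exp (1 / pi * Re (wh_integral \<alpha> \<rho> (a i) b))" for i
  have E': "E i = exp (1 / pi * Re (wh_integral (1 / \<alpha>) (\<alpha> * \<rho>) (a i powr \<alpha>) (b powr \<alpha>)))" for i
    unfolding E_def
    by (subst wh_integral_dual[OF a(1) b \<alpha> \<rho> X.skewness_bound X'.skewness_bound]) (rule refl)
  have 1: "X.sup_transform b = X.sup_transform (a i) * E i" for i
    unfolding E_def by (rule X.sup_transform_ratio[OF S a])
  have 2: "X'.sup_transform (b powr \<alpha>) = X'.sup_transform (a i powr \<alpha>) * E i" for i
    unfolding E' using a[of i] \<alpha> by (intro X'.sup_transform_ratio[OF S'] powr_less_mono2) auto
  have "(\<lambda>i. X.sup_transform b * X'.sup_transform (a i powr \<alpha>)) \<longlonglongrightarrow> X.sup_transform b * 1"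
    by (intro tendsto_mult tendsto_const X'.sup_transform_tendsto_1 S' a0') simp
  moreover have "(\<lambda>i. X'.sup_transform (b powr \<alpha>) * X.sup_transform (a i)) \<longlonglongrightarrow> X'.sup_transform (b powr \<alpha>) * 1"
    using a(1) by (intro tendsto_mult tendsto_const X.sup_transform_tendsto_1 S a0) (auto intro: less_imp_le)
  moreover have "X.sup_transform b * X'.sup_transform (a i powr \<alpha>) = X'.sup_transform (b powr \<alpha>) * X.sup_transform (a i)" for i
    unfolding 1[of i] 2[of i] by simp
  ultimately show ?thesis by (simp add: LIMSEQ_unique)
qed

section \<open>From transforms to distributions\<close>

text \<open>Conditionally on \<open>W\<close> the exponential variable exceeds it with probability \<open>exp (- W)\<close>.\<close>

lemma (in prob_space) prob_less_exponential:
  assumes ind: "indep_var borel W borel E" and E: "distributed M lborel E (exponential_density 1)"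
    and W: "AE \<omega> in M. 0 \<le> W \<omega>"
  shows "prob {\<omega> \<in> space M. W \<omega> < E \<omega>} = expectation (\<lambda>\<omega>. exp (- W \<omega>))"
proof -
  have [measurable]: "random_variable borel W" "random_variable borel E"
    using indep_var_rv1[OF ind] indep_var_rv2[OF ind] by auto
  interpret DW: prob_space "distr M borel W" by (rule prob_space_distr) simp
  interpret DE: prob_space "distr M borel E" by (rule prob_space_distr) simp
  interpret P: pair_prob_space "distr M borel W" "distr M borel E" ..
  let ?A = "{p :: real \<times> real. fst p < snd p}"
  have A [measurable]: "?A \<in> sets (borel \<Otimes>\<^sub>M borel)"
  proof -
    have "{p \<in> space (borel \<Otimes>\<^sub>M borel :: (real \<times> real) measure). fst p < snd p} \<in> sets (borel \<Otimes>\<^sub>M borel)"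
      by measurable
    then show ?thesis by (simp add: space_pair_measure)
  qed
  have joint: "distr M borel W \<Otimes>\<^sub>M distr M borel E = distr M (borel \<Otimes>\<^sub>M borel) (\<lambda>\<omega>. (W \<omega>, E \<omega>))"
    using ind unfolding indep_var_distribution_eq by simp
  have tail: "(\<integral>e. indicator ?A (w, e) \<partial>distr M borel E) = measure (distr M borel E) {w<..}" for w
  proof -
    have "(\<integral>e. indicator ?A (w, e) \<partial>distr M borel E) = (\<integral>e. indicat_real {w<..} e \<partial>distr M borel E)"
      by (intro Bochner_Integration.integral_cong refl) (auto simp: indicator_def)
    then show ?thesis by simp
  qed
  have "(\<lambda>w. \<integral>e. indicat_real ?A (w, e) \<partial>distr M borel E) \<in> borel_measurable borel"
    by measurable
  then have [measurable]: "(\<lambda>w. measure (distr M borel E) {w<..}) \<in> borel_measurable borel"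
    unfolding tail .
  have "prob {\<omega> \<in> space M. W \<omega> < E \<omega>} = measure (distr M borel W \<Otimes>\<^sub>M distr M borel E) ?A"
    unfolding joint by (subst measure_distr) (auto intro!: arg_cong[where f=prob])
  also have "\<dots> = (\<integral>p. indicator ?A p \<partial>(distr M borel W \<Otimes>\<^sub>M distr M borel E))"
    by (simp add: space_pair_measure)
  also have "\<dots> = (\<integral>w. (\<integral>e. indicator ?A (w, e) \<partial>distr M borel E) \<partial>distr M borel W)"
    by (subst P.integral_fst'[symmetric]) (auto intro!: P.P.integrable_const_bound[where B=1])
  also have "\<dots> = (\<integral>w. measure (distr M borel E) {w<..} \<partial>distr M borel W)"
    by (simp only: tail)
  also have "\<dots> = expectation (\<lambda>\<omega>. measure (distr M borel E) {W \<omega><..})"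
    by (rule integral_distr) simp_all
  also have "\<dots> = expectation (\<lambda>\<omega>. exp (- W \<omega>))"
  proof (rule integral_cong_AE)
    show "AE \<omega> in M. measure (distr M borel E) {W \<omega><..} = exp (- W \<omega>)"
      using W
    proof eventually_elim
      case (elim \<omega>)
      then show ?case
        using exponential_distributedD_gt[OF E _ zero_less_one, of "W \<omega>"] by (subst measure_distr) (auto simp: vimage_def Int_def conj_commute)
    qed
    show "(\<lambda>\<omega>. measure (distr M borel E) {W \<omega><..}) \<in> borel_measurable M" by measurable
  qed simp
  finally show ?thesis .
qed

lemma (in prob_space) exponential_AE_pos:
  assumes E: "distributed M lborel E (exponential_density 1)"
  shows "AE \<omega> in M. 0 < E \<omega>"
proof -
  have [measurable]: "random_variable borel E" using distributed_measurable[OF E] by simp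
  have "prob {\<omega> \<in> space M. 0 < E \<omega>} = 1" using exponential_distributedD_gt[OF E _ zero_less_one, of 0] by simp
  then show ?thesis by (subst (asm) prob_Collect_eq_1) auto
qed

lemma (in prob_space) expectation_exponential_mixture:
  fixes f :: "real \<Rightarrow> real \<Rightarrow> real"
  assumes ind: "indep_var borel E borel S" and E: "distributed M lborel E (exponential_density 1)"
    and [measurable]: "case_prod f \<in> borel_measurable (borel \<Otimes>\<^sub>M borel)"
    and B: "\<And>t s. \<bar>f t s\<bar> \<le> 1"
  shows "expectation (\<lambda>\<omega>. f (E \<omega>) (S \<omega>)) = (LBINT t:{0..}. exp (- t) * expectation (\<lambda>\<omega>. f t (S \<omega>)))"
proof -
  have [measurable]: "random_variable borel E" "random_variable borel S"
    using indep_var_rv1[OF ind] indep_var_rv2[OF ind] by auto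
  interpret DE: prob_space "distr M borel E" by (rule prob_space_distr) simp
  interpret DS: prob_space "distr M borel S" by (rule prob_space_distr) simp
  interpret P: pair_prob_space "distr M borel E" "distr M borel S" ..
  have joint: "distr M borel E \<Otimes>\<^sub>M distr M borel S = distr M (borel \<Otimes>\<^sub>M borel) (\<lambda>\<omega>. (E \<omega>, S \<omega>))"
    using ind unfolding indep_var_distribution_eq by simp
  have "expectation (\<lambda>\<omega>. f (E \<omega>) (S \<omega>)) = (\<integral>p. case_prod f p \<partial>(distr M borel E \<Otimes>\<^sub>M distr M borel S))"
    unfolding joint by (subst integral_distr) auto
  also have "\<dots> = (\<integral>t. (\<integral>s. f t s \<partial>distr M borel S) \<partial>distr M borel E)"
    by (subst P.integral_fst'[symmetric]) (use B in \<open>auto intro!: P.P.integrable_const_bound[where B=1]\<close>)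
  also have "\<dots> = (\<integral>t. expectation (\<lambda>\<omega>. f t (S \<omega>)) \<partial>distr M borel E)"
    by (intro Bochner_Integration.integral_cong refl integral_distr) auto
  also have "distr M borel E = density lborel (exponential_density 1)"
    using distributed_distr_eq_density[OF E] by (simp cong: distr_cong)
  also have "(\<integral>t. expectation (\<lambda>\<omega>. f t (S \<omega>)) \<partial>density lborel (exponential_density 1)) =
     (\<integral>t. exponential_density 1 t * expectation (\<lambda>\<omega>. f t (S \<omega>)) \<partial>lborel)"
    by (subst integral_density) auto
  also have "\<dots> = (LBINT t:{0..}. exp (- t) * expectation (\<lambda>\<omega>. f t (S \<omega>)))"
    unfolding set_lebesgue_integral_def
    by (intro Bochner_Integration.integral_cong refl) (auto simp: exponential_density_def indicator_def)
  finally show ?thesis .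
qed

text \<open>Two exponential variables are integrated out: \<open>Z k\<close> by its tail, which produces a Laplace transform,
and \<open>Z j\<close> by its density.\<close>

lemma (in prob_space) prob_exponential_quotient:
  assumes ind: "indep_vars (\<lambda>_. borel) Z I" and I: "i \<in> I" "j \<in> I" "k \<in> I" "i \<noteq> j" "i \<noteq> k" "j \<noteq> k"
    and S: "AE \<omega> in M. 0 \<le> Z i \<omega>"
    and E: "distributed M lborel (Z j) (exponential_density 1)" "distributed M lborel (Z k) (exponential_density 1)"
    and c: "0 \<le> c"
  shows "prob {\<omega> \<in> space M. c * Z j \<omega> powr \<kappa> * Z i \<omega> < Z k \<omega>} =
     (LBINT t:{0..}. exp (- t) * expectation (\<lambda>\<omega>. exp (- (c * t powr \<kappa> * Z i \<omega>))))"
proof -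
  have [measurable]: "random_variable borel (Z i)" "random_variable borel (Z j)" "random_variable borel (Z k)"
    using ind I unfolding indep_vars_def by auto
  have "indep_var (PiM {i, j} (\<lambda>_. borel)) (\<lambda>\<omega>. restrict (\<lambda>i. Z i \<omega>) {i, j})
     (PiM {k} (\<lambda>_. borel)) (\<lambda>\<omega>. restrict (\<lambda>i. Z i \<omega>) {k})"
    using I by (intro indep_var_restrict[OF ind]) auto
  then have "indep_var borel ((\<lambda>f. c * f j powr \<kappa> * f i) \<circ> (\<lambda>\<omega>. restrict (\<lambda>i. Z i \<omega>) {i, j}))
     borel ((\<lambda>f. f k) \<circ> (\<lambda>\<omega>. restrict (\<lambda>i. Z i \<omega>) {k}))"
  proof (rule indep_var_compose)
    have [measurable]: "(\<lambda>f. f j) \<in> borel_measurable (PiM {i, j} (\<lambda>_. borel :: real measure))"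
      "(\<lambda>f. f i) \<in> borel_measurable (PiM {i, j} (\<lambda>_. borel :: real measure))"
      by (rule measurable_component_singleton, simp)+
    show "(\<lambda>f. c * f j powr \<kappa> * f i) \<in> borel_measurable (PiM {i, j} (\<lambda>_. borel))"
      by measurable
  qed (rule measurable_component_singleton, simp)
  then have 1: "indep_var borel (\<lambda>\<omega>. c * Z j \<omega> powr \<kappa> * Z i \<omega>) borel (Z k)"
    by (simp add: comp_def)
  have "indep_var (PiM {j} (\<lambda>_. borel)) (\<lambda>\<omega>. restrict (\<lambda>i. Z i \<omega>) {j})
     (PiM {i} (\<lambda>_. borel)) (\<lambda>\<omega>. restrict (\<lambda>i. Z i \<omega>) {i})"
    using I by (intro indep_var_restrict[OF ind]) auto
  then have "indep_var borel ((\<lambda>f. f j) \<circ> (\<lambda>\<omega>. restrict (\<lambda>i. Z i \<omega>) {j}))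
     borel ((\<lambda>f. f i) \<circ> (\<lambda>\<omega>. restrict (\<lambda>i. Z i \<omega>) {i}))"
    by (rule indep_var_compose) auto
  then have 2: "indep_var borel (Z j) borel (Z i)"
    by (simp add: comp_def)
  have "prob {\<omega> \<in> space M. c * Z j \<omega> powr \<kappa> * Z i \<omega> < Z k \<omega>} = expectation (\<lambda>\<omega>. exp (- (c * Z j \<omega> powr \<kappa> * Z i \<omega>)))"
    by (rule prob_less_exponential[OF 1 E(2)]) (use S c in \<open>auto elim!: eventually_mono\<close>)
  also have "\<dots> = expectation (\<lambda>\<omega>. exp (- (c * Z j \<omega> powr \<kappa> * max 0 (Z i \<omega>))))"
  proof (rule integral_cong_AE)
    show "AE \<omega> in M. exp (- (c * Z j \<omega> powr \<kappa> * Z i \<omega>)) = exp (- (c * Z j \<omega> powr \<kappa> * max 0 (Z i \<omega>)))"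
      using S by eventually_elim (simp only: max_absorb2)
  qed measurable
  also have "\<dots> = (LBINT t:{0..}. exp (- t) * expectation (\<lambda>\<omega>. exp (- (c * t powr \<kappa> * max 0 (Z i \<omega>)))))"
    by (rule expectation_exponential_mixture[OF 2 E(1), where f="\<lambda>t s. exp (- (c * t powr \<kappa> * max 0 s))"])
      (use c in \<open>auto simp: case_prod_beta\<close>)
  also have "\<dots> = (LBINT t:{0..}. exp (- t) * expectation (\<lambda>\<omega>. exp (- (c * t powr \<kappa> * Z i \<omega>))))"
  proof -
    have "expectation (\<lambda>\<omega>. exp (- (c * t powr \<kappa> * max 0 (Z i \<omega>)))) = expectation (\<lambda>\<omega>. exp (- (c * t powr \<kappa> * Z i \<omega>)))" for t
    proof (rule integral_cong_AE)
      show "AE \<omega> in M. exp (- (c * t powr \<kappa> * max 0 (Z i \<omega>))) = exp (- (c * t powr \<kappa> * Z i \<omega>))"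
        using S by eventually_elim (simp only: max_absorb2)
    qed measurable
    then show ?thesis by simp
  qed
  finally show ?thesis .
qed

lemma distr_eq_if_lessThan_eq:
  assumes "prob_space M" "U \<in> borel_measurable M" "V \<in> borel_measurable M"
    and eq: "\<And>y::real. measure M {\<omega> \<in> space M. U \<omega> < y} = measure M {\<omega> \<in> space M. V \<omega> < y}"
  shows "distr M borel U = distr M borel V"
proof -
  interpret prob_space M by fact
  note [measurable] = assms(2,3)
  show ?thesis
  proof (rule measure_eqI_generator_eq[where E="range lessThan" and \<Omega>=UNIV and A="\<lambda>n. {..<real n}"])
    show "Int_stable (range lessThan :: real set set)"
    proof (rule Int_stableI)
      fix A B :: "real set" assume "A \<in> range lessThan" "B \<in> range lessThan"
      then obtain a b where "A = {..<a}" "B = {..<b}" by auto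
      then have "A \<inter> B = {..<min a b}" by auto
      then show "A \<inter> B \<in> range lessThan" by blast
    qed
    show "emeasure (distr M borel U) Y = emeasure (distr M borel V) Y" if "Y \<in> range lessThan" for Y
    proof -
      from that obtain y where Y: "Y = {..<y}" by auto
      have "U -` Y \<inter> space M = {\<omega> \<in> space M. U \<omega> < y}" "V -` Y \<inter> space M = {\<omega> \<in> space M. V \<omega> < y}"
        unfolding Y by auto
      then show ?thesis using eq[of y] by (simp add: emeasure_distr Y emeasure_eq_measure)
    qed
    show "(\<Union>n. {..<real n}) = (UNIV :: real set)"
      using reals_Archimedean2 by auto
    show "emeasure (distr M borel U) {..<real n} \<noteq> \<infinity>" for n
      by (simp add: emeasure_distr)
  qed (auto simp: borel_Iio)
qed

lemma powr_quotient_less_iff: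
  fixes e e' s y \<alpha> :: real
  assumes "0 < e" "0 < e'" "0 \<le> s" "0 < y" "0 < \<alpha>"
  shows "e * (s / e') powr \<alpha> < y \<longleftrightarrow> y powr (- (1 / \<alpha>)) * e powr (1 / \<alpha>) * s < e'"
proof -
  define u where "u = e powr (1 / \<alpha>) * (s / e')"
  have u: "0 \<le> u" using assms by (simp add: u_def)
  have "e * (s / e') powr \<alpha> = u powr \<alpha>"
    unfolding u_def using assms by (subst powr_mult) (simp_all add: powr_powr)
  moreover have "y = (y powr (1 / \<alpha>)) powr \<alpha>" using assms by (simp add: powr_powr)
  moreover have "u powr \<alpha> < (y powr (1 / \<alpha>)) powr \<alpha> \<longleftrightarrow> u < y powr (1 / \<alpha>)"
    using u assms powr_less_mono2[of \<alpha> u "y powr (1 / \<alpha>)"] powr_mono2[of \<alpha> "y powr (1 / \<alpha>)" u]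
    by (auto simp: not_less[symmetric] simp del: not_less)
  moreover have "u < y powr (1 / \<alpha>) \<longleftrightarrow> y powr (- (1 / \<alpha>)) * e powr (1 / \<alpha>) * s < e'"
    using assms by (simp add: u_def powr_minus field_simps)
  ultimately show ?thesis by metis
qed

theorem corollary4:
  fixes M :: "'a measure"
    and X X' :: "real \<Rightarrow> 'a \<Rightarrow> real"
    and \<epsilon>\<^sub>1 \<epsilon>\<^sub>2 \<epsilon>\<^sub>3 \<epsilon>\<^sub>4 :: "'a \<Rightarrow> real"
    and \<alpha> \<rho> :: real
  assumes "\<alpha> \<in> {1/2<..<1} \<union> {1<..<2}"
    and "(\<alpha>, \<rho>) \<in> admissible" and "(1/\<alpha>, \<alpha> * \<rho>) \<in> admissible"
    and "stable_process M X \<alpha> \<rho>"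
    and "stable_process M X' (1/\<alpha>) (\<alpha> * \<rho>)"
    and "distributed M lborel \<epsilon>\<^sub>1 (exponential_density 1)"
    and "distributed M lborel \<epsilon>\<^sub>2 (exponential_density 1)"
    and "distributed M lborel \<epsilon>\<^sub>3 (exponential_density 1)"
    and "distributed M lborel \<epsilon>\<^sub>4 (exponential_density 1)"
    and "prob_space.indep_vars M (\<lambda>_. borel)
           (\<lambda>i. [sup_process X 1, sup_process X' 1, \<epsilon>\<^sub>1, \<epsilon>\<^sub>2, \<epsilon>\<^sub>3, \<epsilon>\<^sub>4] ! i) {..<6}"
  shows "distr M borel (\<lambda>\<omega>. \<epsilon>\<^sub>1 \<omega> * (sup_process X 1 \<omega> / \<epsilon>\<^sub>2 \<omega>) powr \<alpha>) =
         distr M borel (\<lambda>\<omega>. \<epsilon>\<^sub>3 \<omega> powr \<alpha> * (sup_process X' 1 \<omega> / \<epsilon>\<^sub>4 \<omega>))"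
proof -
  interpret X: stable_process M X \<alpha> \<rho> by fact
  interpret X': stable_process M X' "1 / \<alpha>" "\<alpha> * \<rho>" by fact
  define S where "S = sup_process X 1"
  define S' where "S' = sup_process X' 1"
  define Z where "Z = (\<lambda>i. [S, S', \<epsilon>\<^sub>1, \<epsilon>\<^sub>2, \<epsilon>\<^sub>3, \<epsilon>\<^sub>4] ! i)"
  have ind: "X.indep_vars (\<lambda>_. borel) Z {..<6}" using assms(10) unfolding Z_def S_def S'_def .
  have Z: "Z 0 = S" "Z 1 = S'" "Z 2 = \<epsilon>\<^sub>1" "Z 3 = \<epsilon>\<^sub>2" "Z 4 = \<epsilon>\<^sub>3" "Z 5 = \<epsilon>\<^sub>4"
    by (simp_all add: Z_def)
  have rv: "Z i \<in> borel_measurable M" if "i < 6" for i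
    using ind that unfolding X.indep_vars_def by auto
  note [measurable] = rv[of 0, unfolded Z, simplified] rv[of 1, unfolded Z, simplified] rv[of 2, unfolded Z, simplified]
    rv[of 3, unfolded Z, simplified] rv[of 4, unfolded Z, simplified] rv[of 5, unfolded Z, simplified]
  have \<alpha>: "0 < \<alpha>" by (rule X.alpha_pos)
  \<comment> \<open>For \<open>\<alpha> < 1\<close> this is admissibility of \<open>(\<alpha>, \<rho>)\<close>; for \<open>\<alpha> > 1\<close> the value \<open>\<rho> = 1/\<alpha>\<close>, and with it
    \<open>\<alpha>\<rho> = 1\<close>, is excluded by admissibility of the dual pair.\<close>
  have \<rho>: "0 < \<rho>" "\<rho> < 1"
  proof -
    have "0 < \<rho> \<and> \<rho> < 1"
    proof (cases "\<alpha> < 1")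
      case True
      then show ?thesis using assms(2) \<alpha> by (auto simp: admissible_def)
    next
      case False
      then have a: "1 < \<alpha>" using assms(1) by auto
      then have "1 / \<alpha> < 1" by simp
      then have "0 < \<alpha> * \<rho>" "\<alpha> * \<rho> < 1" using assms(3) a by (auto simp: admissible_def)
      moreover from this have "0 < \<rho>" using \<alpha> by (simp add: zero_less_mult_iff)
      moreover have "1 * \<rho> \<le> \<alpha> * \<rho>" using a \<open>0 < \<rho>\<close> by (intro mult_right_mono) auto
      ultimately show ?thesis by linarith
    qed
    then show "0 < \<rho>" "\<rho> < 1" by auto
  qed
  have pos: "AE \<omega> in M. 0 < \<epsilon>\<^sub>1 \<omega> \<and> 0 < \<epsilon>\<^sub>2 \<omega> \<and> 0 < \<epsilon>\<^sub>3 \<omega> \<and> 0 < \<epsilon>\<^sub>4 \<omega> \<and> 0 \<le> S \<omega> \<and> 0 \<le> S' \<omega>"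
    using X.exponential_AE_pos[OF assms(6)] X.exponential_AE_pos[OF assms(7)]
      X.exponential_AE_pos[OF assms(8)] X.exponential_AE_pos[OF assms(9)]
      X.AE_sup_nonneg X'.AE_sup_nonneg
    unfolding S_def S'_def by eventually_elim simp
  show ?thesis
    unfolding S_def[symmetric] S'_def[symmetric]
  proof (rule distr_eq_if_lessThan_eq)
    show "prob_space M" by (rule X.prob_space_axioms)
    fix y :: real
    show "measure M {\<omega> \<in> space M. \<epsilon>\<^sub>1 \<omega> * (S \<omega> / \<epsilon>\<^sub>2 \<omega>) powr \<alpha> < y} =
          measure M {\<omega> \<in> space M. \<epsilon>\<^sub>3 \<omega> powr \<alpha> * (S' \<omega> / \<epsilon>\<^sub>4 \<omega>) < y}"
    proof (cases "0 < y")
      case False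
      \<comment> \<open>Both sides are almost surely nonnegative.\<close>
      have null: "measure M {\<omega> \<in> space M. U \<omega> < y} = 0"
        if [measurable]: "U \<in> borel_measurable M" and "AE \<omega> in M. 0 \<le> U \<omega>" for U :: "'a \<Rightarrow> real"
      proof -
        have "AE \<omega> in M. \<not> U \<omega> < y" using that(2) by eventually_elim (use False in simp)
        then show ?thesis by (subst X.prob_Collect_eq_0) auto
      qed
      have "AE \<omega> in M. 0 \<le> \<epsilon>\<^sub>1 \<omega> * (S \<omega> / \<epsilon>\<^sub>2 \<omega>) powr \<alpha>" "AE \<omega> in M. 0 \<le> \<epsilon>\<^sub>3 \<omega> powr \<alpha> * (S' \<omega> / \<epsilon>\<^sub>4 \<omega>)"
        using pos by (eventually_elim, simp)+
      then show ?thesis by (simp add: null)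
    next
      case True
      have "measure M {\<omega> \<in> space M. \<epsilon>\<^sub>1 \<omega> * (S \<omega> / \<epsilon>\<^sub>2 \<omega>) powr \<alpha> < y} =
        measure M {\<omega> \<in> space M. y powr (- (1 / \<alpha>)) * \<epsilon>\<^sub>1 \<omega> powr (1 / \<alpha>) * S \<omega> < \<epsilon>\<^sub>2 \<omega>}"
      proof (rule X.finite_measure_eq_AE)
        show "AE \<omega> in M. \<omega> \<in> {\<omega> \<in> space M. \<epsilon>\<^sub>1 \<omega> * (S \<omega> / \<epsilon>\<^sub>2 \<omega>) powr \<alpha> < y} \<longleftrightarrow>
           \<omega> \<in> {\<omega> \<in> space M. y powr (- (1 / \<alpha>)) * \<epsilon>\<^sub>1 \<omega> powr (1 / \<alpha>) * S \<omega> < \<epsilon>\<^sub>2 \<omega>}"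
          using pos by eventually_elim (simp add: powr_quotient_less_iff True \<alpha>)
      qed measurable
      also have "\<dots> = X.sup_transform (y powr (- (1 / \<alpha>)))"
        using X.prob_exponential_quotient[OF ind, of 0 2 3 "y powr (- (1 / \<alpha>))" "1 / \<alpha>"] assms(6,7) X.AE_sup_nonneg
        unfolding Z X.sup_transform_def S_def by simp
      also have "\<dots> = X'.sup_transform ((y powr (- (1 / \<alpha>))) powr \<alpha>)"
        by (rule sup_transform_dual[OF assms(4,5) _ _ \<rho>]) (use True in \<open>simp_all flip: S_def S'_def\<close>)
      also have "(y powr (- (1 / \<alpha>))) powr \<alpha> = inverse y"
      proof -
        have "- (1 / \<alpha>) * \<alpha> = - 1" using \<alpha> by simp
        then show ?thesis unfolding powr_powr using True by (simp add: powr_minus)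
      qed
      also have "X'.sup_transform (inverse y) = measure M {\<omega> \<in> space M. inverse y * \<epsilon>\<^sub>3 \<omega> powr \<alpha> * S' \<omega> < \<epsilon>\<^sub>4 \<omega>}"
        using X.prob_exponential_quotient[OF ind, of 1 4 5 "inverse y" \<alpha>] assms(8,9) X'.AE_sup_nonneg True
        unfolding Z X'.sup_transform_def S'_def by simp
      also have "\<dots> = measure M {\<omega> \<in> space M. \<epsilon>\<^sub>3 \<omega> powr \<alpha> * (S' \<omega> / \<epsilon>\<^sub>4 \<omega>) < y}"
      proof (rule X.finite_measure_eq_AE)
        show "AE \<omega> in M. \<omega> \<in> {\<omega> \<in> space M. inverse y * \<epsilon>\<^sub>3 \<omega> powr \<alpha> * S' \<omega> < \<epsilon>\<^sub>4 \<omega>} \<longleftrightarrow>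
           \<omega> \<in> {\<omega> \<in> space M. \<epsilon>\<^sub>3 \<omega> powr \<alpha> * (S' \<omega> / \<epsilon>\<^sub>4 \<omega>) < y}"
          using pos by eventually_elim (use True in \<open>simp add: field_simps\<close>)
      qed measurable
      finally show ?thesis .
    qed
  qed measurable
qed

end
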